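(* Let $(\mathfrak g,[-,\cdots,-]_{\mathfrak g};\rho)$ be an $n$-LieRep pair, with $\rho$ a representation on $V$, and write $\mu=[-,\cdots,-]_{\mathfrak g}$. On the graded vector space $C^*(V,\mathfrak g)=\bigoplus_{m\ge 0}C^m(V,\mathfrak g)$, $C^m(V,\mathfrak g)=\mathrm{Hom}(\otimes^m(\wedge^{n-1}V)\wedge V,\mathfrak g)$ (degree $m$), define $$\{P_1,P_2,\cdots,P_n\}=[\cdots[[\mu+\rho,P_1]_{n\text{-Lie}},P_2]_{n\text{-Lie}},\cdots,P_n]_{n\text{-Lie}},\qquad P_i\in C^{m_i}(V,\mathfrak g),$$ which is an element of $C^{m_1+\cdots+m_n+1}(V,\mathfrak g)$. Then $(C^*(V,\mathfrak g),\{-,\cdots,-\})$ is a Lie $n$-algebra. Moreover, its Maurer-Cartan elements are precisely the relative Rota-Baxter operators $T:V\to\mathfrak g$ on the $n$-LieRep pair $(\mathfrak g,[-,\cdots,-]_{\mathfrak g};\rho)$.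
   Context: All vector spaces are finite dimensional over an algebraically closed field $\mathbb K$ of characteristic $0$; $n\ge 2$ is an integer; a hat denotes omission. An $n$-Lie algebra is a vector space $\mathfrak g$ with a skew-symmetric linear map $[-,\cdots,-]_{\mathfrak g}:\wedge^n\mathfrak g\to\mathfrak g$ such that $[x_1,\cdots,x_{n-1},[y_1,\cdots,y_n]]=\sum_{i=1}^n[y_1,\cdots,y_{i-1},[x_1,\cdots,x_{n-1},y_i],y_{i+1},\cdots,y_n]$. A representation of it on $V$ is a linear map $\rho:\wedge^{n-1}\mathfrak g\to\mathfrak{gl}(V)$ with (1) $[\rho(\mathfrak X),\rho(\mathfrak Y)]=\rho(\mathfrak X\circ\mathfrak Y)$ (commutator on the left), where for $\mathfrak X=x_1\wedge\cdots\wedge x_{n-1}$, $\mathfrak Y=y_1\wedge\cdots\wedge y_{n-1}$, $\mathfrak X\circ\mathfrak Y=\sum_{i=1}^{n-1}y_1\wedge\cdots\wedge[x_1,\cdots,x_{n-1},y_i]_{\mathfrak g}\wedge\cdots\wedge y_{n-1}$; and (2) $\rho(x_1,\cdots,x_{n-2},[y_1,\cdots,y_n]_{\mathfrak g})=\sum_{i=1}^n(-1)^{n-i}\rho(y_1,\cdots,\widehat{y_i},\cdots,y_n)\rho(x_1,\cdots,x_{n-2},y_i)$. An $n$-LieRep pair $(\mathfrak g,[-,\cdots,-]_{\mathfrak g};\rho)$ is an $n$-Lie algebra together with a representation $\rho$ on a vector space $V$. A relative Rota-Baxter operator on the $n$-LieRep pair is a linear map $T:V\to\mathfrak g$ with $[Tv_1,\cdots,Tv_n]_{\mathfrak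 g}=\sum_{i=1}^n(-1)^{n-i}T(\rho(Tv_1,\cdots,\widehat{Tv_i},\cdots,Tv_n)(v_i))$ for all $v_i\in V$. For a vector space $W$, $\otimes^p(\wedge^{n-1}W)\wedge W$ means $W$ if $p=0$ and $\otimes^{p-1}(\wedge^{n-1}W)\otimes\wedge^nW$ if $p\ge1$; a map on it is written $P(\mathfrak X_1,\cdots,\mathfrak X_p,x)$ with $\mathfrak X_i\in\wedge^{n-1}W$, $x\in W$. Put $C^p(W,W)=\mathrm{Hom}(\otimes^p(\wedge^{n-1}W)\wedge W,W)$ (degree $p$). $\bigoplus_{p\ge0}C^p(W,W)$ is a graded Lie algebra under $[P,Q]_{n\text{-Lie}}=P\circ Q-(-1)^{pq}Q\circ P$ for $P\in C^p$, $Q\in C^q$, where, with $\mathfrak X_i=x_i^1\wedge\cdots\wedge x_i^{n-1}$, $$(P\circ Q)(\mathfrak X_1,\cdots,\mathfrak X_{p+q},x)=\sum_{k=1}^p(-1)^{(k-1)q}\sum_{\sigma\in S(k-1,q)}(-1)^\sigma\sum_{i=1}^{n-1}P(\mathfrak X_{\sigma(1)},\cdots,\mathfrak X_{\sigma(k-1)},x_{k+q}^1\wedge\cdots\wedge x_{k+q}^{i-1}\wedge Q(\mathfrak X_{\sigma(k)},\cdots,\mathfrak X_{\sigma(k+q-1)},x_{k+q}^i)\wedge x_{k+q}^{i+1}\wedge\cdots\wedge x_{k+q}^{n-1},\mathfrak X_{k+q+1},\cdots,\mathfrak X_{p+q},x)$$ $$+\sum_{\sigma\in S(p,q)}(-1)^{pq}(-1)^\sigma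 P(\mathfrak X_{\sigma(1)},\cdots,\mathfrak X_{\sigma(p)},Q(\mathfrak X_{\sigma(p+1)},\cdots,\mathfrak X_{\sigma(p+q)},x)),$$ and $S(i,j)$ is the set of $(i,j)$-shuffles. The bracket in the claim is taken with $W=\mathfrak g\oplus V$: $\mu+\rho\in C^1(W,W)$ is the map $(x_1+u_1,\cdots,x_n+u_n)\mapsto[x_1,\cdots,x_n]_{\mathfrak g}+\sum_{i=1}^n(-1)^{n-i}\rho(x_1,\cdots,\widehat{x_i},\cdots,x_n)(u_i)$, and $P\in C^m(V,\mathfrak g)$ is viewed in $C^m(W,W)$ by applying $P$ to the $V$-components of the arguments. A Lie $n$-algebra is a $\mathbb Z$-graded vector space with an $n$-multilinear bracket $\{-,\cdots,-\}$ of degree $1$ such that for homogeneous elements $\{x_1,\cdots,x_n\}=\varepsilon(\sigma)\{x_{\sigma(1)},\cdots,x_{\sigma(n)}\}$ for all $\sigma\in S_n$ and $\sum_{\sigma\in S(n,n-1)}\varepsilon(\sigma)\{\{x_{\sigma(1)},\cdots,x_{\sigma(n)}\},x_{\sigma(n+1)},\cdots,x_{\sigma(2n-1)}\}=0$, where $\varepsilon(\sigma)$ is the Koszul sign. A Maurer-Cartan element of it is a degree $0$ element $\alpha$ with $\frac1{n!}\{\alpha,\cdots,\alpha\}=0$. *)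

theory Defs
  imports
    "HOL-Computational_Algebra.Polynomial"
    "HOL-Combinatorics.Permutations"
    "HOL-Library.Function_Algebras"
    "HOL-Analysis.Product_Vector"
begin

text \<open>
  A vector space over a field is a type with a scaling satisfying \<^locale>\<open>vector_space\<close>.
  Exterior and tensor powers are not formed explicitly: a linear map out of them is given, by their
  universal property, as a multilinear map that vanishes when two arguments of the same exterior
  power agree. Arguments are collected in lists and indexed from 0, so a sign $(-1)^{n-i}$ with
  $1 \le i \le n$ becomes $(-1)^{n-1-i}$ with $0 \le i < n$.
\<close>

definition alternating_multilinear ::
  "nat \<Rightarrow> ('k::field \<Rightarrow> 'a::ab_group_add \<Rightarrow> 'a) \<Rightarrow> ('k \<Rightarrow> 'b::ab_group_add \<Rightarrow> 'b) \<Rightarrow> ('a list \<Rightarrow> 'b) \<Rightarrow> bool"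
  where "alternating_multilinear m sA sB f \<longleftrightarrow>
    (\<forall>xs. length xs = m \<longrightarrow>
      (\<forall>i<m. Vector_Spaces.linear sA sB (\<lambda>y. f (xs[i := y]))) \<and>
      (\<not> distinct xs \<longrightarrow> f xs = 0))"

definition omit :: "nat \<Rightarrow> 'a list \<Rightarrow> 'a list"
  where "omit i xs = take i xs @ drop (Suc i) xs"


section \<open>n-Lie algebras, representations, relative Rota-Baxter operators\<close>

definition n_lie_algebra ::
  "nat \<Rightarrow> ('k::field \<Rightarrow> 'g::ab_group_add \<Rightarrow> 'g) \<Rightarrow> ('g list \<Rightarrow> 'g) \<Rightarrow> bool"
  where "n_lie_algebra n sg br \<longleftrightarrow>
    alternating_multilinear n sg sg br \<and>
    (\<forall>xs ys. length xs = n - 1 \<and> length ys = n \<longrightarrow>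
      br (xs @ [br ys]) = (\<Sum>i<n. br (ys[i := br (xs @ [ys ! i])])))"

definition n_lie_representation ::
  "nat \<Rightarrow> ('k::field \<Rightarrow> 'g::ab_group_add \<Rightarrow> 'g) \<Rightarrow> ('g list \<Rightarrow> 'g) \<Rightarrow>
   ('k \<Rightarrow> 'v::ab_group_add \<Rightarrow> 'v) \<Rightarrow> ('g list \<Rightarrow> 'v \<Rightarrow> 'v) \<Rightarrow> bool"
  where "n_lie_representation n sg br sv \<rho> \<longleftrightarrow>
    (\<forall>xs. length xs = n - 1 \<longrightarrow> Vector_Spaces.linear sv sv (\<rho> xs)) \<and>
    (\<forall>v. alternating_multilinear (n - 1) sg sv (\<lambda>xs. \<rho> xs v)) \<and>
    (\<forall>xs ys v. length xs = n - 1 \<and> length ys = n - 1 \<longrightarrow>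
      \<rho> xs (\<rho> ys v) - \<rho> ys (\<rho> xs v) = (\<Sum>i<n - 1. \<rho> (ys[i := br (xs @ [ys ! i])]) v)) \<and>
    (\<forall>xs ys v. length xs = n - 2 \<and> length ys = n \<longrightarrow>
      \<rho> (xs @ [br ys]) v =
        (\<Sum>i<n. sv ((-1) ^ (n - 1 - i)) (\<rho> (omit i ys) (\<rho> (xs @ [ys ! i]) v))))"

definition n_lie_rep_pair ::
  "nat \<Rightarrow> ('k::field \<Rightarrow> 'g::ab_group_add \<Rightarrow> 'g) \<Rightarrow> ('g list \<Rightarrow> 'g) \<Rightarrow>
   ('k \<Rightarrow> 'v::ab_group_add \<Rightarrow> 'v) \<Rightarrow> ('g list \<Rightarrow> 'v \<Rightarrow> 'v) \<Rightarrow> bool"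
  where "n_lie_rep_pair n sg br sv \<rho> \<longleftrightarrow>
    n_lie_algebra n sg br \<and> n_lie_representation n sg br sv \<rho>"

definition relative_rota_baxter ::
  "nat \<Rightarrow> ('k::field \<Rightarrow> 'g::ab_group_add \<Rightarrow> 'g) \<Rightarrow> ('g list \<Rightarrow> 'g) \<Rightarrow>
   ('k \<Rightarrow> 'v::ab_group_add \<Rightarrow> 'v) \<Rightarrow> ('g list \<Rightarrow> 'v \<Rightarrow> 'v) \<Rightarrow> ('v \<Rightarrow> 'g) \<Rightarrow> bool"
  where "relative_rota_baxter n sg br sv \<rho> T \<longleftrightarrow>
    Vector_Spaces.linear sv sg T \<and>
    (\<forall>vs. length vs = n \<longrightarrow>
      br (map T vs) =
        (\<Sum>i<n. sg ((-1) ^ (n - 1 - i)) (T (\<rho> (map T (omit i vs)) (vs ! i)))))"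


section \<open>Cochains\<close>

text \<open>
  A cochain of degree \<open>p\<close> is a function \<open>P Xs x\<close> of a list \<open>Xs\<close> of \<open>p\<close> blocks, each of \<open>n - 1\<close>
  vectors, and a vector \<open>x\<close>, where the last block together with \<open>x\<close> forms an \<open>n\<close>-fold
  exterior product. Cochains are 0 on all other lists, so that the cochains of all degrees
  span their direct sum inside the one function space \<open>'a list list \<Rightarrow> 'a \<Rightarrow> 'b\<close>, with the
  pointwise addition of \<^theory>\<open>HOL-Library.Function_Algebras\<close>.
\<close>

definition blocks :: "nat \<Rightarrow> nat \<Rightarrow> 'a list list set"
  where "blocks n p = {Xs. length Xs = p \<and> (\<forall>X\<in>set Xs. length X = n - 1)}"

definition cochains ::
  "nat \<Rightarrow> ('k::field \<Rightarrow> 'a::ab_group_add \<Rightarrow> 'a) \<Rightarrow> ('k \<Rightarrow> 'b::ab_group_add \<Rightarrow> 'b) \<Rightarrow> nat \<Rightarrow>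
   ('a list list \<Rightarrow> 'a \<Rightarrow> 'b) set"
  where "cochains n sA sB p = {P.
    (\<forall>Xs x. Xs \<notin> blocks n p \<longrightarrow> P Xs x = 0) \<and>
    (\<forall>Xs\<in>blocks n p.
      Vector_Spaces.linear sA sB (P Xs) \<and>
      (\<forall>x. \<forall>i<p. \<forall>j<n - 1. Vector_Spaces.linear sA sB (\<lambda>y. P (Xs[i := (Xs ! i)[j := y]]) x)) \<and>
      (\<forall>x. (\<exists>X\<in>set Xs. \<not> distinct X) \<longrightarrow> P Xs x = 0) \<and>
      (\<forall>x. Xs \<noteq> [] \<and> x \<in> set (last Xs) \<longrightarrow> P Xs x = 0))}"

definition scale_cochain ::
  "('k \<Rightarrow> 'b \<Rightarrow> 'b) \<Rightarrow> 'k \<Rightarrow> ('a list list \<Rightarrow> 'a \<Rightarrow> 'b) \<Rightarrow> 'a list list \<Rightarrow> 'a \<Rightarrow> 'b"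
  where "scale_cochain sB c P = (\<lambda>Xs x. sB c (P Xs x))"

definition cochain_grading ::
  "nat \<Rightarrow> ('k::field \<Rightarrow> 'a::ab_group_add \<Rightarrow> 'a) \<Rightarrow> ('k \<Rightarrow> 'b::ab_group_add \<Rightarrow> 'b) \<Rightarrow> int \<Rightarrow>
   ('a list list \<Rightarrow> 'a \<Rightarrow> 'b) set"
  where "cochain_grading n sA sB m = (if m < 0 then {0} else cochains n sA sB (nat m))"

definition linear_map_cochain :: "('a \<Rightarrow> 'b::zero) \<Rightarrow> 'a list list \<Rightarrow> 'a \<Rightarrow> 'b"
  where "linear_map_cochain T = (\<lambda>Xs x. if Xs = [] then T x else 0)"


section \<open>The graded Lie bracket on cochains with values in the same space\<close>

definition shuffle_perms :: "nat \<Rightarrow> nat \<Rightarrow> (nat \<Rightarrow> nat) set"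
  where "shuffle_perms i j = {\<sigma>. \<sigma> permutes {..<i + j} \<and>
    strict_mono_on {..<i} \<sigma> \<and> strict_mono_on {i..<i + j} \<sigma>}"

text \<open>
  The composition of \<open>P\<close>, of degree \<open>p\<close>, and \<open>Q\<close>, of degree \<open>q\<close>, evaluated on \<open>p + q\<close> blocks.
  With the index \<open>k\<close> starting at 0, the block in which \<open>Q\<close> is inserted is \<open>Xs ! (k + q)\<close>, which
  is not moved by the shuffles of \<open>{..<k + q}\<close>.
\<close>

definition cochain_comp ::
  "nat \<Rightarrow> ('k::field \<Rightarrow> 'w::ab_group_add \<Rightarrow> 'w) \<Rightarrow> nat \<Rightarrow> nat \<Rightarrow>
   ('w list list \<Rightarrow> 'w \<Rightarrow> 'w) \<Rightarrow> ('w list list \<Rightarrow> 'w \<Rightarrow> 'w) \<Rightarrow> 'w list list \<Rightarrow> 'w \<Rightarrow> 'w"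
  where "cochain_comp n s p q P Q Xs x =
    (\<Sum>k<p. \<Sum>\<sigma>\<in>shuffle_perms k q. \<Sum>i<n - 1.
      s ((-1) ^ (k * q) * of_int (sign \<sigma>))
        (let Ys = permute_list \<sigma> Xs; X = Xs ! (k + q) in
          P (take k Ys @ [X[i := Q (take q (drop k Ys)) (X ! i)]] @ drop (k + q + 1) Xs) x)) +
    (\<Sum>\<sigma>\<in>shuffle_perms p q.
      s ((-1) ^ (p * q) * of_int (sign \<sigma>))
        (let Ys = permute_list \<sigma> Xs in P (take p Ys) (Q (drop p Ys) x)))"

text \<open>
  The bilinear extension of $[P,Q] = P \circ Q - (-1)^{pq}\, Q \circ P$ to the direct sum. As the
  component of degree \<open>p\<close> of a cochain is its restriction to lists of \<open>p\<close> blocks, the component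
  of degree \<open>N\<close> of the bracket is the sum over \<open>p + q = N\<close>; if \<open>P\<close> and \<open>Q\<close> are homogeneous,
  only their own degrees contribute.
\<close>

definition nlie_bracket ::
  "nat \<Rightarrow> ('k::field \<Rightarrow> 'w::ab_group_add \<Rightarrow> 'w) \<Rightarrow>
   ('w list list \<Rightarrow> 'w \<Rightarrow> 'w) \<Rightarrow> ('w list list \<Rightarrow> 'w \<Rightarrow> 'w) \<Rightarrow> 'w list list \<Rightarrow> 'w \<Rightarrow> 'w"
  where "nlie_bracket n s P Q = (\<lambda>Xs x.
    \<Sum>p\<le>length Xs. let q = length Xs - p in
      cochain_comp n s p q P Q Xs x - s ((-1) ^ (p * q)) (cochain_comp n s q p Q P Xs x))"


section \<open>The derived bracket\<close>

text \<open>The cochain \<open>\<mu> + \<rho>\<close> of degree 1 on the direct sum of the two spaces.\<close>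

definition semidirect_cochain ::
  "nat \<Rightarrow> ('g list \<Rightarrow> 'g::ab_group_add) \<Rightarrow> ('k::field \<Rightarrow> 'v::ab_group_add \<Rightarrow> 'v) \<Rightarrow>
   ('g list \<Rightarrow> 'v \<Rightarrow> 'v) \<Rightarrow> ('g \<times> 'v) list list \<Rightarrow> 'g \<times> 'v \<Rightarrow> 'g \<times> 'v"
  where "semidirect_cochain n br sv \<rho> = (\<lambda>Xs x.
    if Xs \<in> blocks n 1 then
      (let ws = hd Xs @ [x] in
        (br (map fst ws),
         \<Sum>i<n. sv ((-1) ^ (n - 1 - i)) (\<rho> (map fst (omit i ws)) (snd (ws ! i)))))
    else 0)"

definition lift_cochain ::
  "('v list list \<Rightarrow> 'v \<Rightarrow> 'g) \<Rightarrow> ('g \<times> 'v) list list \<Rightarrow> 'g \<times> 'v \<Rightarrow> 'g \<times> 'v::zero"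
  where "lift_cochain P = (\<lambda>Xs x. (P (map (map snd) Xs) (snd x), 0))"

text \<open>A left inverse of \<^const>\<open>lift_cochain\<close>.\<close>

definition restrict_cochain ::
  "(('g::zero \<times> 'v) list list \<Rightarrow> 'g \<times> 'v \<Rightarrow> 'g \<times> 'v) \<Rightarrow> 'v list list \<Rightarrow> 'v \<Rightarrow> 'g"
  where "restrict_cochain F = (\<lambda>Xs x. fst (F (map (map (Pair 0)) Xs) (0, x)))"

definition iterated_bracket ::
  "nat \<Rightarrow> ('k::field \<Rightarrow> 'g::ab_group_add \<Rightarrow> 'g) \<Rightarrow> ('g list \<Rightarrow> 'g) \<Rightarrow>
   ('k \<Rightarrow> 'v::ab_group_add \<Rightarrow> 'v) \<Rightarrow> ('g list \<Rightarrow> 'v \<Rightarrow> 'v) \<Rightarrow>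
   ('v list list \<Rightarrow> 'v \<Rightarrow> 'g) list \<Rightarrow> ('g \<times> 'v) list list \<Rightarrow> 'g \<times> 'v \<Rightarrow> 'g \<times> 'v"
  where "iterated_bracket n sg br sv \<rho> Ps =
    foldl (nlie_bracket n (module_prod.scale sg sv)) (semidirect_cochain n br sv \<rho>)
      (map lift_cochain Ps)"

definition derived_bracket ::
  "nat \<Rightarrow> ('k::field \<Rightarrow> 'g::ab_group_add \<Rightarrow> 'g) \<Rightarrow> ('g list \<Rightarrow> 'g) \<Rightarrow>
   ('k \<Rightarrow> 'v::ab_group_add \<Rightarrow> 'v) \<Rightarrow> ('g list \<Rightarrow> 'v \<Rightarrow> 'v) \<Rightarrow>
   ('v list list \<Rightarrow> 'v \<Rightarrow> 'g) list \<Rightarrow> 'v list list \<Rightarrow> 'v \<Rightarrow> 'g"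
  where "derived_bracket n sg br sv \<rho> Ps = restrict_cochain (iterated_bracket n sg br sv \<rho> Ps)"


section \<open>Lie n-algebras\<close>

text \<open>
  A graded vector space is given by subspaces \<open>A m\<close> of an ambient vector space whose sum is direct;
  the graded vector space itself is their span, which need not be the whole type.
\<close>

definition graded_vector_space ::
  "('k::field \<Rightarrow> 'e::ab_group_add \<Rightarrow> 'e) \<Rightarrow> (int \<Rightarrow> 'e set) \<Rightarrow> bool"
  where "graded_vector_space s A \<longleftrightarrow>
    vector_space s \<and>
    (\<forall>m. module.subspace s (A m)) \<and>
    (\<forall>M x. finite M \<and> (\<forall>m\<in>M. x m \<in> A m) \<and> (\<Sum>m\<in>M. x m) = 0 \<longrightarrow> (\<forall>m\<in>M. x m = 0))"

definition graded_total ::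
  "('k::field \<Rightarrow> 'e::ab_group_add \<Rightarrow> 'e) \<Rightarrow> (int \<Rightarrow> 'e set) \<Rightarrow> 'e set"
  where "graded_total s A = module.span s (\<Union>m. A m)"

text \<open>
  The Koszul sign of the permutation \<open>\<sigma>\<close> of homogeneous elements of degrees \<open>ds\<close>, that is
  $x_1 \cdots x_N = \varepsilon(\sigma)\, x_{\sigma(1)} \cdots x_{\sigma(N)}$ in the graded symmetric
  algebra. It does not include the sign of \<open>\<sigma>\<close>.
\<close>

definition koszul_sign :: "(nat \<Rightarrow> nat) \<Rightarrow> int list \<Rightarrow> int"
  where "koszul_sign \<sigma> ds =
    (\<Prod>(i, j)\<in>{(i, j). i < j \<and> j < length ds \<and> \<sigma> i > \<sigma> j}.
      if odd (ds ! \<sigma> i) \<and> odd (ds ! \<sigma> j) then - 1 else 1)"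

definition lie_n_algebra ::
  "nat \<Rightarrow> ('k::field \<Rightarrow> 'e::ab_group_add \<Rightarrow> 'e) \<Rightarrow> (int \<Rightarrow> 'e set) \<Rightarrow> ('e list \<Rightarrow> 'e) \<Rightarrow> bool"
  where "lie_n_algebra n s A br \<longleftrightarrow>
    graded_vector_space s A \<and>
    (\<forall>xs y z c i. length xs = n \<and> set xs \<subseteq> graded_total s A \<and> i < n \<and>
        y \<in> graded_total s A \<and> z \<in> graded_total s A \<longrightarrow>
      br (xs[i := y + z]) = br (xs[i := y]) + br (xs[i := z]) \<and>
      br (xs[i := s c y]) = s c (br (xs[i := y]))) \<and>
    (\<forall>xs ds. length xs = n \<and> list_all2 (\<lambda>x d. x \<in> A d) xs ds \<longrightarrow> br xs \<in> A (sum_list ds + 1)) \<and>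
    (\<forall>xs ds \<sigma>. length xs = n \<and> list_all2 (\<lambda>x d. x \<in> A d) xs ds \<and> \<sigma> permutes {..<n} \<longrightarrow>
      br xs = s (of_int (koszul_sign \<sigma> ds)) (br (permute_list \<sigma> xs))) \<and>
    (\<forall>xs ds. length xs = 2 * n - 1 \<and> list_all2 (\<lambda>x d. x \<in> A d) xs ds \<longrightarrow>
      (\<Sum>\<sigma>\<in>shuffle_perms n (n - 1). s (of_int (koszul_sign \<sigma> ds))
        (let ys = permute_list \<sigma> xs in br (br (take n ys) # drop n ys))) = 0)"

definition maurer_cartan ::
  "nat \<Rightarrow> ('k::field_char_0 \<Rightarrow> 'e::ab_group_add \<Rightarrow> 'e) \<Rightarrow> (int \<Rightarrow> 'e set) \<Rightarrow> ('e list \<Rightarrow> 'e) \<Rightarrow> 'e \<Rightarrow> bool"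
  where "maurer_cartan n s A br \<alpha> \<longleftrightarrow> \<alpha> \<in> A 0 \<and> s (1 / fact n) (br (replicate n \<alpha>)) = 0"

end

theory Submission
  imports Defs
begin

text \<open>
  The bracket on cochains is the commutator of a circle product. Splitting off the first block of
  arguments gives a derivation rule for this product which determines it, and from which an
  induction on the number of blocks yields that the product is graded pre-Lie; this is the graded
  Jacobi identity of the bracket. The cochain \<open>\<Delta> = \<mu> + \<rho>\<close> satisfies \<open>[\<Delta>, \<Delta>] = 0\<close>, since it is the
  semidirect product n-Lie algebra, and the cochains with arguments in \<open>V\<close> and values in \<open>\<gg>\<close> form
  an abelian subalgebra. Counting arguments from \<open>\<gg>\<close> shows that bracketing \<open>\<Delta>\<close> with \<open>n\<close> of them
  gives an element of that subalgebra, and with more than \<open>n\<close> of them gives 0. So the \<open>n\<close>-ary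
  bracket is a higher derived bracket in the sense of Voronov, and the only one that survives.
\<close>

section \<open>Koszul signs and shuffles\<close>

text \<open>Voronov's construction normally projects the iterated brackets to the abelian
  subalgebra. What replaces the projection here is a weight: a component of a cochain on the sum of
  \<gg> and \<open>V\<close> gets the number of its arguments from \<gg>, plus one if its value lies
  in \<open>V\<close>. With this correction \<open>\<mu>\<close> and \<open>\<rho>\<close> both have
  weight \<open>n\<close>, although they take different numbers of arguments from \<gg>. The number
  \<open>2 n - 1\<close> of entries in the Lie n-algebra identity then does the rest: when they are
  distributed over the two factors of \<open>[\<Delta>, \<Delta>]\<close>, one factor receives at
  least \<open>n\<close> of them. More than \<open>n\<close> kills the term, and exactly
  \<open>n\<close> puts that factor into the abelian subalgebra, where it can be read as an inner
  \<open>n\<close>-ary bracket. The obstacle is the signs: two kinds of shuffle sums occur, one with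
  signs of permutations and one with Koszul signs. Both are turned into a single recursion that adds
  one list entry at a time. Cochains of all degrees share one function space, so the circle product
  is studied without fixing degrees, and homogeneity enters only where a sign depends on it.\<close>

lemma permutes_adjacent_induct [consumes 1, case_names id adj]:
  assumes "\<sigma> permutes {..<N}"
    and id: "P id"
    and adj: "\<And>\<sigma> i. \<sigma> permutes {..<N} \<Longrightarrow> Suc i < N \<Longrightarrow> P \<sigma> \<Longrightarrow> P (\<sigma> \<circ> Transposition.transpose i (Suc i))"
  shows "P \<sigma>"
proof -
  have seq: "P (\<sigma> \<circ> apply_adj_transps is)"
    if "\<sigma> permutes {..<N}" "P \<sigma>" "\<forall>i\<in>set is. Suc i < N" for \<sigma> "is"
    using that
  proof (induction "is" arbitrary: \<sigma>)
    case (Cons i "is")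
    have "\<sigma> \<circ> Transposition.transpose i (Suc i) permutes {..<N}"
      using Cons.prems by (intro permutes_compose permutes_swap_id) auto
    then have "P ((\<sigma> \<circ> Transposition.transpose i (Suc i)) \<circ> apply_adj_transps is)"
      by (rule Cons.IH[OF _ adj[OF Cons.prems(1) _ Cons.prems(2)]]) (use Cons.prems in simp_all)
    then show ?case by (simp only: apply_adj_transps_Cons Suc_eq_plus1 comp_assoc)
  qed simp
  \<comment> \<open>\<open>permutes_rev_induct\<close> supplies arbitrary transpositions;
    \<open>adj_transp_seq\<close> writes each of them as a product of swaps of neighbours.\<close>
  have transp: "P (\<sigma> \<circ> Transposition.transpose a b)"
    if "\<sigma> permutes {..<N}" "P \<sigma>" "a < b" "b < N" for \<sigma> a b
    using seq[OF that(1,2), of "adj_transp_seq a b"] that(3,4)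
    by (simp add: adj_transp_seq_correct set_adj_transp_seq)
  show ?thesis
    using finite_lessThan[of N] assms(1)
  proof (induction rule: permutes_rev_induct)
    case (swap a b p)
    then show ?case
      using transp[of p a b] transp[of p b a] transpose_commute[of a b]
      by (metis lessThan_iff linorder_neqE_nat)
  qed (rule id)
qed

text \<open>The swap carries the inversions of \<sigma> bijectively to those of the composite,
  weights included, except for the pair \<open>(i, Suc i)\<close> itself, which appears or
  disappears.\<close>

lemma koszul_sign_adj:
  assumes "\<sigma> permutes {..<N}" "Suc i < N" "length ds = N"
  shows "koszul_sign (\<sigma> \<circ> Transposition.transpose i (Suc i)) ds
    = koszul_sign \<sigma> ds * (if odd (ds ! \<sigma> i) \<and> odd (ds ! \<sigma> (Suc i)) then - 1 else 1)"
proof -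
  define I where "I \<sigma> = {(i, j). i < j \<and> j < length ds \<and> \<sigma> i > \<sigma> j}" for \<sigma> :: "nat \<Rightarrow> nat"
  define w :: "(nat \<Rightarrow> nat) \<Rightarrow> nat \<times> nat \<Rightarrow> int"
    where "w \<sigma> = (\<lambda>(i, j). if odd (ds ! \<sigma> i) \<and> odd (ds ! \<sigma> j) then - 1 else 1)" for \<sigma>
  have ks: "koszul_sign \<sigma> ds = prod (w \<sigma>) (I \<sigma>)" for \<sigma>
    by (simp add: koszul_sign_def I_def w_def)
  have fin: "finite (I \<sigma>)" for \<sigma>
    by (rule finite_subset[of _ "{..<N} \<times> {..<N}"]) (auto simp: I_def assms)
  let ?t = "Transposition.transpose i (Suc i)"
  have step: "koszul_sign (\<sigma> \<circ> ?t) ds = koszul_sign \<sigma> ds * w \<sigma> (i, Suc i)"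
    if "\<sigma> permutes {..<N}" "\<sigma> i < \<sigma> (Suc i)" for \<sigma>
  proof -
    let ?m = "map_prod ?t ?t"
    have inj: "inj_on ?m (I \<sigma>)"
      by (intro inj_onI) (auto simp: map_prod_def split: prod.splits dest: injD[OF inj_transpose])
    have mem: "(a, b) \<in> I (\<sigma> \<circ> ?t) \<longleftrightarrow> (a, b) = (i, Suc i) \<or> (?t a, ?t b) \<in> I \<sigma>" for a b
      using that assms(2,3) unfolding I_def
      by (auto simp: transpose_def split: if_splits)
    have m_mem: "(?t a, ?t b) \<in> I \<sigma> \<longleftrightarrow> (a, b) \<in> ?m ` I \<sigma>" for a b
      by (force simp: image_iff map_prod_def split: prod.splits)
    have eq: "I (\<sigma> \<circ> ?t) = insert (i, Suc i) (?m ` I \<sigma>)"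
      using mem m_mem by auto
    have notin: "(i, Suc i) \<notin> ?m ` I \<sigma>"
      unfolding m_mem[symmetric] by (simp add: I_def)
    have "prod (w (\<sigma> \<circ> ?t)) (?m ` I \<sigma>) = prod (w \<sigma>) (I \<sigma>)"
      by (subst prod.reindex[OF inj]) (auto intro!: prod.cong simp: w_def)
    moreover have "w (\<sigma> \<circ> ?t) (i, Suc i) = w \<sigma> (i, Suc i)"
      by (auto simp: w_def)
    ultimately show ?thesis
      by (simp add: ks eq fin notin)
  qed
  have "\<sigma> i \<noteq> \<sigma> (Suc i)"
    using permutes_inj[OF assms(1)] by (metis injD n_not_Suc_n)
  then consider "\<sigma> i < \<sigma> (Suc i)" | "\<sigma> (Suc i) < \<sigma> i"
    by linarith
  then show ?thesis
  proof cases
    case 1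
    then show ?thesis using step[OF assms(1)] by (simp add: w_def)
  next
    case 2
    \<comment> \<open>The swap is an involution, so the increasing case applies to the composite;
      the weight of the pair squares to 1.\<close>
    have "\<sigma> \<circ> ?t permutes {..<N}"
      using assms by (intro permutes_compose permutes_swap_id) auto
    then have "koszul_sign (\<sigma> \<circ> ?t \<circ> ?t) ds = koszul_sign (\<sigma> \<circ> ?t) ds * w (\<sigma> \<circ> ?t) (i, Suc i)"
      using 2 by (intro step) auto
    then show ?thesis
      by (simp add: comp_assoc w_def conj_commute split: if_splits)
  qed
qed

lemma koszul_sign_id [simp]: "koszul_sign id ds = 1"
  unfolding koszul_sign_def by (rule prod.neutral) auto

lemma koszul_sign_ident [simp]: "koszul_sign (\<lambda>a. a) ds = 1"
  using koszul_sign_id[of ds] by (simp only: id_def)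

text \<open>If all degrees are odd, every inversion contributes -1. Hence the shuffles of the circle
  product and those of the Lie n-algebra identity are both covered by
  \<open>sum_shuffle_perms\<close>.\<close>

lemma sign_eq_koszul_sign:
  assumes "\<sigma> permutes {..<N}"
  shows "sign \<sigma> = koszul_sign \<sigma> (replicate N 1)"
  using assms
proof (induction rule: permutes_adjacent_induct)
  case (adj \<sigma> i)
  have "\<sigma> i < N" "\<sigma> (Suc i) < N"
    using adj permutes_in_image[OF adj(1)] by (metis Suc_lessD lessThan_iff)+
  then have "koszul_sign (\<sigma> \<circ> Transposition.transpose i (Suc i)) (replicate N 1)
      = - koszul_sign \<sigma> (replicate N 1)"
    by (subst koszul_sign_adj[OF adj(1,2)]) auto
  moreover have "sign (\<sigma> \<circ> Transposition.transpose i (Suc i)) = - sign \<sigma>"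
    by (subst sign_compose)
      (auto intro: permutes_imp_permutation[OF _ adj(1)] simp: sign_swap_id permutation_swap_id)
  ultimately show ?case using adj by (simp only:)
qed (simp only: sign_id koszul_sign_id)

text \<open>Through \<open>permute_list\<close> this moves the head of a list to position
  \<open>i\<close> and permutes the tail by \<sigma>, so shuffles can be peeled off one list entry
  at a time.\<close>

definition insert_zero :: "nat \<Rightarrow> (nat \<Rightarrow> nat) \<Rightarrow> nat \<Rightarrow> nat"
  where "insert_zero i \<sigma> k = (if k < i then Suc (\<sigma> k) else if k = i then 0 else Suc (\<sigma> (k - 1)))"

text \<open>Pushing the head one place further is a swap of neighbours, which reduces facts about
  \<open>insert_zero i\<close> to \<open>i = 0\<close> by induction.\<close>

lemma insert_zero_Suc:
  "insert_zero (Suc i) \<sigma> = insert_zero i \<sigma> \<circ> Transposition.transpose i (Suc i)"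
  by (auto simp: insert_zero_def transpose_def fun_eq_iff)

lemma insert_zero_permutes:
  assumes "\<sigma> permutes {..<N}" "i \<le> N"
  shows "insert_zero i \<sigma> permutes {..<Suc N}"
  using assms(2)
proof (induction i)
  case 0
  have "inj (insert_zero 0 \<sigma>)"
  proof (rule injI)
    fix a b assume "insert_zero 0 \<sigma> a = insert_zero 0 \<sigma> b"
    then show "a = b"
      using injD[OF permutes_inj[OF assms(1)], of "a - 1" "b - 1"]
      by (cases a; cases b) (simp_all add: insert_zero_def)
  qed
  moreover have "insert_zero 0 \<sigma> k = k" if "k \<ge> Suc N" for k
    using that permutes_not_in[OF assms(1), of "k - 1"] by (auto simp: insert_zero_def)
  moreover have "insert_zero 0 \<sigma> k < Suc N" if "k < Suc N" for k
    using that permutes_in_image[OF assms(1), of "k - 1"] by (auto simp: insert_zero_def)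
  ultimately show ?case
    by (intro bij_imp_permutes bij_betw_imageI endo_inj_surj) (auto intro: inj_on_subset)
next
  case (Suc i)
  then show ?case
    unfolding insert_zero_Suc by (intro permutes_compose permutes_swap_id) auto
qed

text \<open>The head, of degree \<open>d\<close>, passes exactly the \<open>i\<close> entries that
  end up in front of it, one swap of neighbours for each.\<close>

lemma koszul_sign_insert_zero:
  assumes "\<sigma> permutes {..<N}" "i \<le> N" "length ds = N"
  shows "koszul_sign (insert_zero i \<sigma>) (d # ds)
    = (if odd d \<and> odd (\<Sum>k<i. ds ! \<sigma> k) then - 1 else 1) * koszul_sign \<sigma> ds"
  using assms(2)
proof (induction i)
  case 0
  let ?h = "map_prod Suc Suc"
  have "{(a, b). a < b \<and> b < length (d # ds) \<and> insert_zero 0 \<sigma> a > insert_zero 0 \<sigma> b}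
      = ?h ` {(a, b). a < b \<and> b < length ds \<and> \<sigma> a > \<sigma> b}" (is "?L = ?h ` ?R")
  proof (intro set_eqI iffI)
    fix z assume "z \<in> ?L"
    then obtain a b where z: "z = (a, b)" "a < b" "b < Suc (length ds)"
        "insert_zero 0 \<sigma> a > insert_zero 0 \<sigma> b"
      by auto
    then have "0 < a" by (auto simp: insert_zero_def split: if_splits)
    then have "(a - 1, b - 1) \<in> ?R" "z = ?h (a - 1, b - 1)"
      using z by (auto simp: insert_zero_def)
    then show "z \<in> ?h ` ?R" by blast
  qed (auto simp: insert_zero_def)
  moreover have "inj_on ?h ?R"
    by (auto simp: inj_on_def)
  ultimately show ?case
    unfolding koszul_sign_def
    by (simp add: prod.reindex) (auto intro!: prod.cong simp: insert_zero_def)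
next
  case (Suc i)
  have "koszul_sign (insert_zero (Suc i) \<sigma>) (d # ds)
      = koszul_sign (insert_zero i \<sigma>) (d # ds) * (if odd d \<and> odd (ds ! \<sigma> i) then - 1 else 1)"
    unfolding insert_zero_Suc
    by (subst koszul_sign_adj[of _ "Suc N"])
      (use Suc assms in \<open>auto intro: insert_zero_permutes simp: insert_zero_def\<close>)
  then show ?case using Suc by auto
qed

lemma permute_list_insert_zero:
  assumes "\<sigma> permutes {..<length xs}" "i \<le> length xs"
  shows "permute_list (insert_zero i \<sigma>) (x # xs)
    = take i (permute_list \<sigma> xs) @ x # drop i (permute_list \<sigma> xs)"
proof (rule nth_equalityI)
  fix k assume k: "k < length (permute_list (insert_zero i \<sigma>) (x # xs))"
  have *: "permute_list (insert_zero i \<sigma>) (x # xs) ! k = (x # xs) ! insert_zero i \<sigma> k"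
    by (rule permute_list_nth) (use k insert_zero_permutes[OF assms] in simp_all)
  consider "k < i" | "k = i" | m where "k = Suc (i + m)"
    by (metis less_imp_Suc_add linorder_neqE_nat)
  then show "permute_list (insert_zero i \<sigma>) (x # xs) ! k
      = (take i (permute_list \<sigma> xs) @ x # drop i (permute_list \<sigma> xs)) ! k"
    unfolding * using k assms
    by cases (simp_all add: insert_zero_def nth_append permute_list_nth)
qed (use assms in simp)

lemma insert_zero_inj: "insert_zero i \<sigma> = insert_zero i \<tau> \<longleftrightarrow> \<sigma> = \<tau>"
proof
  assume eq: "insert_zero i \<sigma> = insert_zero i \<tau>"
  show "\<sigma> = \<tau>"
  proof
    fix k show "\<sigma> k = \<tau> k"
      using fun_cong[OF eq, of k] fun_cong[OF eq, of "Suc k"]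
      by (cases "k < i") (simp_all add: insert_zero_def)
  qed
qed simp

section \<open>Shuffles, classified by the position of the value 0\<close>

lemma shuffle_perms_finite [simp]: "finite (shuffle_perms i j)"
  by (rule finite_subset[OF _ finite_permutations[of "{..<i + j}"]]) (auto simp: shuffle_perms_def)

lemma shuffle_perms_permutes: "\<sigma> \<in> shuffle_perms i j \<Longrightarrow> \<sigma> permutes {..<i + j}"
  by (simp add: shuffle_perms_def)

lemma strict_mono_on_insert_zero:
  assumes "strict_mono_on A (insert_zero i \<sigma>)" "\<And>k. k \<in> B \<Longrightarrow> (if k < i then k else Suc k) \<in> A"
  shows "strict_mono_on B \<sigma>"
proof (rule strict_mono_onI)
  fix r s assume "r \<in> B" "s \<in> B" "r < s"
  then show "\<sigma> r < \<sigma> s"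
    using strict_mono_onD[OF assms(1) assms(2)[of r] assms(2)[of s]]
    by (cases "r < i"; cases "s < i") (simp_all add: insert_zero_def)
qed

lemma insert_zero_strict_mono_on:
  assumes "strict_mono_on B \<sigma>" "\<And>k. k \<in> A \<Longrightarrow> k \<noteq> i \<Longrightarrow> (if k < i then k else k - 1) \<in> B"
    and "i \<in> A \<Longrightarrow> \<forall>k\<in>A. i \<le> k"
  shows "strict_mono_on A (insert_zero i \<sigma>)"
proof (rule strict_mono_onI)
  fix r s assume rs: "r \<in> A" "s \<in> A" "r < s"
  consider "s < i" | "s = i" | "r < i" "i < s" | "r = i" | "i < r"
    using rs by linarith
  then show "insert_zero i \<sigma> r < insert_zero i \<sigma> s"
    using strict_mono_onD[OF assms(1) assms(2)[of r] assms(2)[of s]] rs assms(3)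
    by cases (auto simp: insert_zero_def)
qed

lemma insert_zero_surj:
  assumes "\<sigma> permutes {..<Suc N}" "\<sigma> i = 0"
  obtains \<tau> where "\<tau> permutes {..<N}" "\<sigma> = insert_zero i \<tau>"
proof -
  define \<tau> where "\<tau> k = \<sigma> (if k < i then k else Suc k) - 1" for k
  have nz: "\<sigma> k \<noteq> 0" if "k \<noteq> i" for k
    using that assms permutes_inj[OF assms(1)] by (metis injD)
  have i: "i < Suc N"
    using assms permutes_in_image[OF assms(1), of i] by simp
  have eq: "\<sigma> = insert_zero i \<tau>"
  proof
    fix k
    show "\<sigma> k = insert_zero i \<tau> k"
      using assms(2) nz[of k] by (auto simp: insert_zero_def \<tau>_def)
  qed
  have "inj \<tau>"
  proof (rule injI)
    fix a b assume "\<tau> a = \<tau> b"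
    then have "\<sigma> (if a < i then a else Suc a) = \<sigma> (if b < i then b else Suc b)"
      using nz[of "if a < i then a else Suc a"] nz[of "if b < i then b else Suc b"]
      by (auto simp: \<tau>_def split: if_splits)
    then show "a = b"
      using injD[OF permutes_inj[OF assms(1)]] by (fastforce split: if_splits)
  qed
  moreover have "\<tau> k < N" if "k < N" for k
    using that permutes_in_image[OF assms(1), of "if k < i then k else Suc k"]
      nz[of "if k < i then k else Suc k"] by (auto simp: \<tau>_def split: if_splits)
  moreover have "\<tau> k = k" if "\<not> k < N" for k
    using that i permutes_not_in[OF assms(1), of "Suc k"] by (auto simp: \<tau>_def)
  ultimately have "\<tau> permutes {..<N}"
    by (intro bij_imp_permutes bij_betw_imageI endo_inj_surj) (auto intro: inj_on_subset)
  then show thesis using eq that by blast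
qed

text \<open>Both runs of a shuffle are increasing, so the value 0 stands at the start of a nonempty
  run: at position 0 or at position \<open>i\<close>.\<close>

lemma shuffle_perms_Suc:
  assumes "i + j = Suc N"
  shows "shuffle_perms i j =
    (if i = 0 then {} else insert_zero 0 ` shuffle_perms (i - 1) j) \<union>
    (if j = 0 then {} else insert_zero i ` shuffle_perms i (j - 1))"
    (is "_ = ?A \<union> ?B")
proof (intro set_eqI iffI)
  fix \<sigma> assume s: "\<sigma> \<in> shuffle_perms i j"
  then have perm: "\<sigma> permutes {..<Suc N}" and mono: "strict_mono_on {..<i} \<sigma>" "strict_mono_on {i..<Suc N} \<sigma>"
    using assms by (simp_all add: shuffle_perms_def)
  obtain k where k: "\<sigma> k = 0" "k < Suc N"
    using permutes_image[OF perm] by (metis imageE lessThan_iff zero_less_Suc)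
  have "k = 0 \<and> i \<noteq> 0 \<or> k = i \<and> j \<noteq> 0"
  proof (cases "k < i")
    case True
    then have "\<not> 0 < k" using strict_mono_onD[OF mono(1), of 0 k] k by (metis lessThan_iff less_trans not_less_zero)
    then show ?thesis using True by auto
  next
    case False
    then have "\<not> i < k" using strict_mono_onD[OF mono(2), of i k] k assms
      by (metis atLeastLessThan_iff less_imp_le less_trans not_less_zero order_refl)
    then have "k = i" using False by linarith
    then show ?thesis using k assms by auto
  qed
  then show "\<sigma> \<in> ?A \<union> ?B"
  proof
    assume k0: "k = 0 \<and> i \<noteq> 0"
    then obtain \<tau> where \<tau>: "\<tau> permutes {..<N}" "\<sigma> = insert_zero 0 \<tau>"
      using insert_zero_surj[OF perm] k by metis
    have "strict_mono_on {..<i - 1} \<tau>"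
      by (rule strict_mono_on_insert_zero[OF mono(1)[unfolded \<tau>(2)]]) auto
    moreover have "strict_mono_on {i - 1..<N} \<tau>"
      by (rule strict_mono_on_insert_zero[OF mono(2)[unfolded \<tau>(2)]]) auto
    ultimately have "\<tau> \<in> shuffle_perms (i - 1) j"
      using \<tau> k0 assms by (simp add: shuffle_perms_def)
    then show ?thesis using k0 \<tau> by auto
  next
    assume ki: "k = i \<and> j \<noteq> 0"
    then obtain \<tau> where \<tau>: "\<tau> permutes {..<N}" "\<sigma> = insert_zero i \<tau>"
      using insert_zero_surj[OF perm] k by metis
    have "strict_mono_on {..<i} \<tau>"
      by (rule strict_mono_on_insert_zero[OF mono(1)[unfolded \<tau>(2)]]) auto
    moreover have "strict_mono_on {i..<N} \<tau>"
      by (rule strict_mono_on_insert_zero[OF mono(2)[unfolded \<tau>(2)]]) auto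
    ultimately have "\<tau> \<in> shuffle_perms i (j - 1)"
      using \<tau> ki assms by (simp add: shuffle_perms_def)
    then show ?thesis using ki \<tau> by auto
  qed
next
  fix \<sigma> assume "\<sigma> \<in> ?A \<union> ?B"
  then show "\<sigma> \<in> shuffle_perms i j"
  proof
    assume "\<sigma> \<in> ?A"
    then obtain \<tau> where i: "i \<noteq> 0" and \<tau>: "\<tau> \<in> shuffle_perms (i - 1) j" "\<sigma> = insert_zero 0 \<tau>"
      by (auto split: if_splits)
    have "\<sigma> permutes {..<i + j}"
      using insert_zero_permutes[of \<tau> N 0] \<tau> i assms by (simp add: shuffle_perms_def)
    moreover have "strict_mono_on {..<i} \<sigma>"
      unfolding \<tau>(2) by (rule insert_zero_strict_mono_on[where B = "{..<i - 1}"])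
        (use \<tau>(1) in \<open>auto simp: shuffle_perms_def\<close>)
    moreover have "strict_mono_on {i..<i + j} \<sigma>"
      unfolding \<tau>(2) by (rule insert_zero_strict_mono_on[where B = "{i - 1..<i - 1 + j}"])
        (use \<tau>(1) i in \<open>auto simp: shuffle_perms_def\<close>)
    ultimately show ?thesis by (simp add: shuffle_perms_def)
  next
    assume "\<sigma> \<in> ?B"
    then obtain \<tau> where j: "j \<noteq> 0" and \<tau>: "\<tau> \<in> shuffle_perms i (j - 1)" "\<sigma> = insert_zero i \<tau>"
      by (auto split: if_splits)
    have "\<sigma> permutes {..<i + j}"
      using insert_zero_permutes[of \<tau> N i] \<tau> j assms by (simp add: shuffle_perms_def)
    moreover have "strict_mono_on {..<i} \<sigma>"
      unfolding \<tau>(2) by (rule insert_zero_strict_mono_on[where B = "{..<i}"])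
        (use \<tau>(1) in \<open>auto simp: shuffle_perms_def\<close>)
    moreover have "strict_mono_on {i..<i + j} \<sigma>"
      unfolding \<tau>(2) by (rule insert_zero_strict_mono_on[where B = "{i..<i + (j - 1)}"])
        (use \<tau>(1) j in \<open>auto simp: shuffle_perms_def\<close>)
    ultimately show ?thesis by (simp add: shuffle_perms_def)
  qed
qed

lemma shuffle_perms_0_0: "shuffle_perms 0 0 = {id}"
  by (auto simp: shuffle_perms_def id_def)

text \<open>The first component is the exponent of the Koszul sign of the splitting.\<close>

fun splits :: "('a \<Rightarrow> int) \<Rightarrow> 'a list \<Rightarrow> (int \<times> 'a list \<times> 'a list) list" where
  "splits d [] = [(0, [], [])]"
| "splits d (x # xs) =
    map (\<lambda>(e, I, J). (e, x # I, J)) (splits d xs) @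
    map (\<lambda>(e, I, J). (e + d x * sum_list (map d I), I, x # J)) (splits d xs)"

lemma splits_length: "(e, I, J) \<in> set (splits d xs) \<Longrightarrow> length I + length J = length xs"
  by (induction d xs arbitrary: e I J rule: splits.induct) fastforce+

lemma splits_set: "(e, I, J) \<in> set (splits d xs) \<Longrightarrow> set I \<union> set J = set xs"
  by (induction d xs arbitrary: e I J rule: splits.induct) fastforce+

definition koszul_exp :: "int \<Rightarrow> int"
  where "koszul_exp e = (if even e then 1 else - 1)"

lemma sum_nth_permute_list:
  assumes "\<sigma> permutes {..<length xs}" "i \<le> length xs"
  shows "(\<Sum>k<i. map d xs ! \<sigma> k) = sum_list (map d (take i (permute_list \<sigma> xs)))"
proof -
  have "\<sigma> k < length xs" if "k < i" for k
    using that assms permutes_in_image[OF assms(1), of k] by auto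
  then show ?thesis
    using assms by (simp add: sum_list_sum_nth permute_list_nth atLeast0LessThan min_absorb2)
qed

text \<open>The recursion of \<open>splits\<close> mirrors the classification of shuffles by where
  the head of the list goes: into the first part without a sign, or into the second part, past all
  of the first. After this lemma shuffle sums are treated by induction over lists. The sign is an
  argument of \<open>g\<close> so that the induction hypothesis can absorb the sign of the
  head.\<close>

lemma sum_shuffle_perms:
  fixes g :: "int \<Rightarrow> 'a list \<Rightarrow> 'a list \<Rightarrow> 'm::comm_monoid_add"
  assumes "length xs = i + j"
  shows "(\<Sum>\<sigma>\<in>shuffle_perms i j.
      g (koszul_sign \<sigma> (map d xs)) (take i (permute_list \<sigma> xs)) (drop i (permute_list \<sigma> xs)))
    = (\<Sum>(e, I, J)\<leftarrow>filter (\<lambda>(e, I, J). length I = i) (splits d xs). g (koszul_exp e) I J)"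
  using assms
proof (induction xs arbitrary: i j g)
  case Nil
  then show ?case by (simp add: shuffle_perms_0_0 koszul_exp_def)
next
  case (Cons x xs)
  let ?N = "length xs"
  let ?G = "\<lambda>\<sigma>. g (koszul_sign \<sigma> (map d (x # xs))) (take i (permute_list \<sigma> (x # xs)))
              (drop i (permute_list \<sigma> (x # xs)))"
  let ?A = "if i = 0 then {} else insert_zero 0 ` shuffle_perms (i - 1) j"
  let ?B = "if j = 0 then {} else insert_zero i ` shuffle_perms i (j - 1)"
  have N: "i + j = Suc ?N" using Cons.prems by simp
  have A: "sum ?G ?A = (\<Sum>(e, I, J)\<leftarrow>filter (\<lambda>(e, I, J). length (x # I) = i) (splits d xs).
      g (koszul_exp e) (x # I) J)"
  proof (cases i)
    case 0
    then show ?thesis by (simp add: filter_False case_prod_unfold)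
  next
    case (Suc i')
    have "?G (insert_zero 0 \<sigma>) = g (koszul_sign \<sigma> (map d xs))
        (x # take i' (permute_list \<sigma> xs)) (drop i' (permute_list \<sigma> xs))"
      if "\<sigma> \<in> shuffle_perms i' j" for \<sigma>
    proof -
      have \<sigma>: "\<sigma> permutes {..<length xs}"
        using that N Suc by (auto dest: shuffle_perms_permutes)
      show ?thesis
        using koszul_sign_insert_zero[OF \<sigma>, of 0 "map d xs" "d x"] permute_list_insert_zero[OF \<sigma>, of 0 x] Suc
        by simp
    qed
    then have "sum ?G ?A = (\<Sum>\<sigma>\<in>shuffle_perms i' j. g (koszul_sign \<sigma> (map d xs))
        (x # take i' (permute_list \<sigma> xs)) (drop i' (permute_list \<sigma> xs)))"
      using Suc by (simp add: sum.reindex inj_on_def insert_zero_inj)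
    then show ?thesis
      using Cons.IH[of i' j "\<lambda>c I J. g c (x # I) J"] N Suc by simp
  qed
  have B: "sum ?G ?B = (\<Sum>(e, I, J)\<leftarrow>filter (\<lambda>(e, I, J). length I = i) (splits d xs).
      g (koszul_exp (e + d x * sum_list (map d I))) I (x # J))"
  proof (cases j)
    case 0
    then have "length I \<noteq> i" if "(e, I, J) \<in> set (splits d xs)" for e I J
      using splits_length[OF that] N by simp
    then have "filter (\<lambda>(e, I, J). length I = i) (splits d xs) = []"
      by (auto simp: filter_empty_conv)
    then show ?thesis using 0 by simp
  next
    case (Suc j')
    let ?k = "\<lambda>c I. (if odd (d x) \<and> odd (sum_list (map d I)) then - 1 else 1) * c"
    have "sum ?G ?B = (\<Sum>\<sigma>\<in>shuffle_perms i j'. g (?k (koszul_sign \<sigma> (map d xs)) (take i (permute_list \<sigma> xs)))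
        (take i (permute_list \<sigma> xs)) (x # drop i (permute_list \<sigma> xs)))"
    proof -
      have "?G (insert_zero i \<sigma>) = g (?k (koszul_sign \<sigma> (map d xs)) (take i (permute_list \<sigma> xs)))
        (take i (permute_list \<sigma> xs)) (x # drop i (permute_list \<sigma> xs))"
        if "\<sigma> \<in> shuffle_perms i j'" for \<sigma>
      proof -
        have \<sigma>: "\<sigma> permutes {..<length xs}" "i \<le> length xs"
          using that N Suc by (auto dest: shuffle_perms_permutes)
        have "koszul_sign (insert_zero i \<sigma>) (map d (x # xs))
            = ?k (koszul_sign \<sigma> (map d xs)) (take i (permute_list \<sigma> xs))"
          using koszul_sign_insert_zero[OF \<sigma>, of "map d xs" "d x"] sum_nth_permute_list[OF \<sigma>, of d]
          by simp
        then show ?thesis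
          using \<sigma> by (simp only: permute_list_insert_zero) simp
      qed
      then show ?thesis using Suc by (simp add: sum.reindex inj_on_def insert_zero_inj)
    qed
    also have "\<dots> = (\<Sum>(e, I, J)\<leftarrow>filter (\<lambda>(e, I, J). length I = i) (splits d xs).
        g (?k (koszul_exp e) I) I (x # J))"
      using Cons.IH[of i j' "\<lambda>c I J. g (?k c I) I (x # J)"] N Suc by simp
    also have "\<dots> = (\<Sum>(e, I, J)\<leftarrow>filter (\<lambda>(e, I, J). length I = i) (splits d xs).
        g (koszul_exp (e + d x * sum_list (map d I))) I (x # J))"
      by (intro arg_cong[of _ _ sum_list] map_cong refl) (auto simp: koszul_exp_def)
    finally show ?thesis .
  qed
  have "?A \<inter> ?B = {}"
  proof -
    have False if "insert_zero 0 \<sigma> = insert_zero i \<tau>" "i \<noteq> 0" for \<sigma> \<tau>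
      using fun_cong[OF that(1), of 0] that(2) by (simp add: insert_zero_def)
    then show ?thesis by (cases "i = 0") (auto simp: image_iff)
  qed
  then have "sum ?G (shuffle_perms i j) = sum ?G ?A + sum ?G ?B"
    unfolding shuffle_perms_Suc[OF N] by (intro sum.union_disjoint) auto
  also have "\<dots> = (\<Sum>(e, I, J)\<leftarrow>filter (\<lambda>(e, I, J). length I = i) (splits d (x # xs)). g (koszul_exp e) I J)"
    unfolding A B by (simp add: filter_map o_def case_prod_unfold)
  finally show ?case .
qed

section \<open>Cochains of all degrees\<close>

text \<open>The sign \<open>(-1)^d\<close> acting on any abelian group: sign computations then
  involve no scalars, and \<open>d\<close> may be negative.\<close>

definition sgm :: "int \<Rightarrow> 'a::ab_group_add \<Rightarrow> 'a"
  where "sgm d x = (if even d then x else - x)"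

lemma sgm_0 [simp]: "sgm 0 x = x" and sgm_zero [simp]: "sgm d 0 = 0"
  by (simp_all add: sgm_def)

lemma sgm_add: "sgm d (x + y) = sgm d x + sgm d y"
  and sgm_diff: "sgm d (x - y) = sgm d x - sgm d y"
  and sgm_minus: "sgm d (- x) = - sgm d x"
  and sgm_sgm: "sgm d (sgm e x) = sgm (d + e) x"
  by (simp_all add: sgm_def)

lemma sgm_sum: "sgm d (sum f A) = (\<Sum>i\<in>A. sgm d (f i))"
  by (simp add: sgm_def sum_negf)

lemma sgm_sum_list: "sgm d (\<Sum>x\<leftarrow>xs. f x) = (\<Sum>x\<leftarrow>xs. sgm d (f x))"
  by (induction xs) (simp_all add: sgm_add)

lemma sgm_cong: "even (d - e) \<Longrightarrow> sgm d x = sgm e x"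
  by (auto simp: sgm_def)

lemma sgm_apply: "sgm d F Xs = sgm d (F Xs)"
  by (simp add: sgm_def)

lemma (in module) scale_koszul_exp: "scale (of_int (koszul_exp e)) x = sgm e x"
  by (simp add: koszul_exp_def sgm_def)

lemma (in module) scale_minus_one_power: "scale ((- 1) ^ m) x = sgm (int m) x"
  by (simp add: sgm_def minus_one_power_iff)

section \<open>Contraction with a block of arguments, and cochains without a fixed degree\<close>

definition contr :: "'a list \<Rightarrow> ('a list list \<Rightarrow> 'a \<Rightarrow> 'b) \<Rightarrow> 'a list list \<Rightarrow> 'a \<Rightarrow> 'b"
  where "contr X F = (\<lambda>Xs. F (X # Xs))"

lemma contr_apply: "contr X F Xs x = F (X # Xs) x"
  by (simp add: contr_def)

lemma contr_zero [simp]: "contr X 0 = 0"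
  and contr_add: "contr X (F + G) = contr X F + contr X G"
  and contr_diff: "contr X (F - G) = contr X F - contr X G"
  and contr_scale: "contr X (scale_cochain sB c F) = scale_cochain sB c (contr X F)"
  by (simp_all add: contr_def fun_eq_iff scale_cochain_def sgm_def)

lemma sum_apply2: "sum f A Xs x = (\<Sum>i\<in>A. f i Xs x)"
  by (induction A rule: infinite_finite_induct) simp_all

lemma sum_list_apply2: "(\<Sum>i\<leftarrow>xs. f i) Xs x = (\<Sum>i\<leftarrow>xs. f i Xs x)"
  by (induction xs) simp_all

text \<open>The degree involution: it multiplies the component of degree \<open>q\<close> by
  \<open>(-1)^q\<close>, the sign that arises when a block of degree 1 passes a cochain, and it
  makes sense for inhomogeneous cochains.\<close>

definition altsign :: "('a list list \<Rightarrow> 'a \<Rightarrow> 'b::ab_group_add) \<Rightarrow> 'a list list \<Rightarrow> 'a \<Rightarrow> 'b"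
  where "altsign F = (\<lambda>Xs x. sgm (int (length Xs)) (F Xs x))"

text \<open>
  The conditions on a cochain are imposed on the first block only, but for all its contractions:
  the inductions below always split off the first block.
\<close>

definition first_block_ok ::
  "nat \<Rightarrow> ('k::field \<Rightarrow> 'a::ab_group_add \<Rightarrow> 'a) \<Rightarrow> ('k \<Rightarrow> 'b::ab_group_add \<Rightarrow> 'b) \<Rightarrow>
   ('a list list \<Rightarrow> 'a \<Rightarrow> 'b) \<Rightarrow> bool"
  where "first_block_ok n sA sB F \<longleftrightarrow>
    Vector_Spaces.linear sA sB (F []) \<and>
    (\<forall>X x. x \<in> set X \<longrightarrow> F [X] x = 0) \<and>
    (\<forall>X. length X \<noteq> n - 1 \<or> \<not> distinct X \<longrightarrow> contr X F = 0) \<and>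
    (\<forall>X j c y z. length X = n - 1 \<and> j < n - 1 \<longrightarrow>
      contr (X[j := sA c y + z]) F = scale_cochain sB c (contr (X[j := y]) F) + contr (X[j := z]) F)"

text \<open>The number of blocks is unrestricted, so nonzero components in infinitely many degrees
  are allowed. Its homogeneous members are the \<open>cochains\<close> of the given degree, see
  \<open>cochains_eq\<close>.\<close>

definition all_cochains ::
  "nat \<Rightarrow> ('k::field \<Rightarrow> 'a::ab_group_add \<Rightarrow> 'a) \<Rightarrow> ('k \<Rightarrow> 'b::ab_group_add \<Rightarrow> 'b) \<Rightarrow>
   ('a list list \<Rightarrow> 'a \<Rightarrow> 'b) set"
  where "all_cochains n sA sB = {F. \<forall>Ys. first_block_ok n sA sB (\<lambda>Xs. F (Ys @ Xs))}"

text \<open>With integer degrees a contraction lowers the degree by one without a case distinction;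
  in negative degrees only 0 is left.\<close>

definition homog :: "int \<Rightarrow> ('a list list \<Rightarrow> 'a \<Rightarrow> 'b::zero) \<Rightarrow> bool"
  where "homog d F \<longleftrightarrow> (\<forall>Xs. int (length Xs) \<noteq> d \<longrightarrow> F Xs = 0)"

lemma homog_contr: "homog d F \<Longrightarrow> homog (d - 1) (contr X F)"
  by (auto simp: homog_def contr_def)

lemma homog_Nil: "homog d F \<Longrightarrow> d \<noteq> 0 \<Longrightarrow> F [] = 0"
  by (auto simp: homog_def)

lemma homog_altsign: "homog d F \<Longrightarrow> altsign F = sgm d F"
  by (auto simp: homog_def altsign_def fun_eq_iff sgm_def)

text \<open>Source and target are kept apart because cochains from \<open>V\<close> to \<gg> are
  needed besides those from the direct sum to itself.\<close>

locale cochain_space = A: vector_space sA + B: vector_space sB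
  for sA :: "'k::field \<Rightarrow> 'a::ab_group_add \<Rightarrow> 'a" and sB :: "'k \<Rightarrow> 'b::ab_group_add \<Rightarrow> 'b" +
  fixes n :: nat
begin

abbreviation "\<C> \<equiv> all_cochains n sA sB"

lemma linear_iff:
  "Vector_Spaces.linear sA sB f \<longleftrightarrow> (\<forall>c y z. f (sA c y + z) = sB c (f y) + f z)"
proof
  assume "Vector_Spaces.linear sA sB f"
  then interpret f: Vector_Spaces.linear sA sB f .
  show "\<forall>c y z. f (sA c y + z) = sB c (f y) + f z"
    by (simp add: f.add f.scale)
next
  assume f: "\<forall>c y z. f (sA c y + z) = sB c (f y) + f z"
  have add: "f (y + z) = f y + f z" for y z
    using f[rule_format, of 1 y z] by simp
  have "f 0 = 0"
    using add[of 0 0] by simp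
  then have "f (sA c y) = sB c (f y)" for c y
    using f[rule_format, of c y 0] by simp
  with add show "Vector_Spaces.linear sA sB f"
    by unfold_locales auto
qed

lemma scale_cochain_add: "scale_cochain sB c (F + G) = scale_cochain sB c F + scale_cochain sB c G"
  and scale_cochain_zero: "scale_cochain sB c 0 = 0"
  and scale_cochain_uminus: "scale_cochain sB c (- F) = - scale_cochain sB c F"
  by (simp_all add: scale_cochain_def fun_eq_iff B.scale_right_distrib)

lemma first_block_ok_add:
  assumes "first_block_ok n sA sB F" "first_block_ok n sA sB G"
  shows "first_block_ok n sA sB (F + G)"
  using assms by (auto simp: first_block_ok_def linear_iff contr_add scale_cochain_add algebra_simps
      B.scale_right_distrib)

lemma first_block_ok_scale:
  assumes "first_block_ok n sA sB F"
  shows "first_block_ok n sA sB (scale_cochain sB c F)"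
  using assms
  by (auto simp: first_block_ok_def linear_iff contr_scale)
    (auto simp: scale_cochain_def fun_eq_iff algebra_simps B.scale_right_distrib)

lemma first_block_ok_zero: "first_block_ok n sA sB 0"
  by (simp add: first_block_ok_def linear_iff scale_cochain_zero)

lemma first_block_ok_altsign:
  assumes "first_block_ok n sA sB F"
  shows "first_block_ok n sA sB (altsign F)"
proof -
  have *: "contr X (altsign F) = - altsign (contr X F)" for X
    by (simp add: contr_def altsign_def sgm_def fun_eq_iff)
  have "altsign (F + G) = altsign F + altsign G" "altsign (scale_cochain sB c F) = scale_cochain sB c (altsign F)"
    "altsign 0 = 0" for F G :: "'a list list \<Rightarrow> 'a \<Rightarrow> 'b" and c
    by (simp_all add: altsign_def sgm_add fun_eq_iff scale_cochain_def) (simp_all add: sgm_def)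
  then show ?thesis
    using assms unfolding first_block_ok_def linear_iff *
    by (auto simp: scale_cochain_uminus) (auto simp: altsign_def)
qed

lemma all_cochains_ok: "F \<in> \<C> \<Longrightarrow> first_block_ok n sA sB F"
  unfolding all_cochains_def by (auto dest: spec[of _ "[]"])

lemma all_cochains_contr: "F \<in> \<C> \<Longrightarrow> contr X F \<in> \<C>"
  unfolding all_cochains_def by (auto simp: contr_def dest: spec[of _ "X # _"])

lemma all_cochains_zero [simp]: "0 \<in> \<C>"
  using first_block_ok_zero by (simp add: all_cochains_def zero_fun_def)

lemma all_cochains_add:
  assumes "F \<in> \<C>" "G \<in> \<C>"
  shows "F + G \<in> \<C>"
proof -
  have "(\<lambda>Xs. (F + G) (Ys @ Xs)) = (\<lambda>Xs. F (Ys @ Xs)) + (\<lambda>Xs. G (Ys @ Xs))" for Ys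
    by (simp add: fun_eq_iff)
  then show ?thesis
    using assms first_block_ok_add by (simp add: all_cochains_def)
qed

lemma all_cochains_scale:
  assumes "F \<in> \<C>"
  shows "scale_cochain sB c F \<in> \<C>"
proof -
  have "(\<lambda>Xs. scale_cochain sB c F (Ys @ Xs)) = scale_cochain sB c (\<lambda>Xs. F (Ys @ Xs))" for Ys
    by (simp add: scale_cochain_def)
  then show ?thesis
    using assms first_block_ok_scale by (simp add: all_cochains_def)
qed

lemma all_cochains_uminus: "F \<in> \<C> \<Longrightarrow> - F \<in> \<C>"
  using all_cochains_scale[of F "- 1"] by (simp add: scale_cochain_def fun_Compl_def)

lemma all_cochains_diff: "F \<in> \<C> \<Longrightarrow> G \<in> \<C> \<Longrightarrow> F - G \<in> \<C>"
  using all_cochains_add[of F "- G"] all_cochains_uminus by simp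

lemma all_cochains_sgm: "F \<in> \<C> \<Longrightarrow> sgm d F \<in> \<C>"
  by (simp add: sgm_def all_cochains_uminus)

lemma all_cochains_sum: "(\<And>i. i \<in> A \<Longrightarrow> f i \<in> \<C>) \<Longrightarrow> sum f A \<in> \<C>"
  by (induction A rule: infinite_finite_induct) (auto simp: all_cochains_add)

lemma all_cochains_altsign:
  assumes "F \<in> \<C>"
  shows "altsign F \<in> \<C>"
proof -
  have "(\<lambda>Xs. altsign F (Ys @ Xs)) = scale_cochain sB ((- 1) ^ length Ys) (altsign (\<lambda>Xs. F (Ys @ Xs)))" for Ys
    by (simp add: fun_eq_iff altsign_def scale_cochain_def B.scale_minus_one_power sgm_sgm)
  then show ?thesis
    using assms first_block_ok_scale first_block_ok_altsign by (simp add: all_cochains_def)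
qed

lemma all_cochains_contrI:
  assumes "first_block_ok n sA sB F" "\<And>X. contr X F \<in> \<C>"
  shows "F \<in> \<C>"
proof -
  have "first_block_ok n sA sB (\<lambda>Xs. F (Ys @ Xs))" for Ys
    using assms by (cases Ys) (auto simp: all_cochains_def contr_def)
  then show ?thesis by (simp add: all_cochains_def)
qed

lemma all_cochains_linear: "F \<in> \<C> \<Longrightarrow> Vector_Spaces.linear sA sB (F [])"
  using all_cochains_ok by (auto simp: first_block_ok_def)

lemma all_cochains_linear_arg:
  assumes "F \<in> \<C>"
  shows "Vector_Spaces.linear sA sB (F Xs)"
  using assms
proof (induction Xs arbitrary: F)
  case (Cons X Xs)
  then show ?case using Cons.IH[OF all_cochains_contr[OF Cons.prems, of X]] by (simp add: contr_def)
qed (rule all_cochains_linear)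

lemma contr_bad: "F \<in> \<C> \<Longrightarrow> length X \<noteq> n - 1 \<or> \<not> distinct X \<Longrightarrow> contr X F = 0"
  using all_cochains_ok unfolding first_block_ok_def by blast

lemma contr_slot:
  "F \<in> \<C> \<Longrightarrow> length X = n - 1 \<Longrightarrow> j < n - 1 \<Longrightarrow>
    contr (X[j := sA c y + z]) F = scale_cochain sB c (contr (X[j := y]) F) + contr (X[j := z]) F"
  using all_cochains_ok unfolding first_block_ok_def by blast

lemma last_block_zero: "F \<in> \<C> \<Longrightarrow> x \<in> set X \<Longrightarrow> F [X] x = 0"
  using all_cochains_ok unfolding first_block_ok_def by blast

lemma contr_slot_add:
  assumes "F \<in> \<C>" "j < n - 1"
  shows "contr (X[j := y + z]) F = contr (X[j := y]) F + contr (X[j := z]) F"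
proof (cases "length X = n - 1")
  case True
  then show ?thesis
    using contr_slot[OF assms(1) True assms(2), of 1 y z] by (simp add: scale_cochain_def)
qed (simp add: contr_bad[OF assms(1)])

lemma contr_slot_zero:
  assumes "F \<in> \<C>" "j < n - 1"
  shows "contr (X[j := 0]) F = 0"
  using contr_slot_add[OF assms, of X 0 0] by simp

lemma contr_slot_uminus:
  assumes "F \<in> \<C>" "j < n - 1"
  shows "contr (X[j := - y]) F = - contr (X[j := y]) F"
  using contr_slot_add[OF assms, of X y "- y"] contr_slot_zero[OF assms, of X]
  by (simp add: eq_neg_iff_add_eq_0 add.commute)

lemma contr_slot_scale:
  assumes "F \<in> \<C>" "j < n - 1"
  shows "contr (X[j := sA c y]) F = scale_cochain sB c (contr (X[j := y]) F)"
proof (cases "length X = n - 1")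
  case True
  then show ?thesis
    using contr_slot[OF assms(1) True assms(2), of c y 0] contr_slot_zero[OF assms, of X] by simp
qed (simp add: contr_bad[OF assms(1)] scale_cochain_zero)

lemma contr_slot_sgm:
  assumes "F \<in> \<C>" "j < n - 1"
  shows "contr (X[j := sgm d y]) F = sgm d (contr (X[j := y]) F)"
  by (simp add: sgm_def contr_slot_uminus[OF assms])

lemma all_cochains_outside: "F \<in> \<C> \<Longrightarrow> \<not> (\<forall>X\<in>set Xs. length X = n - 1) \<Longrightarrow> F Xs = 0"
proof (induction Xs arbitrary: F)
  case (Cons X Xs)
  then show ?case
    using contr_bad[of F X] Cons.IH[OF all_cochains_contr[of F X]]
    by (cases "length X = n - 1") (auto simp: contr_def fun_eq_iff)
qed simp

lemma all_cochains_subspace: "module.subspace (scale_cochain sB) (\<C> \<inter> {F. homog d F})"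
  (is "module.subspace _ ?S")
proof -
  interpret V: vector_space "scale_cochain sB :: 'k \<Rightarrow> ('a list list \<Rightarrow> 'a \<Rightarrow> 'b) \<Rightarrow> _"
    by unfold_locales (auto simp: scale_cochain_def fun_eq_iff algebra_simps B.scale_right_distrib
        B.scale_left_distrib)
  show ?thesis
    by (rule V.subspaceI)
      (auto intro: all_cochains_add all_cochains_scale, auto simp: homog_def scale_cochain_def fun_eq_iff)
qed

end

section \<open>The circle product\<close>

text \<open>
  Splitting off the first block turns the sum over shuffles into a recursion: that block is either
  an argument of \<open>Q\<close>, or an argument of \<open>F\<close> which \<open>Q\<close> has to pass with a sign, or, if \<open>Q\<close> has
  degree 0, the block into which \<open>Q\<close> is inserted. All identities for the circle product become
  inductions along this derivation rule.
\<close>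

fun star :: "nat \<Rightarrow> ('a list list \<Rightarrow> 'a \<Rightarrow> 'a::ab_group_add) \<Rightarrow> ('a list list \<Rightarrow> 'a \<Rightarrow> 'a) \<Rightarrow>
    'a list list \<Rightarrow> 'a \<Rightarrow> 'a" where
  "star n F Q [] x = F [] (Q [] x)"
| "star n F Q (X # Xs) x = star n F (contr X Q) Xs x + star n (contr X F) (altsign Q) Xs x +
    (\<Sum>i<n - 1. F (X[i := Q [] (X ! i)] # Xs) x)"

text \<open>The map \<open>f\<close> is extended to the exterior power as a derivation, and
  \<open>F\<close> is contracted with the result.\<close>

definition insert_block :: "nat \<Rightarrow> 'a list \<Rightarrow> ('a \<Rightarrow> 'a) \<Rightarrow> ('a list list \<Rightarrow> 'a \<Rightarrow> 'b::ab_group_add) \<Rightarrow>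
    'a list list \<Rightarrow> 'a \<Rightarrow> 'b"
  where "insert_block n X f F = (\<Sum>i<n - 1. contr (X[i := f (X ! i)]) F)"

lemma star_Cons:
  "star n F Q (X # Xs) x = star n F (contr X Q) Xs x + star n (contr X F) (altsign Q) Xs x +
    insert_block n X (Q []) F Xs x"
  by (simp add: insert_block_def sum_apply2 contr_apply)

declare star.simps(2) [simp del]

lemma contr_star:
  "contr X (star n F Q) = star n F (contr X Q) + star n (contr X F) (altsign Q) + insert_block n X (Q []) F"
  by (simp add: fun_eq_iff contr_apply star_Cons)

lemma insert_block_add_cochain: "insert_block n X f (F + G) = insert_block n X f F + insert_block n X f G"
  by (simp add: insert_block_def contr_add sum.distrib)

lemma insert_block_scale_cochain:
  assumes "vector_space sB"
  shows "insert_block n X f (scale_cochain sB c F) = scale_cochain sB c (insert_block n X f F)"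
proof -
  interpret vector_space sB by fact
  show ?thesis
    by (simp add: insert_block_def contr_scale)
      (simp add: scale_cochain_def fun_eq_iff sum_apply2 scale_sum_right)
qed

lemma star_add_left: "star n (F + G) Q = star n F Q + star n G Q"
proof -
  have "star n (F + G) Q Xs x = star n F Q Xs x + star n G Q Xs x" for Xs x
    by (induction Xs arbitrary: F G Q) (simp_all add: star_Cons contr_add insert_block_add_cochain)
  then show ?thesis by (simp add: fun_eq_iff)
qed

lemma star_zero_left [simp]: "star n 0 Q = 0"
  using star_add_left[of n 0 0 Q] by simp

lemma star_uminus_left: "star n (- F) Q = - star n F Q"
  using star_add_left[of n F "- F" Q] by (simp add: eq_neg_iff_add_eq_0 add.commute)

lemma star_diff_left: "star n (F - G) Q = star n F Q - star n G Q"
  using star_add_left[of n F "- G" Q] by (simp add: star_uminus_left)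

lemma star_sgm_left: "star n (sgm d F) Q = sgm d (star n F Q)"
  by (simp add: sgm_def star_uminus_left)

lemma star_sum_left: "star n (sum f A) Q = (\<Sum>i\<in>A. star n (f i) Q)"
  using sum_comp_morphism[where h = "\<lambda>F. star n F Q" and g = f and A = A]
  by (simp add: star_add_left o_def)

lemma star_scale_left:
  assumes "vector_space s"
  shows "star n (scale_cochain s c F) Q = scale_cochain s c (star n F Q)"
proof -
  interpret vector_space s by fact
  have "star n (scale_cochain s c F) Q Xs x = s c (star n F Q Xs x)" for Xs x
  proof (induction Xs arbitrary: F Q)
    case (Cons X Xs)
    then show ?case
      by (simp add: star_Cons contr_scale insert_block_scale_cochain[OF assms] scale_right_distrib)
        (simp add: scale_cochain_def)
  qed (simp add: scale_cochain_def)
  then show ?thesis by (simp add: fun_eq_iff scale_cochain_def)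
qed

lemma altsign_add: "altsign (F + G) = altsign F + altsign G"
  and altsign_scale: "vector_space sB \<Longrightarrow> altsign (scale_cochain sB c F) = scale_cochain sB c (altsign F)"
  by (simp_all add: altsign_def sgm_def fun_eq_iff scale_cochain_def module.scale_minus_right
      module_iff_vector_space)

lemma altsign_zero [simp]: "altsign 0 = 0"
  by (simp add: altsign_def fun_eq_iff)

lemma altsign_Nil: "altsign F [] = F []"
  by (simp add: altsign_def)

locale cochain_algebra = vector_space s
  for s :: "'k::field \<Rightarrow> 'w::ab_group_add \<Rightarrow> 'w" +
  fixes n :: nat
begin

sublocale cochain_space s s n
  by unfold_locales

abbreviation circ (infixl "\<star>" 70) where "F \<star> Q \<equiv> star n F Q"

lemma cochain_arg_add: "F \<in> \<C> \<Longrightarrow> F Xs (y + z) = F Xs y + F Xs z"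
  and cochain_arg_scale: "F \<in> \<C> \<Longrightarrow> F Xs (s c y) = s c (F Xs y)"
  and cochain_arg_zero: "F \<in> \<C> \<Longrightarrow> F Xs 0 = 0"
  and cochain_arg_uminus: "F \<in> \<C> \<Longrightarrow> F Xs (- y) = - F Xs y"
  using all_cochains_linear_arg[of F Xs] unfolding linear_iff_module_hom
  by (auto simp: module_hom.add module_hom.scale module_hom.zero module_hom.neg)

lemma insert_block_add:
  assumes "F \<in> \<C>"
  shows "insert_block n X (\<lambda>y. f y + g y) F = insert_block n X f F + insert_block n X g F"
  by (simp add: insert_block_def contr_slot_add[OF assms] sum.distrib)

lemma insert_block_scale:
  assumes "F \<in> \<C>"
  shows "insert_block n X (\<lambda>y. s c (f y)) F = scale_cochain s c (insert_block n X f F)"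
  by (simp add: insert_block_def contr_slot_scale[OF assms])
    (simp add: fun_eq_iff scale_cochain_def sum_apply2 scale_sum_right)

lemma insert_block_zero:
  assumes "F \<in> \<C>"
  shows "insert_block n X 0 F = 0"
  by (simp add: insert_block_def contr_slot_zero[OF assms])

lemma insert_block_closed: "F \<in> \<C> \<Longrightarrow> insert_block n X f F \<in> \<C>"
  unfolding insert_block_def by (intro all_cochains_sum all_cochains_contr)

text \<open>The right factor is inserted into the slots of \<open>F\<close>, so, in contrast to
  \<open>star_add_left\<close>, the multilinearity of \<open>F\<close> enters.\<close>

lemma star_add_right:
  assumes "F \<in> \<C>"
  shows "F \<star> (P + Q) = F \<star> P + F \<star> Q"
proof -
  have "(F \<star> (P + Q)) Xs x = (F \<star> P) Xs x + (F \<star> Q) Xs x" if "F \<in> \<C>" for F Xs x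
    using that
  proof (induction Xs arbitrary: F P Q)
    case (Cons X Xs)
    have "insert_block n X ((P + Q) []) F = insert_block n X (P []) F + insert_block n X (Q []) F"
      using insert_block_add[OF Cons.prems, of X "P []" "Q []"] by (simp add: plus_fun_def)
    moreover have "(F \<star> (contr X P + contr X Q)) Xs x = (F \<star> contr X P) Xs x + (F \<star> contr X Q) Xs x"
      by (rule Cons.IH[OF Cons.prems])
    moreover have "(contr X F \<star> (altsign P + altsign Q)) Xs x
        = (contr X F \<star> altsign P) Xs x + (contr X F \<star> altsign Q) Xs x"
      by (rule Cons.IH[OF all_cochains_contr[OF Cons.prems]])
    ultimately show "(F \<star> (P + Q)) (X # Xs) x = (F \<star> P) (X # Xs) x + (F \<star> Q) (X # Xs) x"
      unfolding star_Cons contr_add altsign_add by simp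
  qed (simp add: cochain_arg_add)
  then show ?thesis using assms by (simp add: fun_eq_iff)
qed

lemma star_scale_right:
  assumes "F \<in> \<C>"
  shows "F \<star> scale_cochain s c Q = scale_cochain s c (F \<star> Q)"
proof -
  have "(F \<star> scale_cochain s c Q) Xs x = s c ((F \<star> Q) Xs x)" if "F \<in> \<C>" for F Xs x
    using that
  proof (induction Xs arbitrary: F Q)
    case (Cons X Xs)
    have "insert_block n X (scale_cochain s c Q []) F = scale_cochain s c (insert_block n X (Q []) F)"
      using insert_block_scale[OF Cons.prems, of X c "Q []"] by (simp add: scale_cochain_def)
    then show ?case
      using Cons
      by (simp add: star_Cons contr_scale altsign_scale vector_space_axioms all_cochains_contr
          scale_right_distrib) (simp add: scale_cochain_def)
  qed (simp add: cochain_arg_scale scale_cochain_def)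
  then show ?thesis using assms by (simp add: fun_eq_iff scale_cochain_def)
qed

lemma star_zero_right [simp]: "F \<in> \<C> \<Longrightarrow> F \<star> 0 = 0"
  using star_add_right[of F 0 0] by simp

lemma star_uminus_right: "F \<in> \<C> \<Longrightarrow> F \<star> (- Q) = - (F \<star> Q)"
  using star_add_right[of F Q "- Q"] by (simp add: eq_neg_iff_add_eq_0 add.commute)

lemma star_diff_right: "F \<in> \<C> \<Longrightarrow> F \<star> (P - Q) = F \<star> P - F \<star> Q"
  using star_add_right[of F P "- Q"] by (simp add: star_uminus_right)

lemma star_sgm_right: "F \<in> \<C> \<Longrightarrow> F \<star> sgm d Q = sgm d (F \<star> Q)"
  by (simp add: sgm_def star_uminus_right)

lemma star_sum_right: "F \<in> \<C> \<Longrightarrow> F \<star> sum f A = (\<Sum>i\<in>A. F \<star> f i)"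
  using sum_comp_morphism[where h = "\<lambda>Q. F \<star> Q" and g = f and A = A]
  by (simp add: star_add_right o_def)

lemma homog_star:
  assumes "F \<in> \<C>" "homog f F" "homog q Q"
  shows "homog (f + q) (F \<star> Q)"
proof -
  have "(F \<star> Q) Xs x = 0" if "F \<in> \<C>" "homog f F" "homog q Q" "int (length Xs) \<noteq> f + q" for F Q f q Xs x
    using that
  proof (induction Xs arbitrary: F Q f q)
    case Nil
    then have "F [] = 0 \<or> Q [] = 0"
      using homog_Nil[of f F] homog_Nil[of q Q] by (cases "f = 0") auto
    then show ?case
      using Nil by (auto simp: cochain_arg_zero)
  next
    case (Cons X Xs)
    have 1: "(F \<star> contr X Q) Xs x = 0"
      by (rule Cons.IH[OF Cons.prems(1,2) homog_contr[OF Cons.prems(3)]]) (use Cons.prems(4) in simp)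
    have "homog q (altsign Q)"
      using Cons.prems(3) by (simp add: homog_def altsign_def fun_eq_iff)
    then have 2: "(contr X F \<star> altsign Q) Xs x = 0"
      by (rule Cons.IH[OF all_cochains_contr[OF Cons.prems(1)] homog_contr[OF Cons.prems(2)]])
        (use Cons.prems(4) in simp)
    \<comment> \<open>Only the degree 0 component of \<open>Q\<close> occurs here, so the term is 0
      unless \<open>q = 0\<close>, and then the degree of \<open>F\<close> excludes it.\<close>
    have 3: "insert_block n X (Q []) F Xs x = 0"
    proof (cases "q = 0")
      case True
      then have "contr Y F Xs = 0" for Y
        using homog_contr[OF Cons.prems(2), of Y] Cons.prems(4) by (simp add: homog_def)
      then show ?thesis by (simp add: insert_block_def sum_apply2)
    next
      case False
      then show ?thesis
        using homog_Nil[OF Cons.prems(3)] by (simp add: insert_block_zero[OF Cons.prems(1)])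
    qed
    show ?case using 1 2 3 by (simp add: star_Cons)
  qed
  then show ?thesis using assms by (auto simp: homog_def fun_eq_iff)
qed

text \<open>Polarization: put \<open>X ! j + y\<close> into both slots, where \<open>F\<close>
  vanishes, and expand.\<close>

lemma contr_exchange:
  assumes "F \<in> \<C>" "length X = n - 1" "i < n - 1" "j < n - 1" "i \<noteq> j" "X ! i = X ! j"
  shows "contr (X[i := y]) F + contr (X[j := y]) F = 0"
proof -
  have same: "contr (X[i := z, j := z]) F = 0" for z
  proof (rule contr_bad[OF assms(1)])
    have "X[i := z, j := z] ! i = X[i := z, j := z] ! j" using assms by simp
    then show "length (X[i := z, j := z]) \<noteq> n - 1 \<or> \<not> distinct (X[i := z, j := z])"
      using assms nth_eq_iff_index_eq[of "X[i := z, j := z]" i j] by auto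
  qed
  have id: "X[i := X ! j] = X" "X[j := X ! j] = X" "X[i := y, j := X ! j] = X[i := y]"
    using assms by (metis list_update_id, simp, metis list_update_id list_update_swap)
  have add: "contr (X[i := a + b, j := z]) F = contr (X[i := a, j := z]) F + contr (X[i := b, j := z]) F" for a b z
    unfolding list_update_swap[OF assms(5)] by (rule contr_slot_add[OF assms(1,3)])
  have "0 = contr (X[i := X ! j + y, j := X ! j + y]) F"
    by (simp add: same)
  also have "\<dots> = contr (X[i := X ! j, j := X ! j]) F + contr (X[i := y, j := X ! j]) F
      + (contr (X[i := X ! j, j := y]) F + contr (X[i := y, j := y]) F)"
    unfolding contr_slot_add[OF assms(1,4)] add ..
  finally show ?thesis
    using same[of y] same[of "X ! j"] by (simp add: id)
qed

text \<open>The same polarization across the border between the last block and the separate last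
  argument, which together form one \<open>n\<close>-fold exterior product.\<close>

lemma last_block_exchange:
  assumes "F \<in> \<C>" "length X = n - 1" "i < n - 1"
  shows "F [X] y + F [X[i := y]] (X ! i) = 0"
proof -
  have "F [X[i := X ! i + y]] z = F [X] z + F [X[i := y]] z" for z
    using contr_slot_add[OF assms(1,3), of X "X ! i" y] by (simp add: contr_def fun_eq_iff)
  then have "F [X[i := X ! i + y]] (X ! i + y)
      = F [X] (X ! i) + F [X] y + (F [X[i := y]] (X ! i) + F [X[i := y]] y)"
    by (simp add: cochain_arg_add[OF assms(1)])
  then show ?thesis
    using assms by (simp add: last_block_zero set_update_memI)
qed

lemma first_block_ok_star:
  assumes F: "F \<in> \<C>" and Q: "Q \<in> \<C>"
  shows "first_block_ok n s s (F \<star> Q)"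
proof -
  have lin: "Vector_Spaces.linear s s ((F \<star> Q) [])"
    unfolding linear_iff using F Q by (simp add: cochain_arg_add cochain_arg_scale)
  have bad: "contr X (F \<star> Q) = 0" if X: "length X \<noteq> n - 1 \<or> \<not> distinct X" for X
  proof -
    have "insert_block n X (Q []) F = 0"
    proof (cases "length X = n - 1")
      case False
      then show ?thesis by (simp add: insert_block_def contr_bad[OF F])
    next
      case True
      then obtain a b where ab: "a < n - 1" "b < n - 1" "a \<noteq> b" "X ! a = X ! b"
        using X by (auto simp: distinct_conv_nth)
      let ?t = "\<lambda>i. contr (X[i := Q [] (X ! i)]) F"
      \<comment> \<open>An insertion away from the equal entries at \<open>a\<close> and
        \<open>b\<close> leaves them equal; the two remaining insertions cancel by
        \<open>contr_exchange\<close>.\<close>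
      have "?t i = 0" if "i < n - 1" "i \<noteq> a" "i \<noteq> b" for i
      proof (rule contr_bad[OF F], rule disjI2)
        show "\<not> distinct (X[i := Q [] (X ! i)])"
          using that ab True nth_eq_iff_index_eq[of "X[i := Q [] (X ! i)]" a b] by auto
      qed
      then have "insert_block n X (Q []) F = (\<Sum>i\<in>{a, b}. ?t i)"
        unfolding insert_block_def using ab by (intro sum.mono_neutral_right) auto
      also have "\<dots> = 0"
        using contr_exchange[OF F True ab, of "Q [] (X ! b)"] ab by simp
      finally show ?thesis .
    qed
    then show ?thesis
      using contr_bad[OF F X] contr_bad[OF Q X] F by (simp add: contr_star)
  qed
  have last: "(F \<star> Q) [X] x = 0" if x: "x \<in> set X" for X x
  proof (cases "length X \<noteq> n - 1 \<or> \<not> distinct X")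
    case True
    then show ?thesis using bad[OF True] by (simp add: contr_def fun_eq_iff)
  next
    case False
    then obtain a where a: "a < n - 1" "x = X ! a" and len: "length X = n - 1"
      using x by (metis in_set_conv_nth)
    \<comment> \<open>An insertion away from \<open>a\<close> leaves the entry \<open>x\<close> in
      the block. The insertion at \<open>a\<close> survives and cancels against
      \<open>F [X] (Q [] x)\<close>.\<close>
    have "F [X[i := Q [] (X ! i)]] x = 0" if "i < n - 1" "i \<noteq> a" for i
      by (rule last_block_zero[OF F])
        (use that a len in \<open>auto simp: in_set_conv_nth intro!: exI[of _ a]\<close>)
    then have "(\<Sum>i<n - 1. F [X[i := Q [] (X ! i)]] x) = (\<Sum>i\<in>{a}. F [X[i := Q [] (X ! i)]] x)"
      using a by (intro sum.mono_neutral_right) auto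
    then have "(F \<star> Q) [X] x = F [] (Q [X] x) + (F [X] (Q [] x) + F [X[a := Q [] x]] (X ! a))"
      using a by (simp add: star.simps(2) contr_def altsign_Nil)
    then show ?thesis
      using last_block_exchange[OF F len a(1), of "Q [] x"] last_block_zero[OF Q x]
      by (simp add: cochain_arg_zero[OF F])
  qed
  have slot: "contr (X[j := s c y + z]) (F \<star> Q)
      = scale_cochain s c (contr (X[j := y]) (F \<star> Q)) + contr (X[j := z]) (F \<star> Q)"
    if X: "length X = n - 1" and j: "j < n - 1" for X j c y z
  proof -
    let ?u = "\<lambda>y. X[j := y]"
    let ?t = "\<lambda>y i. contr ((?u y)[i := Q [] (?u y ! i)]) F"
    have t: "?t (s c y + z) i = scale_cochain s c (?t y i) + ?t z i" if i: "i < n - 1" for i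
    proof (cases "i = j")
      case True
      have "?t w i = contr (X[i := Q [] w]) F" for w
        using X i True by simp
      then show ?thesis
        using X j True by (simp add: cochain_arg_add[OF Q] cochain_arg_scale[OF Q] contr_slot[OF F])
    next
      case False
      have "?t w i = contr ((X[i := Q [] (X ! i)])[j := w]) F" for w
        using False by (simp add: list_update_swap)
      then show ?thesis
        using X j by (simp add: contr_slot[OF F])
    qed
    have ib: "insert_block n (?u (s c y + z)) (Q []) F
        = scale_cochain s c (insert_block n (?u y) (Q []) F) + insert_block n (?u z) (Q []) F"
      using t by (simp add: insert_block_def sum.distrib)
        (simp add: fun_eq_iff scale_cochain_def sum_apply2 scale_sum_right)
    show ?thesis
      unfolding contr_star contr_slot[OF F X j] contr_slot[OF Q X j] ib
      by (simp add: star_add_left star_scale_left[OF vector_space_axioms] star_add_right[OF F]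
          star_scale_right[OF F] scale_cochain_add algebra_simps)
  qed
  show ?thesis
    unfolding first_block_ok_def using lin bad last slot by blast
qed

lemma star_closed:
  assumes "F \<in> \<C>" "Q \<in> \<C>"
  shows "F \<star> Q \<in> \<C>"
proof -
  have "first_block_ok n s s (\<lambda>Xs. (F \<star> Q) (Ys @ Xs))" if "F \<in> \<C>" "Q \<in> \<C>" for F Q Ys
    using that
  proof (induction Ys arbitrary: F Q)
    case Nil
    then show ?case by (simp add: first_block_ok_star)
  next
    case (Cons Y Ys)
    have "(\<lambda>Xs. (F \<star> Q) ((Y # Ys) @ Xs)) = (\<lambda>Xs. (F \<star> contr Y Q) (Ys @ Xs))
        + (\<lambda>Xs. (contr Y F \<star> altsign Q) (Ys @ Xs)) + (\<lambda>Xs. insert_block n Y (Q []) F (Ys @ Xs))"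
      by (simp add: fun_eq_iff star_Cons)
    moreover have "first_block_ok n s s (\<lambda>Xs. insert_block n Y (Q []) F (Ys @ Xs))"
      using insert_block_closed[OF Cons.prems(1)] unfolding all_cochains_def by blast
    ultimately show ?case
      using Cons by (simp add: first_block_ok_add all_cochains_contr all_cochains_altsign)
  qed
  then show ?thesis using assms by (simp add: all_cochains_def)
qed

section \<open>The graded pre-Lie identity\<close>

definition associator where "associator F P Q = (F \<star> P) \<star> Q - F \<star> (P \<star> Q)"

text \<open>By \<open>contr_star\<close>, splitting off a block is a graded derivation of the circle
  product up to an insertion term, hence a derivation of the associator up to what these insertion
  terms leave over; the last two lines of the formula collect this remainder.\<close>

lemma contr_associator:
  assumes F: "F \<in> \<C>" and P: "P \<in> \<C>" "homog p P" and Q: "Q \<in> \<C>" "homog q Q"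
  shows "contr X (associator F P Q) = associator F P (contr X Q) + sgm q (associator F (contr X P) Q)
    + sgm (p + q) (associator (contr X F) P Q)
    + (sgm q (insert_block n X (P []) F \<star> Q) + sgm p (insert_block n X (Q []) F \<star> P)
       + ((\<Sum>i<n - 1. insert_block n (X[i := Q [] (X ! i)]) (P []) F) - insert_block n X (\<lambda>y. P [] (Q [] y)) F))"
proof -
  note cl = F P(1) Q(1) star_closed all_cochains_contr insert_block_closed
  note alt = homog_altsign[OF P(2)] homog_altsign[OF Q(2)] homog_altsign[OF homog_star[OF P(1,2) Q(2)]]
  have ib: "insert_block n X f (F \<star> P) = F \<star> insert_block n X f P + sgm p (insert_block n X f F \<star> P)
      + (\<Sum>i<n - 1. insert_block n (X[i := f (X ! i)]) (P []) F)" for f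
    by (simp add: insert_block_def contr_star alt sum.distrib star_sum_right[OF F] star_sum_left
        star_sgm_right cl sgm_sum)
  have PQ: "(P \<star> Q) [] = (\<lambda>y. P [] (Q [] y))"
    by (simp add: fun_eq_iff)
  show ?thesis
    by (simp add: associator_def contr_diff contr_star alt ib PQ star_add_left star_add_right
        star_sgm_left star_sgm_right sgm_add sgm_diff sgm_sgm cl algebra_simps)
qed

text \<open>Two successive insertions contain the insertion of the composite as the terms that hit
  the same slot twice. What remains hits two different slots, and this is symmetric in
  \<open>f\<close> and \<open>g\<close>.\<close>

lemma insert_block_twice:
  assumes F: "F \<in> \<C>"
  shows "(\<Sum>i<n - 1. insert_block n (X[i := g (X ! i)]) f F) - insert_block n X (\<lambda>y. f (g y)) F
    = (\<Sum>(i, j)\<in>{(i, j). i < n - 1 \<and> j < n - 1 \<and> i \<noteq> j}. contr (X[i := g (X ! i), j := f (X ! j)]) F)"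
proof (cases "length X = n - 1")
  case False
  then show ?thesis by (simp add: insert_block_def contr_bad[OF F] case_prod_unfold)
next
  case True
  let ?t = "\<lambda>i j. contr (X[i := g (X ! i), j := f (X[i := g (X ! i)] ! j)]) F"
  let ?D = "{(i, j). i < n - 1 \<and> j < n - 1 \<and> i \<noteq> j}"
  have "(\<Sum>i<n - 1. insert_block n (X[i := g (X ! i)]) f F) = (\<Sum>(i, j)\<in>{..<n - 1} \<times> {..<n - 1}. ?t i j)"
    by (simp add: insert_block_def sum.cartesian_product)
  also have "{..<n - 1} \<times> {..<n - 1} = ?D \<union> (\<lambda>i. (i, i)) ` {..<n - 1}"
    by auto
  also have "(\<Sum>(i, j)\<in>\<dots>. ?t i j) = (\<Sum>(i, j)\<in>?D. ?t i j) + (\<Sum>(i, j)\<in>(\<lambda>i. (i, i)) ` {..<n - 1}. ?t i j)"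
    by (intro sum.union_disjoint finite_subset[of ?D "{..<n - 1} \<times> {..<n - 1}"]) auto
  also have "(\<Sum>(i, j)\<in>(\<lambda>i. (i, i)) ` {..<n - 1}. ?t i j) = insert_block n X (\<lambda>y. f (g y)) F"
    using True by (simp add: sum.reindex inj_on_def insert_block_def)
  also have "(\<Sum>(i, j)\<in>?D. ?t i j) = (\<Sum>(i, j)\<in>?D. contr (X[i := g (X ! i), j := f (X ! j)]) F)"
    by (intro sum.cong) auto
  finally show ?thesis by (simp only: add_diff_cancel_right')
qed

lemma insert_block_twice_commute:
  assumes F: "F \<in> \<C>"
  shows "(\<Sum>i<n - 1. insert_block n (X[i := g (X ! i)]) f F) - insert_block n X (\<lambda>y. f (g y)) F
    = (\<Sum>i<n - 1. insert_block n (X[i := f (X ! i)]) g F) - insert_block n X (\<lambda>y. g (f y)) F"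
  unfolding insert_block_twice[OF F]
  by (rule sum.reindex_bij_witness[where i = prod.swap and j = prod.swap])
    (auto simp: list_update_swap)

text \<open>Sign bookkeeping for the next theorem. The remainder terms \<open>t1\<close>,
  \<open>t2\<close>, \<open>d\<close> contain the degree 0 component of \<open>P\<close> or
  \<open>Q\<close>, so they are nonzero only if one of the degrees is 0. In particular they vanish
  when \<open>p * q\<close> is odd, and therefore can be symmetric without a sign.\<close>

lemma sgm_combine:
  fixes a1 :: "'e::ab_group_add"
  assumes "a1 = sgm (p * (q - 1)) b2" "a2 = sgm ((p - 1) * q) b1" "a3 = sgm (p * q) b3"
    and "odd (p * q) \<Longrightarrow> t1 = 0" "odd (p * q) \<Longrightarrow> t2 = 0" "odd (p * q) \<Longrightarrow> d = 0"
  shows "a1 + sgm q a2 + sgm (p + q) a3 + (sgm q t1 + sgm p t2 + d)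
    = sgm (p * q) (b1 + sgm p b2 + sgm (q + p) b3 + (sgm p t2 + sgm q t1 + d))"
  unfolding assms(1-3) using assms(4-6)
  by (cases "even p"; cases "even q") (simp_all add: sgm_def)

text \<open>In \<open>contr_associator\<close> the associators on the right have one factor
  contracted, so the induction hypothesis exchanges their last two arguments; the remainder is
  already symmetric under this exchange, for the double insertion by
  \<open>insert_block_twice_commute\<close>.\<close>

theorem associator_commute:
  assumes "F \<in> \<C>" "P \<in> \<C>" "homog p P" "Q \<in> \<C>" "homog q Q"
  shows "associator F P Q = sgm (p * q) (associator F Q P)"
proof -
  have "associator F P Q Xs x = sgm (p * q) (associator F Q P Xs x)"
    if "F \<in> \<C>" "P \<in> \<C>" "homog p P" "Q \<in> \<C>" "homog q Q" for F P Q p q Xs x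
    using that
  proof (induction Xs arbitrary: F P Q p q)
    case Nil
    then show ?case by (simp add: associator_def)
  next
    case (Cons X Xs)
    note F = Cons.prems(1) and P = Cons.prems(2,3) and Q = Cons.prems(4,5)
    note cX = all_cochains_contr[where X = X] and hX = homog_contr[where X = X]
    define D where "D f g = (\<Sum>i<n - 1. insert_block n (X[i := g (X ! i)]) f F) - insert_block n X (\<lambda>y. f (g y)) F"
      for f g
    have D: "D f g = D g f" for f g
      unfolding D_def by (rule insert_block_twice_commute[OF F])
    have zP: "insert_block n X (P []) F = 0" if "p \<noteq> 0"
      using homog_Nil[OF P(2) that] insert_block_zero[OF F] by simp
    have zQ: "insert_block n X (Q []) F = 0" if "q \<noteq> 0"
      using homog_Nil[OF Q(2) that] insert_block_zero[OF F] by simp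
    have IH: "associator F P (contr X Q) Xs x = sgm (p * (q - 1)) (associator F (contr X Q) P Xs x)"
      "associator F (contr X P) Q Xs x = sgm ((p - 1) * q) (associator F Q (contr X P) Xs x)"
      "associator (contr X F) P Q Xs x = sgm (p * q) (associator (contr X F) Q P Xs x)"
      by (rule Cons.IH[OF F P cX[OF Q(1)] hX[OF Q(2)]] Cons.IH[OF F cX[OF P(1)] hX[OF P(2)] Q]
          Cons.IH[OF cX[OF F] P Q])+
    have A: "associator F P Q (X # Xs) x = (associator F P (contr X Q) + sgm q (associator F (contr X P) Q)
        + sgm (p + q) (associator (contr X F) P Q)
        + (sgm q (insert_block n X (P []) F \<star> Q) + sgm p (insert_block n X (Q []) F \<star> P) + D (P []) (Q []))) Xs x"
      using contr_associator[OF F P Q, of X] by (simp add: contr_def D_def fun_eq_iff)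
    have B: "associator F Q P (X # Xs) x = (associator F Q (contr X P) + sgm p (associator F (contr X Q) P)
        + sgm (q + p) (associator (contr X F) Q P)
        + (sgm p (insert_block n X (Q []) F \<star> P) + sgm q (insert_block n X (P []) F \<star> Q) + D (P []) (Q []))) Xs x"
      using contr_associator[OF F Q P, of X] unfolding D[of "P []"]
      by (simp add: contr_def D_def fun_eq_iff)
    have zD: "D (P []) (Q []) = 0" if "p \<noteq> 0"
    proof -
      have P0: "P [] = 0"
        by (rule homog_Nil[OF P(2) that])
      then have "insert_block n X (\<lambda>y. P [] (Q [] y)) F = insert_block n X 0 F"
        by (intro arg_cong[where f = "\<lambda>f. insert_block n X f F"]) (simp add: fun_eq_iff)
      then show ?thesis
        unfolding D_def P0 insert_block_zero[OF F] by simp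
    qed
    have z: "p \<noteq> 0 \<and> q \<noteq> 0" if "odd (p * q)"
      using that by auto
    show "associator F P Q (X # Xs) x = sgm (p * q) (associator F Q P (X # Xs) x)"
      unfolding A B plus_fun_apply sgm_apply
      by (rule sgm_combine[OF IH]) (use z zP zQ zD in simp_all)
  qed
  from this[OF assms] show ?thesis
    by (intro ext) (simp only: sgm_apply)
qed

end

section \<open>The graded Lie bracket\<close>

lemma permute_list_take:
  assumes "\<sigma> permutes {..<m}" "m \<le> length xs"
  shows "permute_list \<sigma> xs = permute_list \<sigma> (take m xs) @ drop m xs"
proof (rule nth_equalityI)
  fix k assume k: "k < length (permute_list \<sigma> xs)"
  have "\<sigma> permutes {..<length xs}"
    using permutes_subset[OF assms(1)] assms(2) by auto
  then have "permute_list \<sigma> xs ! k = xs ! \<sigma> k"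
    using k by (simp add: permute_list_nth)
  moreover have "\<sigma> k < m" if "k < m"
    using permutes_in_image[OF assms(1), of k] that by simp
  moreover have "\<sigma> k = k" if "\<not> k < m"
    using permutes_not_in[OF assms(1), of k] that by simp
  ultimately show "permute_list \<sigma> xs ! k = (permute_list \<sigma> (take m xs) @ drop m xs) ! k"
    using k assms by (cases "k < m") (simp_all add: nth_append permute_list_nth)
qed (use assms in simp)

abbreviation block_splits :: "'a list list \<Rightarrow> (int \<times> 'a list list \<times> 'a list list) list"
  where "block_splits \<equiv> splits (\<lambda>_. 1)"

lemma sum_shuffle_perms_sign:
  fixes g :: "int \<Rightarrow> 'a list list \<Rightarrow> 'a list list \<Rightarrow> 'm::comm_monoid_add"
  assumes "i + j \<le> length Xs"
  shows "(\<Sum>\<sigma>\<in>shuffle_perms i j. g (sign \<sigma>) (take i (permute_list \<sigma> Xs)) (take j (drop i (permute_list \<sigma> Xs))))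
    = (\<Sum>(e, I, J)\<leftarrow>filter (\<lambda>(e, I, J). length I = i) (block_splits (take (i + j) Xs)). g (koszul_exp e) I J)"
proof -
  let ?Zs = "take (i + j) Xs"
  have "g (sign \<sigma>) (take i (permute_list \<sigma> Xs)) (take j (drop i (permute_list \<sigma> Xs)))
      = g (koszul_sign \<sigma> (map (\<lambda>_. 1) ?Zs)) (take i (permute_list \<sigma> ?Zs)) (drop i (permute_list \<sigma> ?Zs))"
    if "\<sigma> \<in> shuffle_perms i j" for \<sigma>
    using assms shuffle_perms_permutes[OF that]
    by (simp add: sign_eq_koszul_sign[of \<sigma> "i + j"] map_replicate_const permute_list_take[of \<sigma> "i + j" Xs])
  then show ?thesis
    using sum_shuffle_perms[of ?Zs i j g "\<lambda>_. 1"] assms by simp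
qed

lemma sum_list_partition:
  fixes g :: "'a \<Rightarrow> 'm::comm_monoid_add"
  assumes "\<And>t. t \<in> set L \<Longrightarrow> f t \<le> (m::nat)"
  shows "(\<Sum>k\<le>m. \<Sum>t\<leftarrow>filter (\<lambda>t. f t = k) L. g t) = (\<Sum>t\<leftarrow>L. g t)"
  using assms
proof (induction L)
  case (Cons t L)
  have "(\<Sum>k\<le>m. \<Sum>t\<leftarrow>filter (\<lambda>t. f t = k) (t # L). g t)
      = (\<Sum>k\<le>m. (if f t = k then g t else 0) + (\<Sum>t\<leftarrow>filter (\<lambda>t. f t = k) L. g t))"
    by (intro sum.cong) auto
  then show ?case
    using Cons by (simp add: sum.distrib)
qed simp

definition degree_part :: "nat set \<Rightarrow> ('a list list \<Rightarrow> 'a \<Rightarrow> 'b::zero) \<Rightarrow> 'a list list \<Rightarrow> 'a \<Rightarrow> 'b"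
  where "degree_part S F = (\<lambda>Xs. if length Xs \<in> S then F Xs else 0)"

lemma degree_part_add:
  fixes F :: "'a list list \<Rightarrow> 'a \<Rightarrow> 'b::ab_group_add"
  shows "degree_part S (F + G) = degree_part S F + degree_part S G"
  by (simp add: degree_part_def fun_eq_iff)

lemma degree_part_zero [simp]: "degree_part S 0 = 0"
  by (simp add: degree_part_def fun_eq_iff)

lemma degree_part_homog: "homog (int p) F \<Longrightarrow> degree_part S F = (if p \<in> S then F else 0)"
  by (auto simp: degree_part_def homog_def fun_eq_iff)

lemma (in cochain_space) degree_part_scale:
  "degree_part S (scale_cochain sB c F) = scale_cochain sB c (degree_part S F)"
  by (simp add: degree_part_def scale_cochain_def fun_eq_iff)

lemma (in cochain_space) degree_part_closed:
  assumes "F \<in> \<C>"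
  shows "degree_part S F \<in> \<C>"
proof -
  have ok: "first_block_ok n sA sB (degree_part S F)" if "first_block_ok n sA sB F" for F S
  proof -
    have c: "contr X (degree_part S F) = degree_part {m. Suc m \<in> S} (contr X F)" for X
      by (simp add: contr_def degree_part_def)
    show ?thesis
      using that unfolding first_block_ok_def linear_iff c
      by (simp add: degree_part_add degree_part_scale) (simp add: degree_part_def)
  qed
  have "(\<lambda>Xs. degree_part S F (Ys @ Xs)) = degree_part {m. length Ys + m \<in> S} (\<lambda>Xs. F (Ys @ Xs))" for Ys
    by (simp add: degree_part_def)
  then show ?thesis
    using assms ok by (simp add: all_cochains_def)
qed

text \<open>Contracts with several blocks at once, so that facts about the first block reach every
  later block.\<close>

lemma (in cochain_space) all_cochains_prefix: "F \<in> \<C> \<Longrightarrow> (\<lambda>Xs. F (Ys @ Xs)) \<in> \<C>"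
  unfolding all_cochains_def by (simp flip: append_assoc)

context cochain_algebra
begin

lemma slot_sgm:
  assumes "F \<in> \<C>" "i < n - 1"
  shows "F (I @ [X[i := sgm d y]] @ Zs) x = sgm d (F (I @ [X[i := y]] @ Zs) x)"
  using contr_slot_sgm[OF all_cochains_prefix[OF assms(1), of I] assms(2), of X d y]
  by (simp add: contr_def fun_eq_iff sgm_apply)

lemma slot_zero:
  assumes "F \<in> \<C>" "i < n - 1"
  shows "F (I @ [X[i := 0]] @ Zs) x = 0"
  using contr_slot_zero[OF all_cochains_prefix[OF assms(1), of I] assms(2), of X]
  by (simp add: contr_def fun_eq_iff)

text \<open>The contribution of one splitting: \<open>Q\<close> consumes \<open>J\<close>, and
  \<open>I\<close> stays with \<open>F\<close>. The exponent combines the factor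
  \<open>(-1)^(k * q)\<close> of the composition with the sign of the shuffle.\<close>

definition insertion where
  "insertion F Q X Zs x = (\<lambda>(e, I, J).
    sgm (int (length I) * int (length J) + e) (\<Sum>i<n - 1. F (I @ [X[i := Q J (X ! i)]] @ Zs) x))"

definition last_insertion where
  "last_insertion F Q x = (\<lambda>(e, I, J). sgm (int (length I) * int (length J) + e) (F I (Q J x)))"

lemma cochain_comp_splits:
  assumes "length Xs = p + q"
  shows "cochain_comp n s p q F Q Xs x =
    (\<Sum>k<p. \<Sum>t\<leftarrow>filter (\<lambda>(e, I, J). length I = k) (block_splits (take (k + q) Xs)).
      insertion F Q (Xs ! (k + q)) (drop (k + q + 1) Xs) x t) +
    (\<Sum>t\<leftarrow>filter (\<lambda>(e, I, J). length I = p) (block_splits Xs). last_insertion F Q x t)"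
proof -
  have sc: "s ((- 1) ^ (k * q) * of_int (koszul_exp e)) y = sgm (int k * int q + e) y" for k e y
    using scale_scale[of "(- 1) ^ (k * q)" "of_int (koszul_exp e)" y, symmetric]
    by (simp add: scale_minus_one_power scale_koszul_exp sgm_sgm)
  have 1: "(\<Sum>\<sigma>\<in>shuffle_perms k q. \<Sum>i<n - 1. s ((- 1) ^ (k * q) * of_int (sign \<sigma>))
        (let Ys = permute_list \<sigma> Xs; X = Xs ! (k + q) in
          F (take k Ys @ [X[i := Q (take q (drop k Ys)) (X ! i)]] @ drop (k + q + 1) Xs) x))
      = (\<Sum>t\<leftarrow>filter (\<lambda>(e, I, J). length I = k) (block_splits (take (k + q) Xs)).
          insertion F Q (Xs ! (k + q)) (drop (k + q + 1) Xs) x t)" (is "?L = ?R")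
    if "k < p" for k
  proof -
    let ?X = "Xs ! (k + q)"
    let ?g = "\<lambda>c I J. \<Sum>i<n - 1. s ((- 1) ^ (k * q) * of_int c)
        (F (I @ [?X[i := Q J (?X ! i)]] @ drop (k + q + 1) Xs) x)"
    have "?L = (\<Sum>\<sigma>\<in>shuffle_perms k q. ?g (sign \<sigma>) (take k (permute_list \<sigma> Xs)) (take q (drop k (permute_list \<sigma> Xs))))"
      by (simp only: Let_def)
    also have "\<dots> = (\<Sum>(e, I, J)\<leftarrow>filter (\<lambda>(e, I, J). length I = k) (block_splits (take (k + q) Xs)). ?g (koszul_exp e) I J)"
      using that assms by (intro sum_shuffle_perms_sign) simp
    also have "\<dots> = ?R"
    proof (intro arg_cong[where f = sum_list] map_cong refl)
      fix t assume t: "t \<in> set (filter (\<lambda>(e, I, J). length I = k) (block_splits (take (k + q) Xs)))"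
      obtain e I J where "t = (e, I, J)" by (cases t)
      moreover from this have "length I = k" "length J = q"
        using t splits_length[of e I J _ "take (k + q) Xs"] that assms by auto
      ultimately show "(case t of (e, I, J) \<Rightarrow> ?g (koszul_exp e) I J)
          = insertion F Q (Xs ! (k + q)) (drop (k + q + 1) Xs) x t"
        by (simp add: insertion_def sc sgm_sum)
    qed
    finally show ?thesis .
  qed
  have 2: "(\<Sum>\<sigma>\<in>shuffle_perms p q. s ((- 1) ^ (p * q) * of_int (sign \<sigma>))
        (let Ys = permute_list \<sigma> Xs in F (take p Ys) (Q (drop p Ys) x)))
      = (\<Sum>t\<leftarrow>filter (\<lambda>(e, I, J). length I = p) (block_splits Xs). last_insertion F Q x t)" (is "?L = ?R")
  proof -
    let ?g = "\<lambda>c I J. s ((- 1) ^ (p * q) * of_int c) (F I (Q J x))"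
    have "?L = (\<Sum>\<sigma>\<in>shuffle_perms p q. ?g (sign \<sigma>) (take p (permute_list \<sigma> Xs)) (take q (drop p (permute_list \<sigma> Xs))))"
      using assms by (simp add: Let_def)
    also have "\<dots> = (\<Sum>(e, I, J)\<leftarrow>filter (\<lambda>(e, I, J). length I = p) (block_splits (take (p + q) Xs)). ?g (koszul_exp e) I J)"
      using assms by (intro sum_shuffle_perms_sign) simp
    also have "\<dots> = ?R"
    proof (intro arg_cong[where f = sum_list] map_cong)
      fix t assume t: "t \<in> set (filter (\<lambda>(e, I, J). length I = p) (block_splits Xs))"
      obtain e I J where "t = (e, I, J)" by (cases t)
      moreover from this have "length I = p" "length J = q"
        using t splits_length[of e I J _ Xs] assms by auto
      ultimately show "(case t of (e, I, J) \<Rightarrow> ?g (koszul_exp e) I J) = last_insertion F Q x t"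
        by (simp add: last_insertion_def sc)
    qed (use assms in simp)
    finally show ?thesis .
  qed
  show ?thesis
    unfolding cochain_comp_def 2 using 1 by simp
qed

text \<open>Summation over all degrees removes the condition on the length of \<open>I\<close>: for
  each block that can receive \<open>Q\<close>, every splitting of the blocks before it occurs
  exactly once. This is what makes an induction on the blocks possible.\<close>

lemma sum_cochain_comp:
  "(\<Sum>p\<le>length Xs. cochain_comp n s p (length Xs - p) F Q Xs x) =
    (\<Sum>j<length Xs. \<Sum>t\<leftarrow>block_splits (take j Xs). insertion F Q (Xs ! j) (drop (j + 1) Xs) x t) +
    (\<Sum>t\<leftarrow>block_splits Xs. last_insertion F Q x t)"
proof -
  let ?N = "length Xs" and ?len = "\<lambda>(e :: int, I :: 'w list list, J :: 'w list list). length I"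
  let ?S = "\<lambda>j k. \<Sum>t\<leftarrow>filter (\<lambda>t. ?len t = k) (block_splits (take j Xs)). insertion F Q (Xs ! j) (drop (j + 1) Xs) x t"
  let ?R = "\<lambda>p. \<Sum>t\<leftarrow>filter (\<lambda>t. ?len t = p) (block_splits Xs). last_insertion F Q x t"
  have fl: "filter (\<lambda>(e, I, J). length I = k) L = filter (\<lambda>t. ?len t = k) L" for k L
    by (simp add: case_prod_unfold)
  have len: "?len t \<le> length Ys" if "t \<in> set (block_splits Ys)" for t and Ys :: "'w list list"
    using that splits_length[of "fst t" "fst (snd t)" "snd (snd t)" "\<lambda>_. 1" Ys]
    by (simp add: case_prod_unfold)
  have "(\<Sum>p\<le>?N. cochain_comp n s p (?N - p) F Q Xs x) = (\<Sum>p\<le>?N. (\<Sum>k<p. ?S (k + (?N - p)) k) + ?R p)"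
  proof (intro sum.cong refl)
    fix p assume "p \<in> {..?N}"
    then show "cochain_comp n s p (?N - p) F Q Xs x = (\<Sum>k<p. ?S (k + (?N - p)) k) + ?R p"
      using cochain_comp_splits[of Xs p "?N - p" F Q x] unfolding fl by simp
  qed
  also have "\<dots> = (\<Sum>p\<le>?N. \<Sum>k<p. ?S (k + (?N - p)) k) + (\<Sum>p\<le>?N. ?R p)"
    by (rule sum.distrib)
  also have "(\<Sum>p\<le>?N. ?R p) = (\<Sum>t\<leftarrow>block_splits Xs. last_insertion F Q x t)"
    by (rule sum_list_partition) (rule len)
  \<comment> \<open>Reindexed by the position \<open>j = k + q\<close> of the block that receives
    \<open>Q\<close>.\<close>
  also have "(\<Sum>p\<le>?N. \<Sum>k<p. ?S (k + (?N - p)) k) = (\<Sum>j<?N. \<Sum>k\<le>j. ?S j k)"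
    unfolding sum.Sigma[OF finite_atMost ballI[OF finite_lessThan]] sum.Sigma[OF finite_lessThan ballI[OF finite_atMost]]
    by (rule sum.reindex_bij_witness[where i = "\<lambda>(j, k). (k + (?N - j), k)" and j = "\<lambda>(p, k). (k + (?N - p), k)"]) auto
  also have "\<dots> = (\<Sum>j<?N. \<Sum>t\<leftarrow>block_splits (take j Xs). insertion F Q (Xs ! j) (drop (j + 1) Xs) x t)"
  proof (intro sum.cong refl sum_list_partition)
    fix j t assume "j \<in> {..<?N}" "t \<in> set (block_splits (take j Xs))"
    then show "?len t \<le> j" using len[of t "take j Xs"] by simp
  qed
  finally show ?thesis .
qed

text \<open>The first block joins \<open>J\<close>, or joins \<open>I\<close>, or receives
  \<open>Q\<close> itself, in which case nothing precedes it and \<open>Q\<close> has only its own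
  slot as argument. These are the three terms of \<open>star_Cons\<close>.\<close>

theorem sum_cochain_comp_eq_star:
  assumes "F \<in> \<C>"
  shows "(\<Sum>p\<le>length Xs. cochain_comp n s p (length Xs - p) F Q Xs x) = (F \<star> Q) Xs x"
  unfolding sum_cochain_comp using assms
proof (induction Xs arbitrary: F Q)
  case Nil
  then show ?case by (simp add: last_insertion_def)
next
  case (Cons X Xs)
  let ?A = "\<lambda>F Q j. \<Sum>t\<leftarrow>block_splits (take j Xs). insertion F Q (Xs ! j) (drop (j + 1) Xs) x t"
  let ?B = "\<lambda>F Q. \<Sum>t\<leftarrow>block_splits Xs. last_insertion F Q x t"
  \<comment> \<open>One more block in \<open>I\<close> changes the sign by the length of
    \<open>J\<close>, which is the sign that \<open>altsign\<close> puts on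
    \<open>Q\<close>.\<close>
  have i1: "insertion F Q Y Zs x (e, X # I, J) = insertion (contr X F) (altsign Q) Y Zs x (e, I, J)" for Y Zs e I J
  proof -
    have "contr X F (I @ [Y[i := altsign Q J (Y ! i)]] @ Zs) x
        = sgm (int (length J)) (F ((X # I) @ [Y[i := Q J (Y ! i)]] @ Zs) x)" if "i < n - 1" for i
      using slot_sgm[OF Cons.prems that, of "X # I" Y "int (length J)"] by (simp add: contr_def altsign_def)
    then have "(\<Sum>i<n - 1. contr X F (I @ [Y[i := altsign Q J (Y ! i)]] @ Zs) x)
        = sgm (int (length J)) (\<Sum>i<n - 1. F ((X # I) @ [Y[i := Q J (Y ! i)]] @ Zs) x)"
      by (simp add: sgm_sum)
    then show ?thesis
      by (simp add: insertion_def sgm_sgm algebra_simps)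
  qed
  \<comment> \<open>The exponent contributed by \<open>splits\<close> cancels the change of sign
    caused by the longer \<open>J\<close>.\<close>
  have i2: "insertion F Q Y Zs x (e + int (length I), I, X # J) = insertion F (contr X Q) Y Zs x (e, I, J)" for Y Zs e I J
    by (simp add: insertion_def contr_def) (rule sgm_cong, auto)
  have l1: "last_insertion F Q x (e, X # I, J) = last_insertion (contr X F) (altsign Q) x (e, I, J)" for e I J
  proof -
    have "contr X F I (altsign Q J x) = sgm (int (length J)) (F (X # I) (Q J x))"
      using Cons.prems by (simp add: contr_def altsign_def sgm_def cochain_arg_uminus)
    then show ?thesis
      by (simp add: last_insertion_def sgm_sgm algebra_simps)
  qed
  have l2: "last_insertion F Q x (e + int (length I), I, X # J) = last_insertion F (contr X Q) x (e, I, J)" for e I J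
    by (simp add: last_insertion_def contr_def) (rule sgm_cong, auto)
  have sl: "sum_list (map (\<lambda>_. 1) I) = int (length I)" for I :: "'w list list"
    by (induction I) auto
  have A: "(\<Sum>t\<leftarrow>block_splits (X # take j Xs). insertion F Q (Xs ! j) (drop (j + 1) Xs) x t)
      = ?A (contr X F) (altsign Q) j + ?A F (contr X Q) j" for j
    by (simp add: o_def case_prod_unfold sl i1 i2)
  have B: "(\<Sum>t\<leftarrow>block_splits (X # Xs). last_insertion F Q x t)
      = ?B (contr X F) (altsign Q) + ?B F (contr X Q)"
    by (simp add: o_def case_prod_unfold sl l1 l2)
  have "insertion F Q X Xs x (0, [], []) = insert_block n X (Q []) F Xs x"
    by (simp add: insertion_def insert_block_def sum_apply2 contr_def)
  then have h1: "(\<Sum>j<length (X # Xs). \<Sum>t\<leftarrow>block_splits (take j (X # Xs)). insertion F Q ((X # Xs) ! j) (drop (j + 1) (X # Xs)) x t)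
      = insert_block n X (Q []) F Xs x + (\<Sum>j<length Xs. ?A (contr X F) (altsign Q) j + ?A F (contr X Q) j)"
    by (simp only: length_Cons sum.lessThan_Suc_shift) (simp add: A[simplified])
  have h2: "sum (?A F (contr X Q)) {..<length Xs} + ?B F (contr X Q) = (F \<star> contr X Q) Xs x"
    by (rule Cons.IH[OF Cons.prems])
  have h3: "sum (?A (contr X F) (altsign Q)) {..<length Xs} + ?B (contr X F) (altsign Q) = (contr X F \<star> altsign Q) Xs x"
    by (rule Cons.IH[OF all_cochains_contr[OF Cons.prems]])
  show ?case
    unfolding h1 B star_Cons h2[symmetric] h3[symmetric] sum.distrib by (simp only: algebra_simps)
qed

text \<open>At degrees \<open>p\<close> and \<open>q\<close> the composition evaluates
  \<open>F\<close> and \<open>Q\<close> only on lists of these lengths, so an inhomogeneous cochain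
  may be replaced by any other with the same component.\<close>

lemma cochain_comp_cong:
  assumes "length Xs = p + q"
    and F: "\<And>Ys. length Ys = p \<Longrightarrow> F Ys = F' Ys" and Q: "\<And>Ys. length Ys = q \<Longrightarrow> Q Ys = Q' Ys"
  shows "cochain_comp n s p q F Q Xs x = cochain_comp n s p q F' Q' Xs x"
proof -
  have "F (take k (permute_list \<sigma> Xs) @ [X[i := Q (take q (drop k (permute_list \<sigma> Xs))) y]] @ drop (k + q + 1) Xs)
      = F' (take k (permute_list \<sigma> Xs) @ [X[i := Q' (take q (drop k (permute_list \<sigma> Xs))) y]] @ drop (k + q + 1) Xs)"
    if "k < p" for k \<sigma> X i y
    using that assms(1) by (subst F, simp, subst Q, simp_all)
  moreover have "F (take p (permute_list \<sigma> Xs)) (Q (drop p (permute_list \<sigma> Xs)) x)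
      = F' (take p (permute_list \<sigma> Xs)) (Q' (drop p (permute_list \<sigma> Xs)) x)" for \<sigma>
    using assms(1) by (subst F, simp, subst Q, simp_all)
  ultimately show ?thesis
    unfolding cochain_comp_def Let_def by (intro arg_cong2[where f = "(+)"] sum.cong refl) auto
qed

lemma cochain_comp_zero:
  assumes "F \<in> \<C>"
  shows "cochain_comp n s p q F 0 Xs x = 0"
  using slot_zero[OF assms] cochain_arg_zero[OF assms]
  by (simp add: cochain_comp_def Let_def)

lemma cochain_comp_sgm: "cochain_comp n s p q (sgm d F) Q Xs x = sgm d (cochain_comp n s p q F Q Xs x)"
  by (simp add: cochain_comp_def Let_def sgm_add sgm_sum)
    (simp add: sgm_def)

section \<open>Bilinearity, skew symmetry and Jacobi identity of the bracket\<close>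

abbreviation bracket where "bracket P Q \<equiv> nlie_bracket n s P Q"

text \<open>The sign \<open>(-1)^(p * q)\<close> is trivial on the even part of \<open>P\<close> and
  is the degree sign of \<open>Q\<close> on the odd part. So the bracket is expressed by circle
  products for inhomogeneous cochains too, and closure and bilinearity follow without decomposing
  into degrees.\<close>

theorem nlie_bracket_eq:
  assumes P: "P \<in> \<C>" and Q: "Q \<in> \<C>"
  shows "bracket P Q = P \<star> Q
    - (Q \<star> degree_part {m. even m} P + altsign Q \<star> degree_part {m. odd m} P)"
proof (intro ext)
  fix Xs :: "'w list list" and x
  let ?N = "length Xs"
  let ?E = "degree_part {m. even m} P" and ?O = "degree_part {m. odd m} P"
  have *: "s ((- 1) ^ (p * (?N - p))) (cochain_comp n s (?N - p) p Q P Xs x)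
      = cochain_comp n s (?N - p) p Q ?E Xs x + cochain_comp n s (?N - p) p (altsign Q) ?O Xs x"
    if p: "p \<le> ?N" for p
  proof (cases "even p")
    case True
    have "cochain_comp n s (?N - p) p Q P Xs x = cochain_comp n s (?N - p) p Q ?E Xs x"
      by (rule cochain_comp_cong) (use p True in \<open>auto simp: degree_part_def\<close>)
    moreover have "cochain_comp n s (?N - p) p (altsign Q) ?O Xs x = cochain_comp n s (?N - p) p (altsign Q) 0 Xs x"
      by (rule cochain_comp_cong) (use p True in \<open>auto simp: degree_part_def\<close>)
    ultimately show ?thesis
      using True cochain_comp_zero[OF all_cochains_altsign[OF Q]] by simp
  next
    case False
    have "cochain_comp n s (?N - p) p (altsign Q) ?O Xs x = cochain_comp n s (?N - p) p (sgm (int (?N - p)) Q) P Xs x"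
      by (rule cochain_comp_cong) (use p False in \<open>auto simp: degree_part_def altsign_def sgm_def\<close>)
    moreover have "cochain_comp n s (?N - p) p Q ?E Xs x = cochain_comp n s (?N - p) p Q 0 Xs x"
      by (rule cochain_comp_cong) (use p False in \<open>auto simp: degree_part_def\<close>)
    ultimately show ?thesis
      using False cochain_comp_zero[OF Q] unfolding cochain_comp_sgm scale_minus_one_power
      by (simp add: sgm_cong[of "int p * int (?N - p)" "int (?N - p)"])
  qed
  have flip: "(\<Sum>p\<le>?N. f (?N - p) p) = (\<Sum>p\<le>?N. f p (?N - p))" for f :: "nat \<Rightarrow> nat \<Rightarrow> 'w"
    by (rule sum.reindex_bij_witness[where i = "\<lambda>p. ?N - p" and j = "\<lambda>p. ?N - p"]) auto
  have "bracket P Q Xs x = (\<Sum>p\<le>?N. cochain_comp n s p (?N - p) P Q Xs x)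
      - (\<Sum>p\<le>?N. s ((- 1) ^ (p * (?N - p))) (cochain_comp n s (?N - p) p Q P Xs x))"
    by (simp add: nlie_bracket_def Let_def sum_subtractf)
  also have "(\<Sum>p\<le>?N. s ((- 1) ^ (p * (?N - p))) (cochain_comp n s (?N - p) p Q P Xs x))
      = (\<Sum>p\<le>?N. cochain_comp n s (?N - p) p Q ?E Xs x) + (\<Sum>p\<le>?N. cochain_comp n s (?N - p) p (altsign Q) ?O Xs x)"
    using * by (simp add: sum.distrib)
  also have "\<dots> = (Q \<star> ?E) Xs x + (altsign Q \<star> ?O) Xs x"
    using flip[of "\<lambda>p q. cochain_comp n s p q Q ?E Xs x"] flip[of "\<lambda>p q. cochain_comp n s p q (altsign Q) ?O Xs x"]
    by (simp add: sum_cochain_comp_eq_star P Q all_cochains_altsign)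
  finally show "bracket P Q Xs x = (P \<star> Q - (Q \<star> ?E + altsign Q \<star> ?O)) Xs x"
    by (simp add: sum_cochain_comp_eq_star P)
qed

lemma bracket_closed:
  assumes "P \<in> \<C>" "Q \<in> \<C>"
  shows "bracket P Q \<in> \<C>"
  unfolding nlie_bracket_eq[OF assms] using assms
  by (intro all_cochains_diff all_cochains_add star_closed all_cochains_altsign degree_part_closed)

lemma bracket_add_left:
  assumes "P \<in> \<C>" "P' \<in> \<C>" "Q \<in> \<C>"
  shows "bracket (P + P') Q = bracket P Q + bracket P' Q"
  using assms
  by (simp add: nlie_bracket_eq all_cochains_add degree_part_add star_add_left star_add_right
      all_cochains_altsign algebra_simps)

lemma bracket_add_right:
  assumes "P \<in> \<C>" "Q \<in> \<C>" "Q' \<in> \<C>"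
  shows "bracket P (Q + Q') = bracket P Q + bracket P Q'"
  using assms
  by (simp add: nlie_bracket_eq all_cochains_add altsign_add star_add_left star_add_right algebra_simps)

lemma scale_cochain_diff: "scale_cochain s c (F - G) = scale_cochain s c F - scale_cochain s c G"
  by (simp add: scale_cochain_def fun_eq_iff scale_right_diff_distrib)

lemma bracket_scale_left:
  assumes "P \<in> \<C>" "Q \<in> \<C>"
  shows "bracket (scale_cochain s c P) Q = scale_cochain s c (bracket P Q)"
  using assms
  by (simp add: nlie_bracket_eq all_cochains_scale degree_part_scale star_scale_left vector_space_axioms
      star_scale_right all_cochains_altsign scale_cochain_add scale_cochain_diff)

lemma bracket_scale_right:
  assumes "P \<in> \<C>" "Q \<in> \<C>"
  shows "bracket P (scale_cochain s c Q) = scale_cochain s c (bracket P Q)"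
  using assms
  by (simp add: nlie_bracket_eq all_cochains_scale altsign_scale star_scale_left vector_space_axioms
      star_scale_right scale_cochain_add scale_cochain_diff)

lemma bracket_homog_eq:
  assumes "P \<in> \<C>" "homog p P" "Q \<in> \<C>" "homog q Q"
  shows "bracket P Q = P \<star> Q - sgm (p * q) (Q \<star> P)"
proof (cases "p < 0")
  case True
  then have "P = 0"
    using assms(2) by (auto simp: homog_def fun_eq_iff)
  then show ?thesis
    using assms by (simp add: nlie_bracket_eq all_cochains_altsign)
next
  case False
  then obtain m where m: "p = int m"
    by (metis nonneg_int_cases not_less)
  show ?thesis
    unfolding nlie_bracket_eq[OF assms(1,3)] homog_altsign[OF assms(4)]
    using degree_part_homog[of m P] assms
    by (simp add: m star_sgm_left all_cochains_sgm) (auto simp: sgm_def)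
qed

lemma bracket_homog:
  assumes "P \<in> \<C>" "homog p P" "Q \<in> \<C>" "homog q Q"
  shows "homog (p + q) (bracket P Q)"
  using homog_star[OF assms(1,2,4)] homog_star[OF assms(3,4,2)]
  unfolding bracket_homog_eq[OF assms]
  by (simp add: homog_def sgm_apply add.commute)

lemma bracket_skew:
  assumes "P \<in> \<C>" "homog p P" "Q \<in> \<C>" "homog q Q"
  shows "bracket P Q = - sgm (p * q) (bracket Q P)"
  using assms by (simp add: bracket_homog_eq sgm_diff sgm_sgm mult.commute) (simp add: sgm_def)

text \<open>Here \<open>fpq\<close> stands for \<open>(F \<star> P) \<star> Q\<close> and
  \<open>f_pq\<close> for \<open>F \<star> (P \<star> Q)\<close>. The hypotheses are the pre-Lie
  identity for the three choices of the left factor; the conclusion is the Jacobi identity written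
  out in circle products.\<close>

lemma jacobi_signs:
  fixes a :: "'e::ab_group_add"
  assumes "fpq = f_pq + sgm (p * q) (fqp - f_qp)"
    and "pfq = p_fq + sgm (f * q) (pqf - p_qf)"
    and "qfp = q_fp + sgm (f * p) (qpf - q_pf)"
  shows "fpq - sgm (f * p) pfq - sgm ((f + p) * q) (q_fp - sgm (f * p) q_pf)
    = f_pq - sgm (p * q) f_qp - sgm (f * (p + q)) (pqf - sgm (p * q) qpf)
      + sgm (p * q) (fqp - sgm (f * q) qfp - sgm ((f + q) * p) (p_fq - sgm (f * q) p_qf))"
  unfolding assms
  by (cases "even f"; cases "even p"; cases "even q") (simp_all add: sgm_def algebra_simps)

text \<open>The form chosen says that the bracket with \<open>Q\<close> on the right is a graded
  derivation, which is how elements are moved through iterated brackets below.\<close>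

theorem bracket_jacobi:
  assumes F: "F \<in> \<C>" "homog f F" and P: "P \<in> \<C>" "homog p P" and Q: "Q \<in> \<C>" "homog q Q"
  shows "bracket (bracket F P) Q = bracket F (bracket P Q) + sgm (p * q) (bracket (bracket F Q) P)"
proof -
  note cl = F(1) P(1) Q(1) star_closed all_cochains_diff all_cochains_sgm
  have FP: "bracket (bracket F P) Q = bracket F P \<star> Q - sgm ((f + p) * q) (Q \<star> bracket F P)"
    by (intro bracket_homog_eq bracket_closed bracket_homog F P Q)
  have FQ: "bracket (bracket F Q) P = bracket F Q \<star> P - sgm ((f + q) * p) (P \<star> bracket F Q)"
    by (intro bracket_homog_eq bracket_closed bracket_homog F P Q)
  have PQ: "bracket F (bracket P Q) = F \<star> bracket P Q - sgm (f * (p + q)) (bracket P Q \<star> F)"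
    by (intro bracket_homog_eq bracket_closed bracket_homog F P Q)
  have a: "(F \<star> P) \<star> Q = F \<star> (P \<star> Q) + sgm (p * q) ((F \<star> Q) \<star> P - F \<star> (Q \<star> P))"
    "(P \<star> F) \<star> Q = P \<star> (F \<star> Q) + sgm (f * q) ((P \<star> Q) \<star> F - P \<star> (Q \<star> F))"
    "(Q \<star> F) \<star> P = Q \<star> (F \<star> P) + sgm (f * p) ((Q \<star> P) \<star> F - Q \<star> (P \<star> F))"
    using associator_commute[OF F(1) P Q] associator_commute[OF P(1) F Q] associator_commute[OF Q(1) F P]
    unfolding associator_def by (simp_all add: algebra_simps)
  show ?thesis
    unfolding FP FQ PQ
    unfolding bracket_homog_eq[OF F P] bracket_homog_eq[OF F Q] bracket_homog_eq[OF P Q]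
    using jacobi_signs[OF a]
    by (simp add: star_diff_left star_diff_right star_sgm_left star_sgm_right cl)
qed

end

section \<open>Iterated brackets\<close>

lemma sgm_odd: "odd (d - e) \<Longrightarrow> sgm d x = - sgm e x"
  by (auto simp: sgm_def)

text \<open>Exchanging the two parts of a splitting costs the Koszul sign for moving all of
  \<open>I\<close> past all of \<open>J\<close>. Only the parity of the exponent is preserved, hence
  the assumption on \<open>g\<close>.\<close>

lemma splits_swap:
  fixes g :: "int \<Rightarrow> 'a list \<Rightarrow> 'a list \<Rightarrow> 'm::comm_monoid_add"
  assumes "\<And>e e' I J. even (e - e') \<Longrightarrow> g e I J = g e' I J"
  shows "(\<Sum>(e, I, J)\<leftarrow>splits d xs. g e I J)
    = (\<Sum>(e, I, J)\<leftarrow>splits d xs. g (e + sum_list (map d I) * sum_list (map d J)) J I)"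
  using assms
proof (induction xs arbitrary: g)
  case (Cons x xs)
  let ?t = "\<lambda>I. sum_list (map d I)"
  have 1: "(\<Sum>(e, I, J)\<leftarrow>splits d xs. g e (x # I) J) = (\<Sum>(e, I, J)\<leftarrow>splits d xs. g (e + ?t I * ?t J) (x # J) I)"
    by (rule Cons.IH[of "\<lambda>e I J. g e (x # I) J"]) (rule Cons.prems)
  have 2: "(\<Sum>(e, I, J)\<leftarrow>splits d xs. g (e + d x * ?t I) I (x # J))
      = (\<Sum>(e, I, J)\<leftarrow>splits d xs. g (e + ?t I * ?t J + d x * ?t J) J (x # I))"
    by (rule Cons.IH[of "\<lambda>e I J. g (e + d x * ?t I) I (x # J)"]) (rule Cons.prems, simp)
  have 3: "g (e + d x * ?t I + ?t I * ?t (x # J)) (x # J) I = g (e + ?t I * ?t J) (x # J) I" for e I J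
    by (rule Cons.prems) (simp add: algebra_simps)
  have 4: "g (e + ?t (x # I) * ?t J) J (x # I) = g (e + ?t I * ?t J + d x * ?t J) J (x # I)" for e I J
    by (rule Cons.prems) (simp add: algebra_simps)
  show ?case
    using 1 2 3 4 by (simp add: o_def case_prod_unfold add.commute)
qed simp

lemma sum_list_filter_if:
  "(\<Sum>t\<leftarrow>filter P L. g t) = (\<Sum>t\<leftarrow>L. if P t then g t else (0 :: 'm::comm_monoid_add))"
  by (induction L) auto

lemma permute_list_transpose_adj:
  assumes "Suc i < length ys"
  shows "permute_list (Transposition.transpose i (Suc i)) ys
    = take i ys @ [ys ! Suc i, ys ! i] @ drop (Suc (Suc i)) ys"
proof (rule nth_equalityI)
  fix k assume k: "k < length (permute_list (Transposition.transpose i (Suc i)) ys)"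
  have "Transposition.transpose i (Suc i) permutes {..<length ys}"
    using assms by (intro permutes_swap_id) auto
  then have *: "permute_list (Transposition.transpose i (Suc i)) ys ! k = ys ! Transposition.transpose i (Suc i) k"
    by (rule permute_list_nth) (use k in simp)
  consider "k < i" | "k = i" | "k = Suc i" | m where "k = Suc (Suc (i + m))"
    by (metis Suc_lessI less_imp_Suc_add linorder_neqE_nat add_Suc)
  then show "permute_list (Transposition.transpose i (Suc i)) ys ! k
      = (take i ys @ [ys ! Suc i, ys ! i] @ drop (Suc (Suc i)) ys) ! k"
    unfolding * using assms k by cases (simp_all add: nth_append transpose_def)
qed (use assms in simp)

context cochain_algebra
begin

lemma foldl_bracket_closed: "a \<in> \<C> \<Longrightarrow> set Ps \<subseteq> \<C> \<Longrightarrow> foldl bracket a Ps \<in> \<C>"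
proof (induction Ps arbitrary: a)
  case (Cons P Ps)
  have "foldl bracket (bracket a P) Ps \<in> \<C>"
    by (rule Cons.IH) (use Cons.prems bracket_closed in auto)
  then show ?case by simp
qed simp

lemma foldl_bracket_combination:
  assumes "a \<in> \<C>" "b \<in> \<C>" "set Ps \<subseteq> \<C>"
  shows "foldl bracket (scale_cochain s c a + b) Ps
    = scale_cochain s c (foldl bracket a Ps) + foldl bracket b Ps"
  using assms
proof (induction Ps arbitrary: a b)
  case (Cons P Ps)
  have "bracket (scale_cochain s c a + b) P = scale_cochain s c (bracket a P) + bracket b P"
    using Cons.prems by (simp add: bracket_add_left bracket_scale_left all_cochains_scale)
  moreover have "foldl bracket (scale_cochain s c (bracket a P) + bracket b P) Ps
      = scale_cochain s c (foldl bracket (bracket a P) Ps) + foldl bracket (bracket b P) Ps"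
    by (rule Cons.IH) (use Cons.prems bracket_closed in auto)
  ultimately show "foldl bracket (scale_cochain s c a + b) (P # Ps)
      = scale_cochain s c (foldl bracket a (P # Ps)) + foldl bracket b (P # Ps)"
    unfolding foldl_Cons by simp
qed simp

lemma foldl_bracket_slot:
  assumes "a \<in> \<C>" "set Ps \<subseteq> \<C>" "P \<in> \<C>" "Q \<in> \<C>" "i < length Ps"
  shows "foldl bracket a (Ps[i := scale_cochain s c P + Q])
    = scale_cochain s c (foldl bracket a (Ps[i := P])) + foldl bracket a (Ps[i := Q])"
proof -
  let ?b = "foldl bracket a (take i Ps)" and ?vs = "drop (Suc i) Ps"
  have b: "?b \<in> \<C>"
    using assms set_take_subset[of i Ps] by (intro foldl_bracket_closed) auto
  have vs: "set ?vs \<subseteq> \<C>"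
    using assms set_drop_subset[of "Suc i" Ps] by auto
  have upd: "foldl bracket a (Ps[i := R]) = foldl bracket (bracket ?b R) ?vs" for R
    using assms(5) by (simp add: upd_conv_take_nth_drop)
  have "bracket ?b (scale_cochain s c P + Q) = scale_cochain s c (bracket ?b P) + bracket ?b Q"
    using b assms by (simp add: bracket_add_right bracket_scale_right all_cochains_scale)
  then show ?thesis
    unfolding upd by (simp only: foldl_bracket_combination bracket_closed b assms vs)
qed

text \<open>Entries are pairs of a cochain and a degree: the degree cannot be recovered from the
  cochain, because 0 is homogeneous of every degree.\<close>

abbreviation homogs where "homogs zs \<equiv> \<forall>z\<in>set zs. fst z \<in> \<C> \<and> homog (snd z) (fst z)"

definition iter_bracket where "iter_bracket a zs = foldl bracket a (map fst zs)"

abbreviation deg :: "('b \<times> int) list \<Rightarrow> int" where "deg zs \<equiv> sum_list (map snd zs)"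

lemma iter_bracket_Nil [simp]: "iter_bracket a [] = a"
  and iter_bracket_Cons: "iter_bracket a (z # zs) = iter_bracket (bracket a (fst z)) zs"
  and iter_bracket_append: "iter_bracket a (ys @ zs) = iter_bracket (iter_bracket a ys) zs"
  by (simp_all add: iter_bracket_def)

lemma iter_bracket_closed: "a \<in> \<C> \<Longrightarrow> homogs zs \<Longrightarrow> iter_bracket a zs \<in> \<C>"
  unfolding iter_bracket_def by (rule foldl_bracket_closed) auto

lemma iter_bracket_homog:
  assumes "a \<in> \<C>" "homog d a" "homogs zs"
  shows "homog (d + deg zs) (iter_bracket a zs)"
  using assms
proof (induction zs arbitrary: a d)
  case (Cons z zs)
  have "homog (d + snd z + deg zs) (iter_bracket (bracket a (fst z)) zs)"
    by (rule Cons.IH) (use Cons.prems bracket_closed bracket_homog in auto)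
  then show ?case by (simp add: iter_bracket_Cons algebra_simps)
qed simp

lemma bracket_zero_left: "Q \<in> \<C> \<Longrightarrow> bracket 0 Q = 0"
  using bracket_add_left[of 0 0 Q] by simp

lemma bracket_zero_right: "P \<in> \<C> \<Longrightarrow> bracket P 0 = 0"
  using bracket_add_right[of P 0 0] by simp

lemma iter_bracket_add:
  assumes "a \<in> \<C>" "b \<in> \<C>" "homogs zs"
  shows "iter_bracket (a + b) zs = iter_bracket a zs + iter_bracket b zs"
proof -
  have "set (map fst zs) \<subseteq> \<C>"
    using assms(3) by auto
  from foldl_bracket_combination[OF assms(1,2) this, of 1] show ?thesis
    by (simp add: iter_bracket_def scale_cochain_def)
qed

lemma iter_bracket_zero: "homogs zs \<Longrightarrow> iter_bracket 0 zs = 0"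
  using iter_bracket_add[of 0 0 zs] by simp

lemma iter_bracket_sgm:
  assumes "a \<in> \<C>" "homogs zs"
  shows "iter_bracket (sgm d a) zs = sgm d (iter_bracket a zs)"
  using iter_bracket_add[of a "- a" zs] assms iter_bracket_zero[of zs]
  by (simp add: sgm_def all_cochains_uminus eq_neg_iff_add_eq_0 add.commute)

text \<open>Iterated Leibniz rule. Each entry of \<open>zs\<close> acts either on \<open>b\<close>,
  or on \<open>a\<close> after passing \<open>b\<close>; the latter accounts for
  \<open>db * deg I\<close>, and the order among the entries for \<open>e\<close>.\<close>

lemma iter_bracket_of_bracket:
  assumes "a \<in> \<C>" "homog da a" "b \<in> \<C>" "homog db b" "homogs zs"
  shows "iter_bracket (bracket a b) zs
    = (\<Sum>(e, I, J)\<leftarrow>splits snd zs. sgm (db * deg I + e) (bracket (iter_bracket a I) (iter_bracket b J)))"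
  using assms
proof (induction zs arbitrary: a b da db)
  case (Cons z zs)
  obtain x d where z: "z = (x, d)" by (cases z)
  have a: "a \<in> \<C>" "homog da a" and b: "b \<in> \<C>" "homog db b" and x: "x \<in> \<C>" "homog d x" and zs: "homogs zs"
    using Cons.prems z by auto
  have 1: "iter_bracket (bracket a (bracket b x)) zs = (\<Sum>(e, I, J)\<leftarrow>splits snd zs.
      sgm ((db + d) * deg I + e) (bracket (iter_bracket a I) (iter_bracket (bracket b x) J)))"
    by (rule Cons.IH[OF a bracket_closed[OF b(1) x(1)] bracket_homog[OF b x] zs])
  have 2: "iter_bracket (bracket (bracket a x) b) zs = (\<Sum>(e, I, J)\<leftarrow>splits snd zs.
      sgm (db * deg I + e) (bracket (iter_bracket (bracket a x) I) (iter_bracket b J)))"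
    by (rule Cons.IH[OF bracket_closed[OF a(1) x(1)] bracket_homog[OF a x] b zs])
  have "iter_bracket (bracket a b) (z # zs)
      = iter_bracket (bracket a (bracket b x) + sgm (db * d) (bracket (bracket a x) b)) zs"
    by (simp add: iter_bracket_Cons z bracket_jacobi[OF a b x])
  also have "\<dots> = iter_bracket (bracket a (bracket b x)) zs
      + sgm (db * d) (iter_bracket (bracket (bracket a x) b) zs)"
    by (simp add: iter_bracket_add iter_bracket_sgm all_cochains_sgm bracket_closed a b x zs)
  finally show "iter_bracket (bracket a b) (z # zs) = (\<Sum>(e, I, J)\<leftarrow>splits snd (z # zs).
      sgm (db * deg I + e) (bracket (iter_bracket a I) (iter_bracket b J)))"
    unfolding 1 2
    by (simp add: z o_def case_prod_unfold iter_bracket_Cons sgm_sum_list sgm_sgm algebra_simps)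
qed simp

lemma bracket_commute:
  assumes "a \<in> \<C>" "homog d a" "x \<in> \<C>" "homog dx x" "y \<in> \<C>" "homog dy y" "bracket x y = 0"
  shows "bracket (bracket a x) y = sgm (dx * dy) (bracket (bracket a y) x)"
  using bracket_jacobi[OF assms(1-6)] assms by (simp add: bracket_zero_right)

text \<open>If two elements have bracket 0, the Jacobi identity lets them change places in an
  iterated bracket at the cost of their Koszul sign; \<open>q\<close> passes all of
  \<open>zs\<close> in this way.\<close>

lemma iter_bracket_move:
  assumes "a \<in> \<C>" "homog d a" "homogs (q # zs)" "\<forall>z\<in>set zs. bracket (fst z) (fst q) = 0"
  shows "iter_bracket a (zs @ [q]) = sgm (snd q * deg zs) (iter_bracket a (q # zs))"
  using assms
proof (induction zs arbitrary: a d)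
  case (Cons z zs)
  have zs: "homogs zs" and az: "bracket a (fst z) \<in> \<C>" and aq: "bracket a (fst q) \<in> \<C>"
    using Cons.prems bracket_closed by auto
  have "iter_bracket (bracket a (fst z)) (zs @ [q])
      = sgm (snd q * deg zs) (iter_bracket (bracket a (fst z)) (q # zs))"
  proof (rule Cons.IH[OF az])
    show "homog (d + snd z) (bracket a (fst z))"
      using Cons.prems by (intro bracket_homog) auto
    show "homogs (q # zs)" using Cons.prems by simp
    show "\<forall>z\<in>set zs. bracket (fst z) (fst q) = 0"
      using Cons.prems(4) by (simp add: fun_eq_iff)
  qed
  also have "iter_bracket (bracket a (fst z)) (q # zs) = iter_bracket (bracket (bracket a (fst z)) (fst q)) zs"
    by (rule iter_bracket_Cons)
  also have "bracket (bracket a (fst z)) (fst q) = sgm (snd z * snd q) (bracket (bracket a (fst q)) (fst z))"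
  proof (rule bracket_commute)
    show "bracket (fst z) (fst q) = 0" using Cons.prems(4) by (simp add: fun_eq_iff)
  qed (use Cons.prems in auto)
  also have "iter_bracket \<dots> zs = sgm (snd z * snd q) (iter_bracket (bracket (bracket a (fst q)) (fst z)) zs)"
    by (rule iter_bracket_sgm[OF bracket_closed[OF aq] zs]) (use Cons.prems in auto)
  finally show "iter_bracket a ((z # zs) @ [q]) = sgm (snd q * deg (z # zs)) (iter_bracket a (q # z # zs))"
    by (simp add: iter_bracket_Cons sgm_sgm algebra_simps)
qed simp

text \<open>This is the source of the graded symmetry of the derived bracket: for entries of an
  abelian family neighbours change places by \<open>bracket_commute\<close>, and swaps of neighbours
  generate all permutations.\<close>

lemma iter_bracket_permute:
  assumes a: "a \<in> \<C>" "homog d a" and zs: "homogs zs"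
    and com: "\<forall>y\<in>set zs. \<forall>z\<in>set zs. bracket (fst y) (fst z) = 0"
    and \<sigma>: "\<sigma> permutes {..<length zs}"
  shows "iter_bracket a zs
    = scale_cochain s (of_int (koszul_sign \<sigma> (map snd zs))) (iter_bracket a (permute_list \<sigma> zs))"
  using \<sigma>
proof (induction rule: permutes_adjacent_induct)
  case id
  then show ?case by (simp add: scale_cochain_def)
next
  case (adj \<sigma> i)
  let ?ys = "permute_list \<sigma> zs" and ?t = "Transposition.transpose i (Suc i)"
  let ?y = "?ys ! i" and ?y' = "?ys ! Suc i" and ?us = "take i ?ys" and ?vs = "drop (Suc (Suc i)) ?ys"
  have i: "Suc i < length ?ys" using adj by simp
  have ys: "?ys = ?us @ [?y, ?y'] @ ?vs"
    using i by (simp add: Cons_nth_drop_Suc)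
  have set: "set ?ys = set zs"
    using set_permute_list[OF adj(1)] .
  then have hs: "homogs ?ys" using zs by simp
  have hus: "homogs ?us" and hvs: "homogs ?vs"
    using hs by (auto dest: in_set_takeD in_set_dropD)
  have mem: "?y \<in> set zs" "?y' \<in> set zs"
    using i set nth_mem[of i ?ys] nth_mem[of "Suc i" ?ys] by auto
  let ?b = "iter_bracket a ?us"
  have b: "?b \<in> \<C>" "homog (d + deg ?us) ?b"
    using iter_bracket_closed[OF a(1) hus] iter_bracket_homog[OF a hus] .
  have "bracket (bracket ?b (fst ?y)) (fst ?y') = sgm (snd ?y * snd ?y') (bracket (bracket ?b (fst ?y')) (fst ?y))"
    by (rule bracket_commute[OF b]) (use mem zs com in auto)
  then have "iter_bracket a ?ys = iter_bracket (sgm (snd ?y * snd ?y') (bracket (bracket ?b (fst ?y')) (fst ?y))) ?vs"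
    by (subst ys) (simp add: iter_bracket_append iter_bracket_Cons)
  also have "\<dots> = sgm (snd ?y * snd ?y') (iter_bracket (bracket (bracket ?b (fst ?y')) (fst ?y)) ?vs)"
    by (intro iter_bracket_sgm hvs bracket_closed b) (use mem zs in auto)
  also have "iter_bracket (bracket (bracket ?b (fst ?y')) (fst ?y)) ?vs = iter_bracket a (permute_list ?t ?ys)"
    by (simp only: permute_list_transpose_adj[OF i] iter_bracket_append iter_bracket_Cons append_Cons append_Nil iter_bracket_Nil)
  also have "permute_list ?t ?ys = permute_list (\<sigma> \<circ> ?t) zs"
    by (rule permute_list_compose[symmetric]) (use adj in \<open>auto intro: permutes_swap_id\<close>)
  finally have step: "iter_bracket a ?ys = sgm (snd ?y * snd ?y') (iter_bracket a (permute_list (\<sigma> \<circ> ?t) zs))" .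
  have "snd ?y = map snd zs ! \<sigma> i" "snd ?y' = map snd zs ! \<sigma> (Suc i)"
    using adj permutes_in_image[OF adj(1), of i] permutes_in_image[OF adj(1), of "Suc i"]
    by (simp_all add: permute_list_nth)
  then have ks: "koszul_sign (\<sigma> \<circ> ?t) (map snd zs)
      = koszul_sign \<sigma> (map snd zs) * (if odd (snd ?y) \<and> odd (snd ?y') then - 1 else 1)"
    using koszul_sign_adj[OF adj(1,2), of "map snd zs"] by simp
  show "iter_bracket a zs = scale_cochain s (of_int (koszul_sign (\<sigma> \<circ> ?t) (map snd zs)))
      (iter_bracket a (permute_list (\<sigma> \<circ> ?t) zs))"
    unfolding adj(3) step ks by (auto simp: scale_cochain_def sgm_def fun_eq_iff)
qed

text \<open>
  Voronov's higher derived bracket identity: expanding the iterated bracket of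
  \<open>bracket \<Delta> \<Delta> = 0\<close> with the \<open>2 N - 1\<close> elements of \<open>zs\<close> yields every term of the claimed sum twice.
\<close>

theorem derived_bracket_identity:
  assumes \<Delta>: "\<Delta> \<in> \<C>" "homog 1 \<Delta>" "bracket \<Delta> \<Delta> = 0" and two: "(2 :: 'k) \<noteq> 0"
    and zs: "homogs zs" "fst ` set zs \<subseteq> L" "length zs = 2 * N - 1" and N: "N > 0"
    and com: "\<And>P Q. P \<in> L \<Longrightarrow> Q \<in> L \<Longrightarrow> bracket P Q = 0"
    and top: "\<And>ys. homogs ys \<Longrightarrow> fst ` set ys \<subseteq> L \<Longrightarrow> length ys = N \<Longrightarrow> iter_bracket \<Delta> ys \<in> L"
    and vanish: "\<And>ys. homogs ys \<Longrightarrow> fst ` set ys \<subseteq> L \<Longrightarrow> length ys > N \<Longrightarrow> iter_bracket \<Delta> ys = 0"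
  shows "(\<Sum>(e, I, J)\<leftarrow>filter (\<lambda>(e, I, J). length I = N) (splits snd zs).
    sgm e (iter_bracket \<Delta> ((iter_bracket \<Delta> I, deg I + 1) # J))) = 0" (is "?S = 0")
proof -
  define g where "g e I J = (if length I = N then sgm e (iter_bracket \<Delta> ((iter_bracket \<Delta> I, deg I + 1) # J)) else 0)"
    for e I J
  have S: "?S = (\<Sum>(e, I, J)\<leftarrow>splits snd zs. g e I J)"
    by (simp add: sum_list_filter_if case_prod_unfold g_def)
  \<comment> \<open>Every splitting is read backwards, so that in twice the sum each term meets its
    mirror image.\<close>
  also have "\<dots> = (\<Sum>(e, I, J)\<leftarrow>splits snd zs. g (e + deg I * deg J) J I)"
    by (rule splits_swap) (auto simp: g_def intro: sgm_cong)
  finally have "?S + ?S = (\<Sum>(e, I, J)\<leftarrow>splits snd zs. g e I J + g (e + deg I * deg J) J I)"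
    using S by (simp add: case_prod_unfold sum_list_addf)
  also have "\<dots> = (\<Sum>(e, I, J)\<leftarrow>splits snd zs. sgm (1 * deg I + e) (bracket (iter_bracket \<Delta> I) (iter_bracket \<Delta> J)))"
  proof (intro arg_cong[where f = sum_list] map_cong refl)
    fix t assume t: "t \<in> set (splits snd zs)"
    obtain e I J where [simp]: "t = (e, I, J)" by (cases t)
    have len: "length I + length J = 2 * N - 1" and sub: "set I \<union> set J = set zs"
      using t splits_length[of e I J snd zs] splits_set[of e I J snd zs] zs by auto
    then have I: "homogs I" "fst ` set I \<subseteq> L" and J: "homogs J" "fst ` set J \<subseteq> L"
      using zs by blast+
    let ?I = "iter_bracket \<Delta> I" and ?J = "iter_bracket \<Delta> J"
    have cl: "?I \<in> \<C>" "?J \<in> \<C>" "homog (1 + deg I) ?I" "homog (1 + deg J) ?J"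
      using iter_bracket_closed[OF \<Delta>(1)] iter_bracket_homog[OF \<Delta>(1,2)] I J by auto
    \<comment> \<open>The inner bracket lies in \<open>L\<close> and commutes with the entries of
      \<open>B\<close>. Moved from the first to the last place, it turns the nested bracket into a
      bracket of two iterated brackets, the shape that occurs in the Leibniz expansion.\<close>
    have move: "iter_bracket \<Delta> ((iter_bracket \<Delta> A, deg A + 1) # B)
        = sgm ((deg A + 1) * deg B) (bracket (iter_bracket \<Delta> B) (iter_bracket \<Delta> A))"
      if "homogs A" "fst ` set A \<subseteq> L" "homogs B" "fst ` set B \<subseteq> L" "length A = N" for A B
    proof -
      let ?q = "(iter_bracket \<Delta> A, deg A + 1)"
      have "iter_bracket \<Delta> (B @ [?q]) = sgm (snd ?q * deg B) (iter_bracket \<Delta> (?q # B))"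
      proof (rule iter_bracket_move[OF \<Delta>(1,2)])
        show "homogs (?q # B)"
          using that iter_bracket_closed[OF \<Delta>(1)] iter_bracket_homog[OF \<Delta>(1,2)] by (auto simp: add.commute)
        show "\<forall>z\<in>set B. bracket (fst z) (fst ?q) = 0"
          using that top[OF that(1,2,5)] com by auto
      qed
      then have "sgm (snd ?q * deg B) (iter_bracket \<Delta> (B @ [?q])) = iter_bracket \<Delta> (?q # B)"
        by (simp add: sgm_sgm) (simp add: sgm_def)
      then show ?thesis
        by (simp add: iter_bracket_append iter_bracket_Cons)
    qed
    \<comment> \<open>The lengths add up to \<open>2 * N - 1\<close>: either one part has more than
      \<open>N\<close> entries and its bracket vanishes, or exactly one part has \<open>N\<close>
      entries and only one of the two mirror terms is present.\<close>
    consider "length I > N" | "length J > N" | "length I = N" "length J \<noteq> N" | "length J = N" "length I \<noteq> N"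
      using len N by linarith
    then have "g e I J + g (e + deg I * deg J) J I = sgm (1 * deg I + e) (bracket ?I ?J)"
    proof cases
      case 1
      then have "length J \<noteq> N" using len N by linarith
      then show ?thesis
        using 1 vanish[OF I 1] cl by (simp add: g_def bracket_zero_left)
    next
      case 2
      then have "length I \<noteq> N" using len N by linarith
      then show ?thesis
        using 2 vanish[OF J 2] cl by (simp add: g_def bracket_zero_right)
    next
      case 3
      have skew: "bracket ?I ?J = - sgm ((1 + deg I) * (1 + deg J)) (bracket ?J ?I)"
        by (rule bracket_skew) (use cl in auto)
      have eq: "g e I J + g (e + deg I * deg J) J I = sgm (e + (deg I + 1) * deg J) (bracket ?J ?I)"
        by (simp only: g_def 3 move[OF I J 3(1)] sgm_sgm simp_thms if_True if_False add_0_right)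
      show ?thesis
        unfolding eq skew sgm_minus sgm_sgm by (rule sgm_odd) auto
    next
      case 4
      have eq: "g e I J + g (e + deg I * deg J) J I = sgm (e + deg I * deg J + (deg J + 1) * deg I) (bracket ?I ?J)"
        by (simp only: g_def 4 move[OF J I 4(1)] sgm_sgm simp_thms if_True if_False add_0_left)
      show ?thesis
        unfolding eq by (rule sgm_cong) auto
    qed
    then show "(case t of (e, I, J) \<Rightarrow> g e I J + g (e + deg I * deg J) J I)
        = (case t of (e, I, J) \<Rightarrow> sgm (1 * deg I + e) (bracket (iter_bracket \<Delta> I) (iter_bracket \<Delta> J)))"
      by simp
  qed
  also have "\<dots> = iter_bracket (bracket \<Delta> \<Delta>) zs"
    by (rule iter_bracket_of_bracket[OF \<Delta>(1,2) \<Delta>(1,2) zs(1), symmetric])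
  also have "\<dots> = 0"
    by (simp add: \<Delta>(3) iter_bracket_zero zs(1))
  finally have SS: "?S + ?S = 0" .
  have double: "s 2 y = y + y" for y
    using scale_left_distrib[of 1 1 y] by simp
  have "s 2 (?S Xs x) = 0" for Xs x
    unfolding double using fun_cong[OF fun_cong[OF SS, of Xs], of x] by (simp only: plus_fun_apply zero_fun_apply)
  then have "?S Xs x = 0" for Xs x
    using two scale_eq_0_iff by blast
  then show ?thesis
    by (intro ext) (simp only: zero_fun_apply)
qed

end

section \<open>Cochains with values in the first summand\<close>

text \<open>Contracting with the preceding blocks makes any block the first one, so conditions on
  the first block of all contractions amount to conditions on every block.\<close>

lemma (in cochain_space) cochains_eq: "cochains n sA sB p = \<C> \<inter> {F. homog (int p) F}"
proof (intro set_eqI iffI)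
  fix F assume "F \<in> \<C> \<inter> {F. homog (int p) F}"
  then have F: "F \<in> \<C>" and hom: "homog (int p) F" by auto
  have outside: "F Xs x = 0" if "Xs \<notin> blocks n p" for Xs x
  proof (cases "\<forall>X\<in>set Xs. length X = n - 1")
    case True
    then show ?thesis using that hom by (simp add: blocks_def homog_def)
  next
    case False
    then show ?thesis using all_cochains_outside[OF F] by simp
  qed
  have slot: "Vector_Spaces.linear sA sB (\<lambda>y. F (Xs[i := (Xs ! i)[j := y]]) x)"
    if "Xs \<in> blocks n p" "i < p" "j < n - 1" for Xs x i j
  proof -
    have len: "length (Xs ! i) = n - 1" "i < length Xs"
      using that by (auto simp: blocks_def)
    show ?thesis
      unfolding linear_iff
      using contr_slot[OF all_cochains_prefix[OF F, of "take i Xs"] len(1) that(3)] len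
      by (simp add: contr_def fun_eq_iff upd_conv_take_nth_drop scale_cochain_def)
  qed
  have dist: "F Xs x = 0" if X: "X \<in> set Xs" "\<not> distinct X" for Xs X x
  proof -
    obtain Ys Zs where "Xs = Ys @ X # Zs"
      using X split_list by metis
    then show ?thesis
      using contr_bad[OF all_cochains_prefix[OF F, of Ys], of X] X by (simp add: contr_def fun_eq_iff)
  qed
  have last: "F Xs x = 0" if "Xs \<noteq> []" "x \<in> set (last Xs)" for Xs x
    using last_block_zero[OF all_cochains_prefix[OF F, of "butlast Xs"] that(2)] that(1) by simp
  show "F \<in> cochains n sA sB p"
    unfolding cochains_def using outside slot dist last all_cochains_linear_arg[OF F] by blast
next
  fix F assume F: "F \<in> cochains n sA sB p"
  have outside: "F Xs = 0" if "Xs \<notin> blocks n p" for Xs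
    using F that by (auto simp: cochains_def fun_eq_iff)
  have lin: "Vector_Spaces.linear sA sB (F Xs)" for Xs
  proof (cases "Xs \<in> blocks n p")
    case True
    then show ?thesis using F by (simp add: cochains_def)
  qed (simp add: outside linear_iff)
  have dist: "F Xs x = 0" if "X \<in> set Xs" "\<not> distinct X" for Xs X x
    using F outside[of Xs] that by (cases "Xs \<in> blocks n p") (auto simp: cochains_def)
  have last: "F (Ys @ [X]) x = 0" if "x \<in> set X" for Ys X x
    using F outside[of "Ys @ [X]"] that by (cases "Ys @ [X] \<in> blocks n p") (auto simp: cochains_def)
  have slot: "F (Ys @ X[j := sA c y + z] # Zs) x = sB c (F (Ys @ X[j := y] # Zs) x) + F (Ys @ X[j := z] # Zs) x"
    if "j < n - 1" for Ys X j c y z Zs x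
  proof (cases "Ys @ X # Zs \<in> blocks n p")
    case True
    then have "length Ys < p" by (auto simp: blocks_def)
    then have "Vector_Spaces.linear sA sB (\<lambda>y. F ((Ys @ X # Zs)[length Ys := ((Ys @ X # Zs) ! length Ys)[j := y]]) x)"
      using F True that unfolding cochains_def by blast
    then show ?thesis
      unfolding linear_iff by simp
  next
    case False
    then have "Ys @ X[j := w] # Zs \<notin> blocks n p" for w
      by (auto simp: blocks_def)
    then show ?thesis by (simp add: outside)
  qed
  have bad: "F (Ys @ X # Zs) x = 0" if "length X \<noteq> n - 1 \<or> \<not> distinct X" for Ys X Zs x
  proof (cases "length X = n - 1")
    case True
    then show ?thesis using that dist[of X "Ys @ X # Zs"] by simp
  next
    case False
    then have "Ys @ X # Zs \<notin> blocks n p" by (auto simp: blocks_def)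
    then show ?thesis by (simp add: outside)
  qed
  have "first_block_ok n sA sB (\<lambda>Xs. F (Ys @ Xs))" for Ys
    unfolding first_block_ok_def using lin last slot bad
    by (auto simp: contr_def fun_eq_iff scale_cochain_def)
  then show "F \<in> \<C> \<inter> {F. homog (int p) F}"
    using outside by (auto simp: all_cochains_def homog_def blocks_def)
qed

lemma (in cochain_space) cochain_grading_eq: "cochain_grading n sA sB m = \<C> \<inter> {F. homog m F}"
proof (cases "m < 0")
  case True
  then have "homog m F \<longleftrightarrow> F = 0" for F :: "'a list list \<Rightarrow> 'a \<Rightarrow> 'b"
    by (auto simp: homog_def fun_eq_iff)
  then show ?thesis using True by (auto simp: cochain_grading_def)
qed (simp add: cochain_grading_def cochains_eq)

lemma linear_combination:
  "Vector_Spaces.linear sA sB f \<Longrightarrow> f (sA c y + z) = sB c (f y) + f z"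
  unfolding linear_iff_module_hom by (simp add: module_hom.add module_hom.scale)

text \<open>Used twice: with \<open>snd\<close> and the inclusion of \<gg> for
  \<open>lift_cochain\<close>, with \<open>Pair 0\<close> and \<open>fst\<close> for
  \<open>restrict_cochain\<close>.\<close>

lemma all_cochains_pullback:
  assumes "F \<in> all_cochains n sA sB"
    and \<psi>: "Vector_Spaces.linear sA' sA \<psi>" and \<phi>: "Vector_Spaces.linear sB sB' \<phi>"
  shows "(\<lambda>Xs x. \<phi> (F (map (map \<psi>) Xs) (\<psi> x))) \<in> all_cochains n sA' sB'"
proof -
  have zero: "\<phi> 0 = 0"
    using \<phi> unfolding linear_iff_module_hom by (rule module_hom.zero)
  let ?pull = "\<lambda>F Xs x. \<phi> (F (map (map \<psi>) Xs) (\<psi> x))"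
  have "first_block_ok n sA' sB' (?pull F)" if F: "first_block_ok n sA sB F" for F
    unfolding first_block_ok_def
  proof (intro conjI allI impI)
    have "Vector_Spaces.linear sA sB (F [])"
      using F by (simp add: first_block_ok_def)
    from Vector_Spaces.linear_compose[OF Vector_Spaces.linear_compose[OF \<psi> this] \<phi>] show "Vector_Spaces.linear sA' sB' (?pull F [])"
      by (simp add: o_def)
    show "?pull F [X] x = 0" if "x \<in> set X" for X x
      using that F by (simp add: first_block_ok_def zero)
    show "contr X (?pull F) = 0" if "length X \<noteq> n - 1 \<or> \<not> distinct X" for X
    proof -
      have "length (map \<psi> X) \<noteq> n - 1 \<or> \<not> distinct (map \<psi> X)"
        using that by (auto simp: distinct_map)
      then have "contr (map \<psi> X) F = 0"
        using F unfolding first_block_ok_def by blast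
      then show ?thesis
        by (simp add: contr_def fun_eq_iff zero)
    qed
    show "contr (X[j := sA' c y + z]) (?pull F)
        = scale_cochain sB' c (contr (X[j := y]) (?pull F)) + contr (X[j := z]) (?pull F)"
      if "length X = n - 1 \<and> j < n - 1" for X j c y z
    proof -
      have "contr ((map \<psi> X)[j := sA c (\<psi> y) + \<psi> z]) F
          = scale_cochain sB c (contr ((map \<psi> X)[j := \<psi> y]) F) + contr ((map \<psi> X)[j := \<psi> z]) F"
        using F that unfolding first_block_ok_def by (metis length_map)
      then show ?thesis
        by (simp add: contr_def fun_eq_iff map_update linear_combination[OF \<psi>] linear_combination[OF \<phi>]
            scale_cochain_def)
    qed
  qed
  from this[of "\<lambda>Xs. F (map (map \<psi>) Ys @ Xs)" for Ys] show ?thesis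
    using assms(1) by (simp add: all_cochains_def)
qed

lemma length_filter_update: "int (length (filter P (X[i := w]))) = int (length (filter P X))
    - (if P (X ! i) then 1 else 0) + (if P w then 1 else 0)" if "i < length X"
  using that by (subst (2) id_take_nth_drop[OF that]) (simp add: upd_conv_take_nth_drop)

section \<open>Passage between cochains from \<open>V\<close> to \<gg> and cochains on the direct
  sum\<close>

locale nlie_cochain_pair = G: vector_space sg + V: vector_space sv
  for sg :: "'k::field \<Rightarrow> 'g::ab_group_add \<Rightarrow> 'g" and sv :: "'k \<Rightarrow> 'v::ab_group_add \<Rightarrow> 'v" +
  fixes n :: nat
begin

abbreviation "sw \<equiv> module_prod.scale sg sv"

lemma sw_eq: "sw c w = (sg c (fst w), sv c (snd w))"
proof -
  interpret vector_space_prod sg sv by unfold_locales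
  show ?thesis by (simp add: scale_def)
qed

sublocale VG: cochain_space sv sg n
  by unfold_locales

sublocale W: cochain_algebra sw n
  by unfold_locales (auto simp: sw_eq algebra_simps G.scale_right_distrib V.scale_right_distrib)

abbreviation "CV \<equiv> all_cochains n sv sg"
abbreviation "CW \<equiv> all_cochains n sw sw"

lemma lift_add: "lift_cochain (P + Q) = lift_cochain P + (lift_cochain Q :: ('g \<times> 'v) list list \<Rightarrow> 'g \<times> 'v \<Rightarrow> 'g \<times> 'v)"
  for P :: "'v list list \<Rightarrow> 'v \<Rightarrow> 'g"
  by (simp add: lift_cochain_def fun_eq_iff)

lemma lift_scale: "lift_cochain (scale_cochain sg c P) = scale_cochain sw c (lift_cochain P)"
  by (simp add: lift_cochain_def scale_cochain_def sw_eq fun_eq_iff)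

lemma lift_closed:
  assumes "P \<in> CV"
  shows "lift_cochain P \<in> CW"
proof -
  have "Vector_Spaces.linear sw sv snd" "Vector_Spaces.linear sg sw (\<lambda>y. (y, 0))"
    by unfold_locales (simp_all add: sw_eq)
  from all_cochains_pullback[OF assms this] show ?thesis
    by (simp add: lift_cochain_def)
qed

lemma lift_homog: "homog d P \<Longrightarrow> homog d (lift_cochain P)"
  by (auto simp: homog_def lift_cochain_def fun_eq_iff zero_prod_def)

lemma restrict_add: "restrict_cochain (F + G) = restrict_cochain F + (restrict_cochain G :: 'v list list \<Rightarrow> 'v \<Rightarrow> 'g)"
  by (simp add: restrict_cochain_def fun_eq_iff)

lemma restrict_zero: "restrict_cochain 0 = (0 :: 'v list list \<Rightarrow> 'v \<Rightarrow> 'g)"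
  by (simp add: restrict_cochain_def fun_eq_iff)

lemma restrict_scale: "restrict_cochain (scale_cochain sw c F) = scale_cochain sg c (restrict_cochain F)"
  by (simp add: restrict_cochain_def scale_cochain_def sw_eq fun_eq_iff)

lemma restrict_closed:
  assumes "F \<in> CW"
  shows "restrict_cochain F \<in> CV"
proof -
  have "Vector_Spaces.linear sv sw (Pair 0)" "Vector_Spaces.linear sw sg fst"
    by unfold_locales (simp_all add: sw_eq)
  from all_cochains_pullback[OF assms this] show ?thesis
    by (simp add: restrict_cochain_def)
qed

lemma restrict_homog: "homog d F \<Longrightarrow> homog d (restrict_cochain F)"
  by (auto simp: homog_def restrict_cochain_def fun_eq_iff)

section \<open>The filtration by arguments from \<gg>\<close>

definition g_count :: "('g \<times> 'v) list \<Rightarrow> int"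
  where "g_count X = int (length (filter (\<lambda>w. snd w = 0) X))"

lemma g_count_nonneg: "0 \<le> g_count X"
  by (simp add: g_count_def)

lemma g_count_pos: "w \<in> set X \<Longrightarrow> snd w = 0 \<Longrightarrow> 0 < g_count X"
  by (auto simp: g_count_def filter_empty_conv)

lemma g_count_append [simp]: "g_count (X @ Y) = g_count X + g_count Y"
  and g_count_Nil [simp]: "g_count [] = 0"
  and g_count_single: "g_count [w] = (if snd w = 0 then 1 else 0)"
  by (simp_all add: g_count_def)

lemma g_count_update:
  "i < length X \<Longrightarrow> g_count (X[i := w])
    = g_count X - (if snd (X ! i) = 0 then 1 else 0) + (if snd w = 0 then 1 else 0)"
  unfolding g_count_def by (rule length_filter_update)

text \<open>
  The cochain \<open>\<mu> + \<rho>\<close> lies in filtration \<open>n\<close>, the cochains with arguments in \<open>V\<close> and values in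
  \<open>\<gg>\<close> are those of filtration 0, and a bracket with one of them lowers the filtration by one.
\<close>

definition filtered :: "int \<Rightarrow> (('g \<times> 'v) list list \<Rightarrow> 'g \<times> 'v \<Rightarrow> 'g \<times> 'v) \<Rightarrow> bool"
  where "filtered r F \<longleftrightarrow> (\<forall>Xs x.
    (r < g_count (concat Xs @ [x]) \<longrightarrow> F Xs x = 0) \<and>
    (r \<le> g_count (concat Xs @ [x]) \<longrightarrow> snd (F Xs x) = 0))"

lemma filteredD:
  assumes "filtered r F"
  shows "r < g_count (concat Xs @ [x]) \<Longrightarrow> F Xs x = 0"
    and "r \<le> g_count (concat Xs @ [x]) \<Longrightarrow> snd (F Xs x) = 0"
  using assms unfolding filtered_def by blast+

lemma filtered_0_snd: "filtered 0 F \<Longrightarrow> snd (F Xs x) = 0"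
  using filteredD(2)[of 0 F] g_count_nonneg by blast

lemma filtered_0_zero: "filtered 0 F \<Longrightarrow> w \<in> set (concat Xs @ [x]) \<Longrightarrow> snd w = 0 \<Longrightarrow> F Xs x = 0"
  using filteredD(1)[of 0 F] g_count_pos by blast

lemma filtered_mono: "filtered r F \<Longrightarrow> r \<le> r' \<Longrightarrow> filtered r' F"
  by (auto simp: filtered_def)

lemma filtered_add: "filtered r F \<Longrightarrow> filtered r G \<Longrightarrow> filtered r (F + G)"
  and filtered_diff: "filtered r F \<Longrightarrow> filtered r G \<Longrightarrow> filtered r (F - G)"
  by (auto simp: filtered_def)

lemma filtered_altsign: "filtered r F \<Longrightarrow> filtered r (altsign F)"
  by (auto simp: filtered_def altsign_def sgm_def)

lemma filtered_degree_part: "filtered r F \<Longrightarrow> filtered r (degree_part S F)"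
  by (auto simp: filtered_def degree_part_def)

lemma filtered_contr: "filtered r F \<Longrightarrow> filtered (r - g_count X) (contr X F)"
  unfolding filtered_def contr_def by (force dest: spec[of _ "X # _"])

lemma filtered_neg: "filtered r F \<Longrightarrow> r < 0 \<Longrightarrow> F = 0"
  by (intro ext) (metis filtered_def order_less_le_trans g_count_nonneg zero_fun_apply)

lemma filtered_lift:
  assumes "P \<in> CV"
  shows "filtered 0 (lift_cochain P)"
  unfolding filtered_def
proof (intro allI conjI impI)
  fix Xs :: "('g \<times> 'v) list list" and x
  assume "0 < g_count (concat Xs @ [x])"
  then have "\<exists>w\<in>set (concat Xs @ [x]). snd w = 0"
    unfolding g_count_def by (metis (mono_tags, lifting) filter_False length_0_conv of_nat_0 order_less_irrefl)
  then consider "snd x = 0" | X w where "X \<in> set Xs" "w \<in> set X" "snd w = 0"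
    by auto
  then show "lift_cochain P Xs x = 0"
  proof cases
    case 1
    have "P Ys 0 = 0" for Ys
      using VG.all_cochains_linear_arg[OF assms, of Ys] unfolding linear_iff_module_hom
      by (rule module_hom.zero)
    then show ?thesis using 1 by (simp add: lift_cochain_def zero_prod_def)
  next
    case 2
    obtain Ys Zs where Xs: "Xs = Ys @ X # Zs"
      using 2 split_list by metis
    obtain j where j: "j < length X" "X ! j = w"
      using 2 by (metis in_set_conv_nth)
    let ?F = "\<lambda>Xs. P (map (map snd) Ys @ Xs)"
    have F: "?F \<in> CV"
      by (rule VG.all_cochains_prefix[OF assms])
    have "contr (map snd X) ?F = 0"
    proof (cases "length X = n - 1")
      case True
      have "(map snd X)[j := 0] = map snd X"
        using j 2 by (metis length_map list_update_id nth_map)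
      then show ?thesis
        using VG.contr_slot_zero[OF F, of j "map snd X"] True j by simp
    qed (simp add: VG.contr_bad[OF F])
    then show ?thesis
      by (simp add: Xs lift_cochain_def contr_def fun_eq_iff zero_prod_def)
  qed
qed (simp add: lift_cochain_def)

text \<open>In filtration 0 a cochain vanishes as soon as one argument lies in \<gg>, so by
  additivity every argument may be replaced by its \<open>V\<close>-component; its values lie in
  \<gg> anyway.\<close>

lemma filtered_0_lift:
  assumes F: "F \<in> CW" and "filtered 0 F"
  shows "F = lift_cochain (restrict_cochain F)"
proof -
  let ?z = "\<lambda>w :: 'g \<times> 'v. (0 :: 'g, snd w)"
  have split: "w = (fst w, 0) + ?z w" for w :: "'g \<times> 'v"
    by simp
  have "F Xs x = F (map (map ?z) Xs) (?z x)" if "F \<in> CW" "filtered 0 F" for F Xs x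
    using that
  proof (induction Xs arbitrary: F)
    case Nil
    have "F [] x = F [] (fst x, 0) + F [] (?z x)"
      using W.cochain_arg_add[OF Nil(1), of "[]" "(fst x, 0)" "?z x"] by simp
    moreover have "F [] (fst x, 0) = 0"
      using Nil(2) unfolding filtered_def by (auto dest!: spec[of _ "[]"] spec[of _ "(fst x, 0)"] simp: g_count_single)
    ultimately show ?case by simp
  next
    case (Cons X Xs)
    note F = Cons.prems(1)
    have slot: "contr (X[j := w]) F = contr (X[j := ?z w]) F" if j: "j < length X" "length X = n - 1" for X j w
    proof -
      have "filtered (0 - g_count (X[j := (fst w, 0)])) (contr (X[j := (fst w, 0)]) F)"
        by (rule filtered_contr[OF Cons.prems(2)])
      moreover have "0 - g_count (X[j := (fst w, 0)]) < 0"
        using g_count_pos[OF set_update_memI[OF j(1), of "(fst w, 0)"]] by simp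
      ultimately have "contr (X[j := (fst w, 0)]) F = 0"
        by (rule filtered_neg)
      then show ?thesis
        using W.contr_slot_add[OF F, of j X "(fst w, 0)" "?z w"] j by simp
    qed
    have "contr X F = contr (map ?z X) F"
    proof (cases "length X = n - 1")
      case True
      \<comment> \<open>The entries of the block are replaced one at a time from the left.\<close>
      have "contr X F = contr (map ?z (take k X) @ drop k X) F" if "k \<le> length X" for k
        using that
      proof (induction k)
        case (Suc k)
        let ?Y = "map ?z (take k X) @ drop k X"
        have k: "k < length ?Y" "?Y ! k = X ! k" "length ?Y = n - 1"
          using Suc.prems True by (simp_all add: nth_append)
        have "?Y[k := ?z (X ! k)] = map ?z (take (Suc k) X) @ drop (Suc k) X"
          using Suc.prems by (simp add: list_update_append take_Suc_conv_app_nth Cons_nth_drop_Suc[symmetric])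
        moreover have "?Y[k := X ! k] = ?Y"
          using k by (metis list_update_id)
        ultimately show ?case
          using slot[OF k(1,3), of "X ! k"] Suc by simp
      qed simp
      from this[of "length X"] show ?thesis by simp
    qed (simp add: W.contr_bad[OF F])
    moreover have "contr X F Xs x = contr X F (map (map ?z) Xs) (?z x)"
      by (rule Cons.IH[OF W.all_cochains_contr[OF F]])
        (use filtered_contr[OF Cons.prems(2), of X] g_count_nonneg[of X] in \<open>auto intro: filtered_mono\<close>)
    ultimately show "F (X # Xs) x = F (map (map ?z) (X # Xs)) (?z x)"
      by (simp add: contr_def fun_eq_iff)
  qed
  from this[OF assms] have "fst (F Xs x) = fst (F (map (map ?z) Xs) (?z x))" for Xs x
    by simp
  moreover have "snd (F Xs x) = 0" for Xs x
    by (rule filtered_0_snd[OF assms(2)])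
  ultimately show ?thesis
    by (simp add: fun_eq_iff lift_cochain_def restrict_cochain_def prod_eq_iff o_def)
qed

text \<open>A value of \<open>P\<close> lies in \<gg> and uses up one argument of \<open>F\<close>
  from \<gg>, while \<open>P\<close> itself accepts none; so the composite tolerates one argument
  from \<gg> less.\<close>

lemma filtered_star_left:
  assumes "F \<in> CW" "filtered r F" "P \<in> CW" "filtered 0 P"
  shows "filtered (r - 1) (star n F P)"
proof -
  have "(r - 1 < g_count (concat Xs @ [x]) \<longrightarrow> star n F P Xs x = 0) \<and>
      (r - 1 \<le> g_count (concat Xs @ [x]) \<longrightarrow> snd (star n F P Xs x) = 0)"
    if "F \<in> CW" "filtered r F" "P \<in> CW" "filtered 0 P" for F P r Xs x
    using that
  proof (induction Xs arbitrary: F P r)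
    case Nil
    have P: "snd (P [] x) = 0" "snd x = 0 \<longrightarrow> P [] x = 0"
      using filtered_0_snd[OF Nil(4)] filtered_0_zero[OF Nil(4), of x "[]" x] by auto
    have "r < 1 \<longrightarrow> F [] (P [] x) = 0" "r \<le> 1 \<longrightarrow> snd (F [] (P [] x)) = 0"
      using filteredD[OF Nil(2), of "[]" "P [] x"] P(1) by (simp_all add: g_count_single)
    then show ?case
      using P W.cochain_arg_zero[OF Nil(1)] by (simp add: g_count_single)
  next
    case (Cons X Xs)
    note F = Cons.prems(1,2) and P = Cons.prems(3,4)
    let ?c = "g_count (concat Xs @ [x])"
    have X0: "0 \<le> g_count X" by (rule g_count_nonneg)
    have cP: "contr X P \<in> CW" "filtered (0 - g_count X) (contr X P)"
      using P W.all_cochains_contr filtered_contr by blast+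
    have cF: "contr X F \<in> CW" "filtered (r - g_count X) (contr X F)"
      using F W.all_cochains_contr filtered_contr by blast+
    have "contr X P = 0" if "g_count X > 0"
      using filtered_neg[OF cP(2)] that by simp
    moreover have "(r - 1 < ?c \<longrightarrow> star n F (contr X P) Xs x = 0) \<and> (r - 1 \<le> ?c \<longrightarrow> snd (star n F (contr X P) Xs x) = 0)"
      by (rule Cons.IH[OF F cP(1)]) (use cP(2) X0 in \<open>auto intro: filtered_mono\<close>)
    ultimately have 1: "(r - 1 < g_count X + ?c \<longrightarrow> star n F (contr X P) Xs x = 0) \<and>
        (r - 1 \<le> g_count X + ?c \<longrightarrow> snd (star n F (contr X P) Xs x) = 0)"
      using X0 F(1) by (cases "g_count X = 0") auto
    have 2: "(r - g_count X - 1 < ?c \<longrightarrow> star n (contr X F) (altsign P) Xs x = 0) \<and>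
        (r - g_count X - 1 \<le> ?c \<longrightarrow> snd (star n (contr X F) (altsign P) Xs x) = 0)"
      by (rule Cons.IH[OF cF W.all_cochains_altsign[OF P(1)] filtered_altsign[OF P(2)]])
    have ins: "(r - 1 < g_count X + ?c \<longrightarrow> F (X[i := P [] (X ! i)] # Xs) x = 0) \<and>
        (r - 1 \<le> g_count X + ?c \<longrightarrow> snd (F (X[i := P [] (X ! i)] # Xs) x) = 0)" if i: "i < n - 1" for i
    proof (cases "length X = n - 1 \<and> snd (X ! i) \<noteq> 0")
      case True
      \<comment> \<open>The inserted value lies in \<gg> but the entry that it replaces does not, so
        the count rises by one and the bound for \<open>F\<close> applies.\<close>
      have "snd (P [] (X ! i)) = 0"
        by (rule filtered_0_snd[OF P(2)])
      then have "g_count (X[i := P [] (X ! i)]) = g_count X + 1"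
        using True i by (simp add: g_count_update)
      then have "g_count (concat (X[i := P [] (X ! i)] # Xs) @ [x]) = g_count X + ?c + 1"
        by simp
      then show ?thesis
        using filteredD[OF F(2), of "X[i := P [] (X ! i)] # Xs" x] by simp
    next
      case False
      have "F (X[i := P [] (X ! i)] # Xs) x = 0"
      proof (cases "length X = n - 1")
        case True
        then have "P [] (X ! i) = 0"
          using False filtered_0_zero[OF P(2), of "X ! i" "[]" "X ! i"] by simp
        then show ?thesis
          using W.contr_slot_zero[OF F(1) i, of X, THEN fun_cong, of Xs, THEN fun_cong, of x]
          by (simp add: contr_def)
      next
        case len: False
        then show ?thesis
          using W.contr_bad[OF F(1), of "X[i := P [] (X ! i)]", THEN fun_cong, of Xs, THEN fun_cong, of x]
          by (simp add: contr_def)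
      qed
      then show ?thesis by simp
    qed
    have 3: "(r - 1 < g_count X + ?c \<longrightarrow> (\<Sum>i<n - 1. F (X[i := P [] (X ! i)] # Xs) x) = 0) \<and>
        (r - 1 \<le> g_count X + ?c \<longrightarrow> snd (\<Sum>i<n - 1. F (X[i := P [] (X ! i)] # Xs) x) = 0)"
      using ins by (simp add: snd_sum)
    have "g_count (concat (X # Xs) @ [x]) = g_count X + ?c"
      by simp
    then show "(r - 1 < g_count (concat (X # Xs) @ [x]) \<longrightarrow> star n F P (X # Xs) x = 0) \<and>
        (r - 1 \<le> g_count (concat (X # Xs) @ [x]) \<longrightarrow> snd (star n F P (X # Xs) x) = 0)"
      unfolding star.simps(2) using 1 2 3 by (simp add: diff_less_eq diff_le_eq algebra_simps)
  qed
  from this[OF assms] show ?thesis unfolding filtered_def by blast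
qed

text \<open>Only the \<open>V\<close>-component of a value of \<open>F\<close> can be seen by
  \<open>P\<close>, and this component already vanishes from \<open>r\<close> arguments in \<gg> on.
  The values of \<open>P\<close> have no \<open>V\<close>-component at all, which gives the second
  half.\<close>

lemma filtered_star_right:
  assumes "F \<in> CW" "filtered r F" "P \<in> CW" "filtered 0 P"
  shows "filtered (r - 1) (star n P F)"
proof -
  have "(r \<le> g_count (concat Xs @ [x]) \<longrightarrow> star n P F Xs x = 0) \<and> snd (star n P F Xs x) = 0"
    if "F \<in> CW" "filtered r F" "P \<in> CW" "filtered 0 P" for F P r Xs x
    using that
  proof (induction Xs arbitrary: F P r)
    case Nil
    show ?case
      using filteredD(2)[OF Nil(2), of "[]" x] filtered_0_snd[OF Nil(4)]
        filtered_0_zero[OF Nil(4), of "F [] x" "[]" "F [] x"] by simp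
  next
    case (Cons X Xs)
    note F = Cons.prems(1,2) and P = Cons.prems(3,4)
    let ?c = "g_count (concat Xs @ [x])"
    have X0: "0 \<le> g_count X" by (rule g_count_nonneg)
    have cP: "contr X P \<in> CW" "filtered (0 - g_count X) (contr X P)"
      using P W.all_cochains_contr filtered_contr by blast+
    have cF: "contr X F \<in> CW" "filtered (r - g_count X) (contr X F)"
      using F W.all_cochains_contr filtered_contr by blast+
    have 1: "(r - g_count X \<le> ?c \<longrightarrow> star n P (contr X F) Xs x = 0) \<and> snd (star n P (contr X F) Xs x) = 0"
      by (rule Cons.IH[OF cF P])
    have "contr X P = 0" if "g_count X > 0"
      using filtered_neg[OF cP(2)] that by simp
    moreover have "(r \<le> ?c \<longrightarrow> star n (contr X P) (altsign F) Xs x = 0) \<and> snd (star n (contr X P) (altsign F) Xs x) = 0"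
      by (rule Cons.IH[OF W.all_cochains_altsign[OF F(1)] filtered_altsign[OF F(2)] cP(1)])
        (use cP(2) X0 in \<open>auto intro: filtered_mono\<close>)
    ultimately have 2: "(r \<le> g_count X + ?c \<longrightarrow> star n (contr X P) (altsign F) Xs x = 0) \<and>
        snd (star n (contr X P) (altsign F) Xs x) = 0"
      using X0 by (cases "g_count X = 0") auto
    have ins: "P (X[i := F [] (X ! i)] # Xs) x = 0" if i: "i < n - 1" and r: "r \<le> g_count X + ?c" for i
    proof (cases "length X = n - 1")
      case True
      show ?thesis
      proof (cases "g_count (X[i := F [] (X ! i)]) + ?c > 0")
        case True
        then have "g_count (concat (X[i := F [] (X ! i)] # Xs) @ [x]) > 0" by simp
        then show ?thesis by (rule filteredD(1)[OF P(2)])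
      next
        case False
        \<comment> \<open>No argument from \<gg> is left after the insertion, so the inserted value
          has a nonzero \<open>V\<close>-component. All arguments counted before must then sit in
          the replaced entry, which contradicts the bound for \<open>F\<close>.\<close>
        have c: "0 \<le> ?c" by (rule g_count_nonneg)
        have u: "g_count (X[i := F [] (X ! i)])
            = g_count X - g_count [X ! i] + g_count [F [] (X ! i)]"
          using i \<open>length X = n - 1\<close> by (simp add: g_count_update g_count_single)
        have "g_count [X ! i] \<le> g_count X"
          using i \<open>length X = n - 1\<close> g_count_pos[of "X ! i" X] g_count_nonneg[of X]
          by (cases "snd (X ! i) = 0") (auto simp: g_count_single)
        then have "g_count [F [] (X ! i)] = 0" "r \<le> g_count [X ! i]"
          using False c u r g_count_nonneg[of "[F [] (X ! i)]"] by linarith+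
        then show ?thesis
          using filteredD(2)[OF F(2), of "[]" "X ! i"] by (simp add: g_count_single split: if_splits)
      qed
    next
      case False
      then show ?thesis
        using W.contr_bad[OF P(1), of "X[i := F [] (X ! i)]", THEN fun_cong, of Xs, THEN fun_cong, of x]
        by (simp add: contr_def)
    qed
    have "snd (P Ys y) = 0" for Ys y
      by (rule filtered_0_snd[OF P(2)])
    then have 3: "snd (\<Sum>i<n - 1. P (X[i := F [] (X ! i)] # Xs) x) = 0"
      by (simp add: snd_sum)
    have "g_count (concat (X # Xs) @ [x]) = g_count X + ?c"
      by simp
    then show "(r \<le> g_count (concat (X # Xs) @ [x]) \<longrightarrow> star n P F (X # Xs) x = 0) \<and> snd (star n P F (X # Xs) x) = 0"
      unfolding star.simps(2) using 1 2 3 ins by (simp add: diff_le_eq algebra_simps)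
  qed
  from this[OF assms] show ?thesis unfolding filtered_def by simp
qed

lemma filtered_bracket:
  assumes F: "F \<in> CW" "filtered r F" and P: "P \<in> CW" "filtered 0 P"
  shows "filtered (r - 1) (W.bracket F P)"
  unfolding W.nlie_bracket_eq[OF F(1) P(1)]
  by (intro filtered_diff filtered_add filtered_star_left filtered_star_right F P W.degree_part_closed
      filtered_degree_part W.all_cochains_altsign filtered_altsign)

text \<open>The bracket would have filtration -1, where only 0 is left: this is the abelian
  subalgebra.\<close>

lemma bracket_filtered_0: "P \<in> CW \<Longrightarrow> filtered 0 P \<Longrightarrow> Q \<in> CW \<Longrightarrow> filtered 0 Q \<Longrightarrow> W.bracket P Q = 0"
  using filtered_bracket[of P 0 Q] by (auto intro: filtered_neg)

lemma filtered_iter_bracket: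
  assumes "F \<in> CW" "filtered r F" "\<forall>z\<in>set zs. fst z \<in> CW \<and> filtered 0 (fst z)"
  shows "filtered (r - int (length zs)) (W.iter_bracket F zs)"
  using assms
proof (induction zs arbitrary: F r)
  case (Cons z zs)
  have "filtered (r - 1 - int (length zs)) (W.iter_bracket (W.bracket F (fst z)) zs)"
    by (rule Cons.IH) (use Cons.prems W.bracket_closed filtered_bracket in auto)
  then show ?case
    by (simp add: W.iter_bracket_Cons algebra_simps)
qed simp

end

section \<open>The semidirect product\<close>

lemma length_omit [simp]: "i < length xs \<Longrightarrow> length (omit i xs) = length xs - 1"
  by (simp add: omit_def)

lemma omit_update:
  assumes "i < length xs" "k < length xs" "i \<noteq> k"
  shows "omit k (xs[i := y]) = (omit k xs)[(if i < k then i else i - 1) := y]"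
proof (cases "i < k")
  case True
  then show ?thesis
    using assms by (simp add: omit_def take_update_swap list_update_append)
next
  case False
  then obtain m where "i = Suc m" "k \<le> m"
    using assms by (cases i) auto
  then show ?thesis
    using assms by (simp add: omit_def drop_update_swap list_update_append)
qed

lemma omit_update_same: "omit i (xs[i := y]) = omit i xs"
  by (simp add: omit_def)

lemma nth_omit: "k < length xs \<Longrightarrow> i < length xs - 1 \<Longrightarrow> omit k xs ! i = xs ! (if i < k then i else Suc i)"
  by (auto simp: omit_def nth_append)

lemma omit_append: "k < length xs \<Longrightarrow> omit k (xs @ ys) = omit k xs @ ys"
  by (simp add: omit_def)

lemma omit_middle: "omit (length xs) (xs @ y # ys) = xs @ ys"
  by (simp add: omit_def)

lemma omit_length: "omit (length xs) (xs @ [y]) = xs"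
  by (simp add: omit_def)

lemma map_omit: "map f (omit i xs) = omit i (map f xs)"
  by (simp add: omit_def take_map drop_map)

lemma omit_reindex_sum:
  fixes h :: "nat \<Rightarrow> 'm::comm_monoid_add"
  assumes "k < n"
  shows "(\<Sum>i\<in>{..<n} - {k}. h i) = (\<Sum>i<n - 1. h (if i < k then i else Suc i))"
  by (rule sum.reindex_bij_witness[where j = "\<lambda>i. if i < k then i else i - 1" and i = "\<lambda>i. if i < k then i else Suc i"])
    (use assms in \<open>auto split: if_splits\<close>)

lemma not_distinct_omit:
  assumes "a < b" "b < length xs" "xs ! a = xs ! b" "i < length xs" "i \<noteq> a" "i \<noteq> b"
  shows "\<not> distinct (omit i xs)"
proof -
  define p where "p c = (if c < i then c else c - 1)" for c
  have nth: "omit i xs ! p c = xs ! c" if "c < length xs" "c \<noteq> i" for c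
  proof (cases "c < i")
    case True
    then show ?thesis using assms(4) by (simp add: p_def nth_omit)
  next
    case False
    then have "i \<le> c - 1" "Suc (c - 1) = c" using that by linarith+
    then show ?thesis using False that assms(4) by (simp add: p_def nth_omit)
  qed
  have len: "p c < length (omit i xs)" if "c < length xs" "c \<noteq> i" for c
    using that assms(4) by (cases "c < i") (simp_all add: p_def)
  have a: "a < length xs" "a \<noteq> i" and b: "b \<noteq> i"
    using assms by simp_all
  have "omit i xs ! p a = omit i xs ! p b"
    unfolding nth[OF a] nth[OF assms(2) b] by (rule assms(3))
  moreover have "p a \<noteq> p b"
    using assms(1) a b unfolding p_def by (cases "a < i"; cases "b < i"; simp; linarith)
  ultimately show ?thesis
    using nth_eq_iff_index_eq[OF _ len[OF a] len[OF assms(2) b]] by blast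
qed

lemma nth_split_two:
  assumes "a < b" "b < length xs" "xs ! a = xs ! b"
  shows "xs = take a xs @ xs ! a # take (b - Suc a) (drop (Suc a) xs) @ xs ! a # drop (Suc b) xs"
proof -
  define ys where "ys = drop (Suc a) xs"
  have "xs = take a xs @ xs ! a # ys"
    using assms unfolding ys_def by (intro id_take_nth_drop) simp
  moreover have "ys = take (b - Suc a) ys @ ys ! (b - Suc a) # drop (Suc (b - Suc a)) ys"
    using assms unfolding ys_def by (intro id_take_nth_drop) simp
  moreover have "ys ! (b - Suc a) = xs ! a" "drop (Suc (b - Suc a)) ys = drop (Suc b) xs"
    using assms unfolding ys_def by (simp_all add: Suc_diff_Suc)
  ultimately show ?thesis
    unfolding ys_def[symmetric] by metis
qed

text \<open>The entry \<open>w\<close> passes the entries of \<open>B\<close> one by one; each swap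
  of neighbours changes the sign by polarization.\<close>

lemma alternating_move:
  assumes f: "alternating_multilinear m sA sB f" and len: "length (A @ B @ w # C) = m"
  shows "f (A @ B @ w # C) = sgm (int (length B)) (f (A @ w # B @ C))"
  using len
proof (induction B arbitrary: A)
  case (Cons b B)
  have add: "f (xs[i := y + z]) = f (xs[i := y]) + f (xs[i := z])" if "length xs = m" "i < m" for xs i y z
  proof -
    have "Vector_Spaces.linear sA sB (\<lambda>y. f (xs[i := y]))"
      using f that unfolding alternating_multilinear_def by blast
    then show ?thesis
      unfolding linear_iff_module_hom by (rule module_hom.add)
  qed
  have zero: "f xs = 0" if "length xs = m" "\<not> distinct xs" for xs
    using f that unfolding alternating_multilinear_def by blast
  have m: "length (A @ x # y # B @ C) = m" for x y
    using Cons.prems by simp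
  have first: "f (A @ (x + x') # y # B @ C) = f (A @ x # y # B @ C) + f (A @ x' # y # B @ C)" for x x' y
    using add[OF m[of x y], of "length A" x x'] m[of x y] by simp
  have second: "f (A @ x # (y + y') # B @ C) = f (A @ x # y # B @ C) + f (A @ x # y' # B @ C)" for x y y'
    using add[OF m[of x y], of "Suc (length A)" y y'] m[of x y] by (simp add: list_update_append)
  have same: "f (A @ x # x # B @ C) = 0" for x
    by (rule zero[OF m]) simp
  have "f (A @ b # w # B @ C) + f (A @ w # b # B @ C) = 0"
    using same[of "b + w"] unfolding first second by (simp add: same add.commute)
  then have swap: "f (A @ b # w # B @ C) = - f (A @ w # b # B @ C)"
    by (simp only: eq_neg_iff_add_eq_0)
  have "f ((A @ [b]) @ B @ w # C) = sgm (int (length B)) (f ((A @ [b]) @ w # B @ C))"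
    by (rule Cons.IH) (use Cons.prems in simp)
  also have "(A @ [b]) @ w # B @ C = A @ b # w # B @ C"
    by simp
  finally show ?case
    unfolding swap by (simp add: sgm_def)
qed simp

lemma alternating_not_distinct:
  "alternating_multilinear m sA sB f \<Longrightarrow> length xs = m \<Longrightarrow> \<not> distinct xs \<Longrightarrow> f xs = 0"
  unfolding alternating_multilinear_def by blast

section \<open>The semidirect product n-Lie algebra\<close>

locale nlie_rep = nlie_cochain_pair sg sv n
  for sg :: "'k::field \<Rightarrow> 'g::ab_group_add \<Rightarrow> 'g" and sv :: "'k \<Rightarrow> 'v::ab_group_add \<Rightarrow> 'v" and n :: nat +
  fixes br :: "'g list \<Rightarrow> 'g" and \<rho> :: "'g list \<Rightarrow> 'v \<Rightarrow> 'v"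
  assumes n2: "n \<ge> 2" and pair: "n_lie_rep_pair n sg br sv \<rho>"
begin

abbreviation "\<Delta> \<equiv> semidirect_cochain n br sv \<rho>"

text \<open>The \<open>V\<close>-component of the semidirect product bracket: each summand uses the
  \<open>V\<close>-component of one argument and the \<gg>-components of all others.\<close>

definition action :: "('g \<times> 'v) list \<Rightarrow> 'v"
  where "action ws = (\<Sum>i<n. sgm (int (n - 1 - i)) (\<rho> (omit i (map fst ws)) (snd (ws ! i))))"

definition semibracket :: "('g \<times> 'v) list \<Rightarrow> 'g \<times> 'v"
  where "semibracket ws = (br (map fst ws), action ws)"

lemma semidirect_cochain_eq: "\<Delta> Xs x = (if Xs \<in> blocks n 1 then semibracket (hd Xs @ [x]) else 0)"
  by (simp add: semidirect_cochain_def semibracket_def action_def Let_def V.scale_minus_one_power map_omit)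

lemma br_alt: "alternating_multilinear n sg sg br"
  and br_identity: "length xs = n - 1 \<Longrightarrow> length ys = n \<Longrightarrow>
    br (xs @ [br ys]) = (\<Sum>i<n. br (ys[i := br (xs @ [ys ! i])]))"
  using pair unfolding n_lie_rep_pair_def n_lie_algebra_def by blast+

lemma rho_linear: "length xs = n - 1 \<Longrightarrow> Vector_Spaces.linear sv sv (\<rho> xs)"
  and rho_alt: "alternating_multilinear (n - 1) sg sv (\<lambda>xs. \<rho> xs v)"
  and rho_commutator: "length xs = n - 1 \<Longrightarrow> length ys = n - 1 \<Longrightarrow>
    \<rho> xs (\<rho> ys v) - \<rho> ys (\<rho> xs v) = (\<Sum>i<n - 1. \<rho> (ys[i := br (xs @ [ys ! i])]) v)"
  using pair unfolding n_lie_rep_pair_def n_lie_representation_def by blast+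

lemma rho_bracket:
  "length xs = n - 2 \<Longrightarrow> length ys = n \<Longrightarrow>
    \<rho> (xs @ [br ys]) v = (\<Sum>i<n. sgm (int (n - 1 - i)) (\<rho> (omit i ys) (\<rho> (xs @ [ys ! i]) v)))"
  using pair unfolding n_lie_rep_pair_def n_lie_representation_def by (simp add: V.scale_minus_one_power)

lemma rho_sum: "length xs = n - 1 \<Longrightarrow> \<rho> xs (\<Sum>i\<in>A. f i) = (\<Sum>i\<in>A. \<rho> xs (f i))"
  and rho_add: "length xs = n - 1 \<Longrightarrow> \<rho> xs (v + w) = \<rho> xs v + \<rho> xs w"
  and rho_zero: "length xs = n - 1 \<Longrightarrow> \<rho> xs 0 = 0"
  and rho_scale: "length xs = n - 1 \<Longrightarrow> \<rho> xs (sv c v) = sv c (\<rho> xs v)"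
  and rho_minus: "length xs = n - 1 \<Longrightarrow> \<rho> xs (- v) = - \<rho> xs v"
  using rho_linear[of xs] unfolding linear_iff_module_hom
  by (simp_all add: module_hom.sum module_hom.add module_hom.zero module_hom.scale module_hom.neg)

lemma rho_sgm: "length xs = n - 1 \<Longrightarrow> \<rho> xs (sgm d v) = sgm d (\<rho> xs v)"
  by (simp add: sgm_def rho_minus)

lemma rho_slot:
  assumes "length xs = n - 1" "i < n - 1"
  shows "\<rho> (xs[i := sg c y + z]) v = sv c (\<rho> (xs[i := y]) v) + \<rho> (xs[i := z]) v"
proof -
  have "Vector_Spaces.linear sg sv (\<lambda>y. \<rho> (xs[i := y]) v)"
    using rho_alt[of v] assms unfolding alternating_multilinear_def by blast
  from linear_combination[OF this] show ?thesis .
qed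

lemma sgm_scale: "sgm d (sv c v) = sv c (sgm d v)"
  by (simp add: sgm_def V.scale_minus_right)

lemma semibracket_slot:
  assumes ws: "length ws = n" and i: "i < n"
  shows "semibracket (ws[i := sw c y + z]) = sw c (semibracket (ws[i := y])) + semibracket (ws[i := z])"
proof -
  have "Vector_Spaces.linear sg sg (\<lambda>y. br ((map fst ws)[i := y]))"
    using br_alt ws i unfolding alternating_multilinear_def by simp
  from linear_combination[OF this, of c "fst y" "fst z"]
  have 1: "br (map fst (ws[i := sw c y + z])) = sg c (br (map fst (ws[i := y]))) + br (map fst (ws[i := z]))"
    by (simp add: map_update sw_eq)
  have "\<rho> (omit k (map fst (ws[i := sw c y + z]))) (snd (ws[i := sw c y + z] ! k))
      = sv c (\<rho> (omit k (map fst (ws[i := y]))) (snd (ws[i := y] ! k)))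
        + \<rho> (omit k (map fst (ws[i := z]))) (snd (ws[i := z] ! k))" if k: "k < n" for k
  proof (cases "k = i")
    case True
    then show ?thesis
      using ws i by (simp add: map_update omit_update_same sw_eq rho_add rho_scale)
  next
    case False
    then have "(if i < k then i else i - 1) < n - 1"
      using i k by auto
    then show ?thesis
      using False ws i k by (simp add: map_update omit_update sw_eq rho_slot)
  qed
  then have 2: "action (ws[i := sw c y + z]) = sv c (action (ws[i := y])) + action (ws[i := z])"
    by (simp add: action_def sgm_add sum.distrib V.scale_sum_right sgm_scale)
  show ?thesis
    unfolding semibracket_def 1 2 by (simp add: sw_eq)
qed

lemma semibracket_not_distinct:
  assumes ws: "length ws = n" and nd: "\<not> distinct ws"
  shows "semibracket ws = 0"
proof -
  have "\<exists>a b. a < b \<and> b < n \<and> ws ! a = ws ! b"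
  proof -
    obtain a b where "a < n" "b < n" "a \<noteq> b" "ws ! a = ws ! b"
      using nd ws unfolding distinct_conv_nth by blast
    then show ?thesis
      by (metis linorder_neqE_nat)
  qed
  then obtain a b where ab: "a < b" "b < n" "ws ! a = ws ! b"
    by blast
  let ?x = "map fst ws"
  let ?t = "\<lambda>i. sgm (int (n - 1 - i)) (\<rho> (omit i ?x) (snd (ws ! i)))"
  have "\<not> distinct ?x"
    using nd by (auto simp: distinct_map)
  then have 1: "br ?x = 0"
    using alternating_not_distinct[OF br_alt] ws by simp
  have "?t i = 0" if "i < n" "i \<noteq> a" "i \<noteq> b" for i
  proof -
    have "\<not> distinct (omit i ?x)"
      by (rule not_distinct_omit[of a b]) (use ab ws that in auto)
    then show ?thesis
      using alternating_not_distinct[OF rho_alt] ws that by simp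
  qed
  then have "action ws = sum ?t {a, b}"
    unfolding action_def using ab by (intro sum.mono_neutral_right) auto
  also have "\<dots> = ?t a + ?t b"
    using ab by simp
  also have "\<dots> = 0"
  proof -
    \<comment> \<open>The two surviving terms leave out one or the other of the equal entries. Their
      argument lists differ by moving the common value past the \<open>b - Suc a\<close> entries in
      between, and with the signs of the summands the total exponents differ by an odd
      number.\<close>
    let ?A = "take a ?x" and ?B = "take (b - Suc a) (drop (Suc a) ?x)" and ?C = "drop (Suc b) ?x" and ?w = "?x ! a"
    have x: "?x = ?A @ ?w # ?B @ ?w # ?C"
      by (rule nth_split_two) (use ab ws in auto)
    have oa: "omit a ?x = ?A @ ?B @ ?w # ?C"
      by (subst x) (use ab ws in \<open>simp add: omit_def\<close>)
    have "length (?A @ ?w # ?B) = b"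
      using ab ws by simp
    from omit_middle[of "?A @ ?w # ?B" ?w ?C, unfolded this]
    have ob: "omit b ?x = ?A @ ?w # ?B @ ?C"
      unfolding append_assoc append_Cons x[symmetric] .
    have "length (omit a ?x) = n - 1"
      using ab ws by simp
    then have len: "length (?A @ ?B @ ?w # ?C) = n - 1"
      by (simp only: oa)
    have "length ?B = b - Suc a"
      using ab ws by simp
    then have move: "\<rho> (omit a ?x) v = sgm (int (b - Suc a)) (\<rho> (omit b ?x) v)" for v
      using alternating_move[OF rho_alt len, of v] by (simp only: oa ob)
    have odd: "odd (p - q)" if "p = q + 2 * d - 1" for p q d :: int
      using that by simp
    have "int (n - 1 - a) + int (b - Suc a) = int (n - 1 - b) + 2 * int (b - a) - 1"
      using ab by (simp add: of_nat_diff)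
    then have "odd (int (n - 1 - a) + int (b - Suc a) - int (n - 1 - b))"
      by (rule odd)
    then have "sgm (int (n - 1 - a) + int (b - Suc a)) v = - sgm (int (n - 1 - b)) v" for v :: 'v
      by (rule sgm_odd)
    then show ?thesis
      unfolding move sgm_sgm ab(3) by (simp only: add.left_inverse)
  qed
  finally show ?thesis
    using 1 by (simp add: semibracket_def zero_prod_def)
qed

lemma sum_nested_swap:
  fixes h :: "nat \<Rightarrow> nat \<Rightarrow> 'm::comm_monoid_add"
  shows "(\<Sum>i<n. \<Sum>k\<in>{..<n} - {i}. h i k) = (\<Sum>k<n. \<Sum>i\<in>{..<n} - {k}. h i k)"
  unfolding sum.Sigma[OF finite_lessThan ballI[OF finite_Diff[OF finite_lessThan]]]
  by (rule sum.reindex_bij_witness[where i = prod.swap and j = prod.swap]) auto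

text \<open>The \<gg>-component is the identity for \<open>br\<close>. In the
  \<open>V\<close>-component each summand is linear in a single \<open>V\<close>-component of an
  argument: those with an entry of \<open>X\<close> are matched by \<open>rho_bracket\<close>, those
  with an entry of \<open>Y\<close> by \<open>rho_commutator\<close>.\<close>

theorem semibracket_identity:
  assumes X: "length X = n - 1" and Y: "length Y = n"
  shows "semibracket (X @ [semibracket Y]) = (\<Sum>i<n. semibracket (Y[i := semibracket (X @ [Y ! i])]))"
proof -
  let ?x = "map fst X" and ?y = "map fst Y"
  let ?u = "\<lambda>k. snd (X ! k)" and ?v = "\<lambda>k. snd (Y ! k)"
  let ?S = "\<lambda>k. sgm (int (n - 1 - k))"
  have act_append: "action (X @ [w]) = \<rho> ?x (snd w) + (\<Sum>k<n - 1. ?S k (\<rho> (omit k ?x @ [fst w]) (?u k)))" for w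
  proof -
    have "action (X @ [w]) = (\<Sum>k<Suc (n - 1). ?S k (\<rho> (omit k (?x @ [fst w])) (snd ((X @ [w]) ! k))))"
      unfolding action_def by (rule sum.cong) (use n2 in auto)
    also have "\<dots> = (\<Sum>k<n - 1. ?S k (\<rho> (omit k (?x @ [fst w])) (snd ((X @ [w]) ! k))))
        + \<rho> (omit (n - 1) (?x @ [fst w])) (snd w)"
      using X by (simp add: nth_append)
    also have "omit (n - 1) (?x @ [fst w]) = ?x"
      using X omit_length[of ?x "fst w"] by simp
    also have "(\<Sum>k<n - 1. ?S k (\<rho> (omit k (?x @ [fst w])) (snd ((X @ [w]) ! k))))
        = (\<Sum>k<n - 1. ?S k (\<rho> (omit k ?x @ [fst w]) (?u k)))"
      using X by (intro sum.cong) (auto simp: omit_append nth_append)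
    finally show ?thesis by (simp add: add.commute)
  qed
  let ?b = "\<lambda>i. br (?x @ [?y ! i])"
  have fst_upd: "map fst (Y[i := semibracket (X @ [Y ! i])]) = ?y[i := ?b i]" if "i < n" for i
    using that Y by (simp add: map_update semibracket_def)
  have 1: "br (?x @ [br ?y]) = (\<Sum>i<n. br (map fst (Y[i := semibracket (X @ [Y ! i])])))"
    using br_identity[of ?x ?y] X Y by (simp add: fst_upd)
  have act: "action (Y[i := semibracket (X @ [Y ! i])])
      = ?S i (\<rho> (omit i ?y) (\<rho> ?x (?v i)))
        + (\<Sum>k<n - 1. ?S k (?S i (\<rho> (omit i ?y) (\<rho> (omit k ?x @ [?y ! i]) (?u k)))))
        + (\<Sum>k\<in>{..<n} - {i}. ?S k (\<rho> (omit k (?y[i := ?b i])) (?v k)))" if i: "i < n" for i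
  proof -
    let ?Z = "Y[i := semibracket (X @ [Y ! i])]"
    have "action ?Z = ?S i (\<rho> (omit i (map fst ?Z)) (snd (?Z ! i)))
        + (\<Sum>k\<in>{..<n} - {i}. ?S k (\<rho> (omit k (map fst ?Z)) (snd (?Z ! k))))"
      unfolding action_def using i by (subst sum.remove[of _ i]) auto
    also have "(\<Sum>k\<in>{..<n} - {i}. ?S k (\<rho> (omit k (map fst ?Z)) (snd (?Z ! k))))
        = (\<Sum>k\<in>{..<n} - {i}. ?S k (\<rho> (omit k (?y[i := ?b i])) (?v k)))"
      unfolding fst_upd[OF i] by (intro sum.cong) auto
    also have "snd (?Z ! i) = action (X @ [Y ! i])"
      using i Y by (simp add: semibracket_def)
    also have "omit i (map fst ?Z) = omit i ?y"
      unfolding fst_upd[OF i] by (rule omit_update_same)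
    also have "\<rho> (omit i ?y) (action (X @ [Y ! i])) = \<rho> (omit i ?y) (\<rho> ?x (?v i))
        + (\<Sum>k<n - 1. ?S k (\<rho> (omit i ?y) (\<rho> (omit k ?x @ [?y ! i]) (?u k))))"
      using i Y unfolding act_append by (simp add: rho_add rho_sum rho_sgm)
    finally show ?thesis
      by (simp add: sgm_add sgm_sum sgm_sgm add.commute)
  qed
  \<comment> \<open>This is \<open>rho_commutator\<close> for the list without entry
    \<open>k\<close>; leaving it out shifts the later indices, hence the reindexing.\<close>
  have comm: "(\<Sum>i\<in>{..<n} - {k}. \<rho> (omit k (?y[i := ?b i])) v)
      = \<rho> ?x (\<rho> (omit k ?y) v) - \<rho> (omit k ?y) (\<rho> ?x v)" if k: "k < n" for k v
  proof -
    have "(\<Sum>i\<in>{..<n} - {k}. \<rho> (omit k (?y[i := ?b i])) v)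
        = (\<Sum>i<n - 1. \<rho> ((omit k ?y)[i := br (?x @ [omit k ?y ! i])]) v)"
      unfolding omit_reindex_sum[OF k]
    proof (intro sum.cong refl)
      fix i assume i: "i \<in> {..<n - 1}"
      let ?j = "if i < k then i else Suc i"
      have j: "?j < n" "?j \<noteq> k" "(if ?j < k then ?j else ?j - 1) = i"
        using i k by auto
      have "omit k (?y[?j := ?b ?j]) = (omit k ?y)[i := ?b ?j]"
        using omit_update[of ?j ?y k "?b ?j"] j k Y by simp
      moreover have "?y ! ?j = omit k ?y ! i"
        using nth_omit[of k ?y i] i k Y by simp
      ultimately show "\<rho> (omit k (?y[?j := ?b ?j])) v = \<rho> ((omit k ?y)[i := br (?x @ [omit k ?y ! i])]) v"
        by simp
    qed
    then show ?thesis
      using rho_commutator[of ?x "omit k ?y" v] X Y k by simp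
  qed
  have brk: "(\<Sum>i<n. ?S i (\<rho> (omit i ?y) (\<rho> (omit k ?x @ [?y ! i]) v))) = \<rho> (omit k ?x @ [br ?y]) v"
    if "k < n - 1" for k v
    using rho_bracket[of "omit k ?x" ?y v] that X Y by simp
  have "(\<Sum>i<n. action (Y[i := semibracket (X @ [Y ! i])]))
      = (\<Sum>i<n. ?S i (\<rho> (omit i ?y) (\<rho> ?x (?v i))))
        + (\<Sum>i<n. \<Sum>k<n - 1. ?S k (?S i (\<rho> (omit i ?y) (\<rho> (omit k ?x @ [?y ! i]) (?u k)))))
        + (\<Sum>i<n. \<Sum>k\<in>{..<n} - {i}. ?S k (\<rho> (omit k (?y[i := ?b i])) (?v k)))"
    by (simp add: act sum.distrib)
  also have "(\<Sum>i<n. \<Sum>k<n - 1. ?S k (?S i (\<rho> (omit i ?y) (\<rho> (omit k ?x @ [?y ! i]) (?u k)))))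
      = (\<Sum>k<n - 1. ?S k (\<rho> (omit k ?x @ [br ?y]) (?u k)))"
    by (subst sum.swap) (intro sum.cong refl, simp only: sgm_sum[symmetric] brk lessThan_iff)
  also have "(\<Sum>i<n. \<Sum>k\<in>{..<n} - {i}. ?S k (\<rho> (omit k (?y[i := ?b i])) (?v k)))
      = (\<Sum>k<n. ?S k (\<rho> ?x (\<rho> (omit k ?y) (?v k)) - \<rho> (omit k ?y) (\<rho> ?x (?v k))))"
    by (subst sum_nested_swap) (intro sum.cong refl, simp only: sgm_sum[symmetric] comm lessThan_iff)
  also have "\<dots> = \<rho> ?x (action Y) - (\<Sum>k<n. ?S k (\<rho> (omit k ?y) (\<rho> ?x (?v k))))"
    using X by (simp add: action_def rho_sum rho_sgm sgm_diff sum_subtractf)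
  finally have 2: "(\<Sum>i<n. action (Y[i := semibracket (X @ [Y ! i])])) = action (X @ [semibracket Y])"
    unfolding act_append by (simp add: semibracket_def)
  show ?thesis
    using 1 2 by (simp add: prod_eq_iff fst_sum snd_sum semibracket_def)
qed

section \<open>The cochain \<open>\<mu> + \<rho>\<close>: closure, filtration and vanishing
  square\<close>

lemma semidirect_Nil [simp]: "\<Delta> [] = 0"
  by (simp add: fun_eq_iff semidirect_cochain_eq blocks_def)

lemma semidirect_single: "length X = n - 1 \<Longrightarrow> \<Delta> [X] x = semibracket (X @ [x])"
  by (simp add: semidirect_cochain_eq blocks_def)

lemma semidirect_bad: "length X \<noteq> n - 1 \<Longrightarrow> \<Delta> [X] = 0"
  by (simp add: fun_eq_iff semidirect_cochain_eq blocks_def)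

lemma semidirect_two [simp]: "\<Delta> (X # Y # Zs) = 0"
  by (simp add: fun_eq_iff semidirect_cochain_eq blocks_def)

lemma semidirect_homog: "homog 1 \<Delta>"
  by (auto simp: homog_def fun_eq_iff semidirect_cochain_eq blocks_def)

lemma semidirect_closed: "\<Delta> \<in> CW"
proof (rule W.all_cochains_contrI)
  have bad: "contr X \<Delta> = 0" if "length X \<noteq> n - 1 \<or> \<not> distinct X" for X
  proof -
    have *: "\<Delta> [X] x = 0" for x
    proof (cases "length X = n - 1")
      case True
      then show ?thesis
        using that n2 semibracket_not_distinct[of "X @ [x]"] by (simp add: semidirect_single)
    qed (simp add: semidirect_bad)
    show ?thesis
    proof (intro ext)
      fix Xs x
      show "contr X \<Delta> Xs x = 0 Xs x"
        by (cases Xs) (simp_all add: contr_def *)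
    qed
  qed
  have slot: "contr (X[j := sw c y + z]) \<Delta> = scale_cochain sw c (contr (X[j := y]) \<Delta>) + contr (X[j := z]) \<Delta>"
    if "length X = n - 1" "j < n - 1" for X j c y z
  proof (intro ext)
    fix Xs x
    show "contr (X[j := sw c y + z]) \<Delta> Xs x
        = (scale_cochain sw c (contr (X[j := y]) \<Delta>) + contr (X[j := z]) \<Delta>) Xs x"
    proof (cases Xs)
      case Nil
      have "(X @ [x])[j := w] = X[j := w] @ [x]" for w
        using that by (simp add: list_update_append)
      then show ?thesis
        using Nil that semibracket_slot[of "X @ [x]" j c y z] n2
        by (simp add: contr_def semidirect_single scale_cochain_def)
    qed (simp add: contr_def scale_cochain_def)
  qed
  have last: "\<Delta> [X] x = 0" if "x \<in> set X" for X x
    using that semibracket_not_distinct[of "X @ [x]"] n2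
    by (cases "length X = n - 1") (simp_all add: semidirect_single semidirect_bad)
  show "first_block_ok n sw sw \<Delta>"
    unfolding first_block_ok_def W.linear_iff
  proof (intro conjI allI impI)
    show "\<Delta> [] (sw c y + z) = sw c (\<Delta> [] y) + \<Delta> [] z" for c y z
      by simp
  qed (use bad slot last in blast)+
  show "contr X \<Delta> \<in> CW" for X
  proof (rule W.all_cochains_contrI)
    have zero: "contr Y (contr X \<Delta>) = 0" for Y
      by (simp add: contr_def fun_eq_iff)
    then show "contr Y (contr X \<Delta>) \<in> CW" for Y
      by simp
    have "contr X \<Delta> [] (sw c y + z) = sw c (contr X \<Delta> [] y) + contr X \<Delta> [] z" for c y z
    proof (cases "length X = n - 1")
      case True
      have "(X @ [w])[n - 1 := w'] = X @ [w']" for w w'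
        using True by (simp add: list_update_append)
      then show ?thesis
        using True semibracket_slot[of "X @ [y]" "n - 1" c y z] n2
        by (simp add: contr_def semidirect_single)
    qed (simp add: contr_def semidirect_bad)
    then show "first_block_ok n sw sw (contr X \<Delta>)"
      unfolding first_block_ok_def zero by (simp add: W.linear_iff W.scale_cochain_zero) (simp add: contr_def)
  qed
qed

text \<open>There are only \<open>n\<close> arguments in total, and each summand of the action
  contains the \<open>V\<close>-component of one of them, so it vanishes if all \<open>n\<close>
  come from \<gg>.\<close>

lemma semidirect_filtered: "filtered (int n) \<Delta>"
  unfolding filtered_def
proof (intro allI)
  fix Xs and x :: "'g \<times> 'v"
  show "(int n < g_count (concat Xs @ [x]) \<longrightarrow> \<Delta> Xs x = 0) \<and>
      (int n \<le> g_count (concat Xs @ [x]) \<longrightarrow> snd (\<Delta> Xs x) = 0)"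
  proof (cases "Xs \<in> blocks n 1")
    case True
    then obtain X where Xs: "Xs = [X]" "length X = n - 1"
      by (auto simp: blocks_def length_Suc_conv)
    let ?ws = "X @ [x]"
    have len: "length ?ws = n" using Xs n2 by simp
    have "length (filter (\<lambda>w. snd w = 0) ?ws) \<le> length ?ws"
      by (rule length_filter_le)
    then have le: "g_count ?ws \<le> int n"
      using len by (simp only: g_count_def of_nat_le_iff)
    have "action ?ws = 0" if "int n \<le> g_count ?ws"
    proof -
      have "length (filter (\<lambda>w. snd w = 0) ?ws) = length ?ws"
        using that le len by (simp only: g_count_def)
      then have all: "snd w = 0" if "w \<in> set ?ws" for w
        using length_filter_less[OF that, of "\<lambda>w. snd w = 0"] by (cases "snd w = 0") simp_all
      have "snd (?ws ! i) = 0" if "i < n" for i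
        by (rule all, rule nth_mem) (simp only: len that)
      then show ?thesis
        using len by (simp add: action_def rho_zero)
    qed
    then show ?thesis
      using le Xs by (simp add: semidirect_single semibracket_def)
  qed (simp add: semidirect_cochain_eq)
qed

text \<open>The square has degree 2, and its value on two blocks is the right side of
  \<open>semibracket_identity\<close> minus the left side.\<close>

lemma semidirect_star: "star n \<Delta> \<Delta> = 0"
proof -
  have "star n \<Delta> \<Delta> [X, Y] z = 0" if X: "length X = n - 1" and Y: "length Y = n - 1" for X Y z
  proof -
    have "semibracket (X @ [semibracket (Y @ [z])]) = (\<Sum>i<Suc (n - 1). semibracket ((Y @ [z])[i := semibracket (X @ [(Y @ [z]) ! i])]))"
      using semibracket_identity[of X "Y @ [z]"] X Y n2 by simp
    also have "\<dots> = (\<Sum>i<n - 1. semibracket (Y[i := semibracket (X @ [Y ! i])] @ [z])) + semibracket (Y @ [semibracket (X @ [z])])"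
      using Y by (simp add: nth_append list_update_append)
    finally have id: "semibracket (X @ [semibracket (Y @ [z])])
        = (\<Sum>i<n - 1. semibracket (Y[i := semibracket (X @ [Y ! i])] @ [z])) + semibracket (Y @ [semibracket (X @ [z])])" .
    have c: "contr X \<Delta> [] w = semibracket (X @ [w])" for w
      using X by (simp add: contr_def semidirect_single)
    have cX: "contr X \<Delta> \<in> CW" "contr Y (contr X \<Delta>) = 0" "contr Y \<Delta> \<in> CW" for Y
      using W.all_cochains_contr[OF semidirect_closed] by (simp_all add: contr_def fun_eq_iff)
    have alt: "altsign \<Delta> = - \<Delta>" "altsign (contr X \<Delta>) [] = contr X \<Delta> []"
      using homog_altsign[OF semidirect_homog] by (simp_all add: sgm_def altsign_Nil)
    \<comment> \<open>The minus sign comes from the odd degree of \<open>\<Delta>\<close>; the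
      insertion term drops out because \<open>\<Delta> [] = 0\<close>.\<close>
    have "contr X (star n \<Delta> \<Delta>) = star n \<Delta> (contr X \<Delta>) - star n (contr X \<Delta>) \<Delta>"
      by (simp add: contr_star alt(1) W.star_uminus_right cX W.insert_block_zero semidirect_closed)
    then have "star n \<Delta> \<Delta> [X, Y] z = star n \<Delta> (contr X \<Delta>) [Y] z - star n (contr X \<Delta>) \<Delta> [Y] z"
      by (metis contr_apply minus_apply)
    also have "star n \<Delta> (contr X \<Delta>) [Y] z = \<Delta> [Y] (contr X \<Delta> [] z) + (\<Sum>i<n - 1. \<Delta> [Y[i := contr X \<Delta> [] (Y ! i)]] z)"
      by (simp add: star.simps(2) cX(2) alt(2) contr_apply)
    also have "star n (contr X \<Delta>) \<Delta> [Y] z = contr X \<Delta> [] (\<Delta> [Y] z)"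
      by (simp add: star.simps(2) cX(2) contr_apply)
    finally have "star n \<Delta> \<Delta> [X, Y] z = \<Delta> [Y] (contr X \<Delta> [] z)
        + (\<Sum>i<n - 1. \<Delta> [Y[i := contr X \<Delta> [] (Y ! i)]] z) - contr X \<Delta> [] (\<Delta> [Y] z)" .
    also have "\<dots> = 0"
      using id Y by (simp add: c semidirect_single)
    finally show ?thesis .
  qed
  moreover have "star n \<Delta> \<Delta> \<in> CW" "homog 2 (star n \<Delta> \<Delta>)"
    using W.star_closed[OF semidirect_closed semidirect_closed]
      W.homog_star[OF semidirect_closed semidirect_homog semidirect_homog] by simp_all
  ultimately have "star n \<Delta> \<Delta> Xs z = 0" for Xs z
  proof (cases "int (length Xs) = 2")
    case True
    then obtain X Y where Xs: "Xs = [X, Y]"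
      by (auto simp: length_Suc_conv numeral_2_eq_2)
    show ?thesis
    proof (cases "length X = n - 1 \<and> length Y = n - 1")
      case False
      then have "star n \<Delta> \<Delta> Xs = 0"
        using W.all_cochains_outside[OF \<open>star n \<Delta> \<Delta> \<in> CW\<close>, of Xs] Xs by auto
      then show ?thesis by simp
    qed (use Xs \<open>\<And>X Y z. length X = n - 1 \<Longrightarrow> length Y = n - 1 \<Longrightarrow> star n \<Delta> \<Delta> [X, Y] z = 0\<close> in simp)
  qed (simp add: homog_def)
  then show ?thesis by (simp add: fun_eq_iff)
qed

lemma semidirect_bracket: "W.bracket \<Delta> \<Delta> = 0"
  unfolding W.bracket_homog_eq[OF semidirect_closed semidirect_homog semidirect_closed semidirect_homog]
  by (simp add: semidirect_star)

end

section \<open>The Lie n-algebra and its Maurer-Cartan elements\<close>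

context cochain_algebra
begin

lemma sum_const_scale: "(\<Sum>i\<in>A. y) = s (of_nat (card A)) y"
  by (induction A rule: infinite_finite_induct) (simp_all add: scale_left_distrib)

end

text \<open>Cochains of different degrees are supported on lists of different lengths, so their sum
  is direct.\<close>

lemma (in cochain_space) graded_vector_space_cochains:
  "graded_vector_space (scale_cochain sB) (cochain_grading n sA sB)"
  unfolding graded_vector_space_def
proof (intro conjI allI impI ballI)
  show "vector_space (scale_cochain sB :: 'k \<Rightarrow> ('a list list \<Rightarrow> 'a \<Rightarrow> 'b) \<Rightarrow> _)"
    by unfold_locales (auto simp: scale_cochain_def fun_eq_iff B.scale_right_distrib B.scale_left_distrib)
  show "module.subspace (scale_cochain sB) (cochain_grading n sA sB m)" for m
    unfolding cochain_grading_eq by (rule all_cochains_subspace)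
next
  fix M and F :: "int \<Rightarrow> 'a list list \<Rightarrow> 'a \<Rightarrow> 'b" and m
  assume M: "finite M \<and> (\<forall>m\<in>M. F m \<in> cochain_grading n sA sB m) \<and> sum F M = 0" and m: "m \<in> M"
  then have hom: "homog k (F k)" if "k \<in> M" for k
    using that by (simp add: cochain_grading_eq)
  show "F m = 0"
  proof (intro ext)
    fix Xs x
    show "F m Xs x = 0 Xs x"
    proof (cases "int (length Xs) = m")
      case True
      have "F k Xs = 0" if "k \<in> M" "k \<noteq> m" for k
        using hom[OF that(1)] that(2) True by (simp add: homog_def)
      then have "(\<Sum>k\<in>M. F k Xs x) = (\<Sum>k\<in>{m}. F k Xs x)"
        using M m by (intro sum.mono_neutral_right) auto
      moreover have "(\<Sum>k\<in>M. F k Xs x) = 0"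
        using M by (simp flip: sum_apply2)
      ultimately show ?thesis by simp
    next
      case False
      then show ?thesis using hom[OF m] by (simp add: homog_def)
    qed
  qed
qed

lemma (in cochain_space) graded_total_cochains:
  "graded_total (scale_cochain sB) (cochain_grading n sA sB) \<subseteq> \<C>"
proof -
  interpret S: vector_space "scale_cochain sB :: 'k \<Rightarrow> ('a list list \<Rightarrow> 'a \<Rightarrow> 'b) \<Rightarrow> _"
    using graded_vector_space_cochains by (simp add: graded_vector_space_def)
  have "S.subspace \<C>"
    by (rule S.subspaceI) (simp_all add: all_cochains_add all_cochains_scale)
  then show ?thesis
    unfolding graded_total_def by (intro S.span_minimal) (auto simp: cochain_grading_eq)
qed

text \<open>Double counting of pairs of a set and one of its elements: a set of size
  \<open>Suc k\<close> arises once from the removal of each of its elements.\<close>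

lemma sum_insert_subsets:
  fixes h :: "'a set \<Rightarrow> 'm::comm_monoid_add"
  assumes "finite A"
  shows "(\<Sum>i\<in>A. \<Sum>S\<in>{S. S \<subseteq> A \<and> card S = k \<and> i \<notin> S}. h (insert i S))
    = (\<Sum>S\<in>{S. S \<subseteq> A \<and> card S = Suc k}. \<Sum>i\<in>S. h S)" (is "(\<Sum>i\<in>A. \<Sum>S\<in>?P i. _) = (\<Sum>S\<in>?Q. _)")
proof -
  have fin: "finite (?P i)" "finite ?Q" for i
    by (rule finite_subset[of _ "Pow A"]; use assms in auto)+
  have fS: "finite S" if "S \<subseteq> A" for S
    using that assms by (rule finite_subset)
  have "(\<Sum>i\<in>A. \<Sum>S\<in>?P i. h (insert i S)) = (\<Sum>(i, S)\<in>Sigma A ?P. h (insert i S))"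
    using assms fin by (intro sum.Sigma) auto
  also have "\<dots> = (\<Sum>(S, i)\<in>Sigma ?Q (\<lambda>S. S). h S)"
    by (rule sum.reindex_bij_witness[where j = "\<lambda>(i, S). (insert i S, i)" and i = "\<lambda>(S, i). (i, S - {i})"])
      (use fS in \<open>auto simp: card_insert_if card_Diff_singleton_if insert_absorb\<close>)
  also have "\<dots> = (\<Sum>S\<in>?Q. \<Sum>i\<in>S. h S)"
    using fin fS by (intro sum.Sigma[symmetric]) auto
  finally show ?thesis .
qed

section \<open>The axioms of a Lie n-algebra for the derived bracket\<close>

locale nlie_rep_char_0 = nlie_rep sg sv n br \<rho>
  for sg :: "'k::field_char_0 \<Rightarrow> 'g::ab_group_add \<Rightarrow> 'g" and sv :: "'k \<Rightarrow> 'v::ab_group_add \<Rightarrow> 'v"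
    and n :: nat and br :: "'g list \<Rightarrow> 'g" and \<rho> :: "'g list \<Rightarrow> 'v \<Rightarrow> 'v"
begin

abbreviation "iterated \<equiv> iterated_bracket n sg br sv \<rho>"
abbreviation "derived \<equiv> derived_bracket n sg br sv \<rho>"
abbreviation "grading \<equiv> cochain_grading n sv sg"

definition lifts where "lifts Ps ds = zip (map lift_cochain Ps) ds"

lemma iterated_eq: "iterated Ps = foldl W.bracket \<Delta> (map lift_cochain Ps)"
  by (simp add: iterated_bracket_def)

lemma derived_eq: "derived Ps = restrict_cochain (iterated Ps)"
  by (simp add: derived_bracket_def)

lemma lifts_iterated: "length Ps = length ds \<Longrightarrow> W.iter_bracket \<Delta> (lifts Ps ds) = iterated Ps"
  by (simp add: W.iter_bracket_def lifts_def iterated_eq)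

lemma lifts_homogs:
  "list_all2 (\<lambda>P d. P \<in> grading d) Ps ds \<Longrightarrow> W.homogs (lifts Ps ds)"
  by (auto simp: lifts_def VG.cochain_grading_eq list_all2_conv_all_nth set_zip lift_closed lift_homog)

lemma grading_CV: "list_all2 (\<lambda>P d. P \<in> grading d) Ps ds \<Longrightarrow> set Ps \<subseteq> CV"
  by (auto simp: VG.cochain_grading_eq list_all2_conv_all_nth in_set_conv_nth)

lemma iterated_closed: "set Ps \<subseteq> CV \<Longrightarrow> iterated Ps \<in> CW"
  unfolding iterated_eq using lift_closed by (intro W.foldl_bracket_closed semidirect_closed) auto

lemma iterated_filtered:
  assumes "set Ps \<subseteq> CV"
  shows "filtered (int n - int (length Ps)) (iterated Ps)"
proof -
  \<comment> \<open>The degree 0 is a placeholder: the filtration statement concerns the first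
    components only.\<close>
  let ?zs = "map (\<lambda>P. (lift_cochain P, 0 :: int)) Ps"
  have "filtered (int n - int (length ?zs)) (W.iter_bracket \<Delta> ?zs)"
    by (rule filtered_iter_bracket[OF semidirect_closed semidirect_filtered])
      (use assms in \<open>auto simp: lift_closed filtered_lift\<close>)
  then show ?thesis
    by (simp add: W.iter_bracket_def iterated_eq o_def)
qed

text \<open>After \<open>n\<close> brackets the filtration has dropped from \<open>n\<close> to 0,
  so the iterated bracket is determined by its restriction.\<close>

lemma iterated_lift:
  assumes "set Ps \<subseteq> CV" "length Ps = n"
  shows "iterated Ps = lift_cochain (derived Ps)"
  unfolding derived_eq
  by (rule filtered_0_lift[OF iterated_closed]) (use assms iterated_filtered[of Ps] in auto)

lemma iterated_homog:
  assumes "list_all2 (\<lambda>P d. P \<in> grading d) Ps ds"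
  shows "homog (sum_list ds + 1) (iterated Ps)"
proof -
  have len: "length Ps = length ds"
    using assms by (rule list_all2_lengthD)
  have "homog (1 + sum_list (map snd (lifts Ps ds))) (W.iter_bracket \<Delta> (lifts Ps ds))"
    by (rule W.iter_bracket_homog[OF semidirect_closed semidirect_homog lifts_homogs[OF assms]])
  then show ?thesis
    using len by (simp add: lifts_iterated) (simp add: lifts_def add.commute)
qed

lemma derived_grading:
  assumes "list_all2 (\<lambda>P d. P \<in> grading d) Ps ds"
  shows "derived Ps \<in> grading (sum_list ds + 1)"
  using restrict_closed[OF iterated_closed[OF grading_CV[OF assms]]] restrict_homog[OF iterated_homog[OF assms]]
  by (simp add: VG.cochain_grading_eq derived_eq)

lemma derived_slot:
  assumes "set Ps \<subseteq> CV" "P \<in> CV" "Q \<in> CV" "i < length Ps"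
  shows "derived (Ps[i := scale_cochain sg c P + Q])
    = scale_cochain sg c (derived (Ps[i := P])) + derived (Ps[i := Q])"
proof -
  have "foldl W.bracket \<Delta> ((map lift_cochain Ps)[i := scale_cochain sw c (lift_cochain P) + lift_cochain Q])
    = scale_cochain sw c (foldl W.bracket \<Delta> ((map lift_cochain Ps)[i := lift_cochain P]))
      + foldl W.bracket \<Delta> ((map lift_cochain Ps)[i := lift_cochain Q])"
    by (rule W.foldl_bracket_slot) (use assms lift_closed semidirect_closed in auto)
  then show ?thesis
    by (simp add: derived_eq iterated_eq map_update lift_add lift_scale restrict_add restrict_scale)
qed

lemma derived_symmetric:
  assumes "list_all2 (\<lambda>P d. P \<in> grading d) Ps ds" "\<sigma> permutes {..<length Ps}"
  shows "derived Ps = scale_cochain sg (of_int (koszul_sign \<sigma> ds)) (derived (permute_list \<sigma> Ps))"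
proof -
  have len: "length Ps = length ds"
    using assms(1) by (rule list_all2_lengthD)
  let ?zs = "lifts Ps ds"
  have fst: "map fst ?zs = map lift_cochain Ps" and snd: "map snd ?zs = ds" and lz: "length ?zs = length Ps"
    using len by (simp_all add: lifts_def)
  have L: "fst z \<in> CW \<and> filtered 0 (fst z)" if "z \<in> set ?zs" for z
  proof -
    have "fst z \<in> set (map lift_cochain Ps)"
      using that unfolding fst[symmetric] by simp
    then show ?thesis
      using grading_CV[OF assms(1)] by (auto simp: lift_closed filtered_lift)
  qed
  have "W.iter_bracket \<Delta> ?zs
      = scale_cochain sw (of_int (koszul_sign \<sigma> (map snd ?zs))) (W.iter_bracket \<Delta> (permute_list \<sigma> ?zs))"
    by (rule W.iter_bracket_permute[OF semidirect_closed semidirect_homog lifts_homogs[OF assms(1)]])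
      (use L bracket_filtered_0 assms(2) lz in auto)
  moreover have "W.iter_bracket \<Delta> (permute_list \<sigma> ?zs) = iterated (permute_list \<sigma> Ps)"
    unfolding W.iter_bracket_def iterated_eq using assms(2) lz fst
    by (simp flip: permute_list_map)
  ultimately show ?thesis
    unfolding snd lifts_iterated[OF len] by (simp add: derived_eq restrict_scale)
qed

lemma restrict_sum_list: "restrict_cochain (\<Sum>t\<leftarrow>ts. f t) = (\<Sum>t\<leftarrow>ts. restrict_cochain (f t) :: 'v list list \<Rightarrow> 'v \<Rightarrow> 'g)"
proof -
  have "fst (\<Sum>t\<leftarrow>ts. h t) = (\<Sum>t\<leftarrow>ts. fst (h t))" for h :: "_ \<Rightarrow> 'g \<times> 'v"
    by (induction ts) simp_all
  then show ?thesis
    by (simp add: restrict_cochain_def fun_eq_iff sum_list_apply2)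
qed

text \<open>The inner bracket has exactly \<open>n\<close> entries, so by
  \<open>iterated_lift\<close> restricting it and lifting it again loses nothing. The sum is
  therefore the restriction of the one in \<open>derived_bracket_identity\<close> with
  \<open>N = n\<close>.\<close>

lemma derived_identity:
  assumes Ps: "list_all2 (\<lambda>P d. P \<in> grading d) Ps ds" and len: "length Ps = 2 * n - 1"
  shows "(\<Sum>\<sigma>\<in>shuffle_perms n (n - 1). scale_cochain sg (of_int (koszul_sign \<sigma> ds))
    (let Qs = permute_list \<sigma> Ps in derived (derived (take n Qs) # drop n Qs))) = 0"
proof -
  let ?zs = "lifts Ps ds"
  have lds: "length Ps = length ds"
    using Ps by (rule list_all2_lengthD)
  have fst: "map fst ?zs = map lift_cochain Ps" and snd: "map snd ?zs = ds"
    and lz: "length ?zs = n + (n - 1)"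
    using len lds by (simp_all add: lifts_def)
  let ?L = "{F \<in> CW. filtered 0 F}"
  have LS: "fst ` set ?zs \<subseteq> ?L"
  proof -
    have "fst ` set ?zs = set (map lift_cochain Ps)"
      unfolding fst[symmetric] by simp
    then show ?thesis
      using grading_CV[OF Ps] by (auto simp: lift_closed filtered_lift)
  qed
  have filt: "W.iter_bracket \<Delta> ys \<in> CW \<and> filtered (int n - int (length ys)) (W.iter_bracket \<Delta> ys)"
    if "W.homogs ys" "fst ` set ys \<subseteq> ?L" for ys
    using that by (intro conjI W.iter_bracket_closed filtered_iter_bracket semidirect_closed semidirect_filtered) auto
  let ?t = "\<lambda>I J. W.iter_bracket \<Delta> ((W.iter_bracket \<Delta> I, sum_list (map snd I) + 1) # J)"
  have zero: "(\<Sum>(e, I, J)\<leftarrow>filter (\<lambda>(e, I, J). length I = n) (splits snd ?zs). sgm e (?t I J)) = 0"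
  proof (rule W.derived_bracket_identity[where L = ?L])
    show "W.iter_bracket \<Delta> ys \<in> ?L" if "W.homogs ys" "fst ` set ys \<subseteq> ?L" "length ys = n" for ys
      using filt[OF that(1,2)] that(3) by simp
    show "W.iter_bracket \<Delta> ys = 0" if "W.homogs ys" "fst ` set ys \<subseteq> ?L" "length ys > n" for ys
      using filt[OF that(1,2)] that(3) by (auto intro: filtered_neg)
  qed (use semidirect_closed semidirect_homog semidirect_bracket lifts_homogs[OF Ps] LS lz n2 bracket_filtered_0 in auto)
  let ?g = "\<lambda>c I J. scale_cochain sg (of_int c) (restrict_cochain (?t I J)) :: 'v list list \<Rightarrow> 'v \<Rightarrow> 'g"
  have "(\<Sum>\<sigma>\<in>shuffle_perms n (n - 1). scale_cochain sg (of_int (koszul_sign \<sigma> ds))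
      (let Qs = permute_list \<sigma> Ps in derived (derived (take n Qs) # drop n Qs)))
    = (\<Sum>\<sigma>\<in>shuffle_perms n (n - 1). ?g (koszul_sign \<sigma> (map snd ?zs))
        (take n (permute_list \<sigma> ?zs)) (drop n (permute_list \<sigma> ?zs)))"
  proof (rule sum.cong[OF refl])
    fix \<sigma> assume "\<sigma> \<in> shuffle_perms n (n - 1)"
    then have \<sigma>: "\<sigma> permutes {..<length ?zs}" "\<sigma> permutes {..<length Ps}"
      using shuffle_perms_permutes[of \<sigma> n "n - 1"] lz len n2 by (simp_all add: mult_2)
    let ?Qs = "permute_list \<sigma> Ps" and ?ys = "permute_list \<sigma> ?zs"
    have ys: "map fst ?ys = map lift_cochain ?Qs"
      using \<sigma> fst by (simp flip: permute_list_map)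
    have Qs: "set (take n ?Qs) \<subseteq> CV" "length (take n ?Qs) = n"
      using grading_CV[OF Ps] set_take_subset[of n ?Qs] set_permute_list[OF \<sigma>(2)] len n2 by auto
    have "W.iter_bracket \<Delta> (take n ?ys) = iterated (take n ?Qs)"
      by (simp add: W.iter_bracket_def iterated_eq ys flip: take_map)
    also have "\<dots> = lift_cochain (derived (take n ?Qs))"
      by (rule iterated_lift[OF Qs])
    finally have "?t (take n ?ys) (drop n ?ys) = iterated (derived (take n ?Qs) # drop n ?Qs)"
      by (simp add: W.iter_bracket_def iterated_eq ys flip: drop_map)
    then show "scale_cochain sg (of_int (koszul_sign \<sigma> ds))
        (let Qs = ?Qs in derived (derived (take n Qs) # drop n Qs))
      = ?g (koszul_sign \<sigma> (map snd ?zs)) (take n ?ys) (drop n ?ys)"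
      by (simp only: Let_def derived_eq[of "derived (take n ?Qs) # drop n ?Qs"] snd)
  qed
  also have "\<dots> = (\<Sum>(e, I, J)\<leftarrow>filter (\<lambda>(e, I, J). length I = n) (splits snd ?zs). ?g (koszul_exp e) I J)"
    by (rule sum_shuffle_perms[OF lz])
  also have "\<dots> = restrict_cochain (\<Sum>(e, I, J)\<leftarrow>filter (\<lambda>(e, I, J). length I = n) (splits snd ?zs). sgm e (?t I J))"
  proof -
    have r: "?g (koszul_exp e) I J = restrict_cochain (sgm e (?t I J))" for e I J
      by (simp add: fun_eq_iff scale_cochain_def restrict_cochain_def G.scale_koszul_exp sgm_def)
    show ?thesis
      by (simp only: restrict_sum_list case_prod_unfold r)
  qed
  finally show ?thesis
    unfolding zero restrict_zero .
qed

theorem lie_n_algebra_derived: "lie_n_algebra n (scale_cochain sg) grading derived"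
  unfolding lie_n_algebra_def
proof (intro conjI allI impI)
  show "graded_vector_space (scale_cochain sg) grading"
    by (rule VG.graded_vector_space_cochains)
next
  fix xs and y z :: "'v list list \<Rightarrow> 'v \<Rightarrow> 'g" and c :: 'k and i
  assume "length xs = n \<and> set xs \<subseteq> graded_total (scale_cochain sg) grading \<and> i < n \<and>
    y \<in> graded_total (scale_cochain sg) grading \<and> z \<in> graded_total (scale_cochain sg) grading"
  then have xs: "set xs \<subseteq> CV" "y \<in> CV" "z \<in> CV" "i < length xs"
    using VG.graded_total_cochains by auto
  have one: "scale_cochain sg 1 P = P" for P :: "'v list list \<Rightarrow> 'v \<Rightarrow> 'g"
    by (simp add: scale_cochain_def)
  have zero: "derived (xs[i := 0]) = 0"
    using derived_slot[OF xs(1) _ _ xs(4), of 0 0 1] by (simp add: one)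
  show "derived (xs[i := y + z]) = derived (xs[i := y]) + derived (xs[i := z])"
    using derived_slot[OF xs(1,2,3,4), of 1] by (simp only: one)
  show "derived (xs[i := scale_cochain sg c y]) = scale_cochain sg c (derived (xs[i := y]))"
    using derived_slot[OF xs(1,2) _ xs(4), of 0 c] zero by simp
next
  show "derived xs \<in> grading (sum_list ds + 1)"
    if "length xs = n \<and> list_all2 (\<lambda>x d. x \<in> grading d) xs ds" for xs ds
    using that derived_grading by blast
next
  show "derived xs = scale_cochain sg (of_int (koszul_sign \<sigma> ds)) (derived (permute_list \<sigma> xs))"
    if "length xs = n \<and> list_all2 (\<lambda>x d. x \<in> grading d) xs ds \<and> \<sigma> permutes {..<n}" for xs ds \<sigma>
    using that derived_symmetric by blast
next
  show "(\<Sum>\<sigma>\<in>shuffle_perms n (n - 1). scale_cochain sg (of_int (koszul_sign \<sigma> ds))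
      (let ys = permute_list \<sigma> xs in derived (derived (take n ys) # drop n ys))) = 0"
    if "length xs = 2 * n - 1 \<and> list_all2 (\<lambda>x d. x \<in> grading d) xs ds" for xs ds
    using that derived_identity by blast
qed

text \<open>
  The formula for the \<open>k\<close>-fold bracket in \<open>iterated_replicate\<close> is the binomial expansion of the
  \<open>k\<close>-th power of \<open>D\<^sub>1 + \<dots> + D\<^sub>n - L\<close>, where \<open>D\<^sub>i\<close> applies \<open>T\<close> to the \<open>i\<close>-th argument and \<open>L\<close> to
  the value; these operators commute and square to 0.
\<close>

definition apply_on :: "('v \<Rightarrow> 'g) \<Rightarrow> nat set \<Rightarrow> ('g \<times> 'v) list \<Rightarrow> ('g \<times> 'v) list"
  where "apply_on T S ws = map (\<lambda>i. if i \<in> S then (T (snd (ws ! i)), 0) else ws ! i) [0..<length ws]"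

lemma length_apply_on [simp]: "length (apply_on T S ws) = length ws"
  and nth_apply_on: "i < length ws \<Longrightarrow> apply_on T S ws ! i = (if i \<in> S then (T (snd (ws ! i)), 0) else ws ! i)"
  by (simp_all add: apply_on_def)

lemma apply_on_empty [simp]: "apply_on T {} ws = ws"
  by (simp add: apply_on_def map_nth)

lemma apply_on_insert:
  "i < length ws \<Longrightarrow> i \<notin> S \<Longrightarrow> apply_on T S (ws[i := (T (snd (ws ! i)), 0)]) = apply_on T (insert i S) ws"
  by (rule nth_equalityI) (auto simp: nth_apply_on nth_list_update)

lemma semibracket_zero_slot:
  assumes "length ws = n" "i < n" "ws ! i = 0"
  shows "semibracket ws = 0"
proof -
  have "ws[i := sw 1 0 + 0] = ws[i := 0]" "ws[i := 0] = ws"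
    using assms by (simp_all add: list_update_same_conv)
  then have "semibracket ws = semibracket ws + semibracket ws"
    using semibracket_slot[OF assms(1,2), of 1 0 0] by (simp only: W.scale_one)
  then show ?thesis by simp
qed

section \<open>Maurer-Cartan elements and relative Rota-Baxter operators\<close>

context
  fixes T :: "'v \<Rightarrow> 'g"
  assumes T: "Vector_Spaces.linear sv sg T"
begin

abbreviation "tau \<equiv> linear_map_cochain T"

definition T_hat :: "'g \<times> 'v \<Rightarrow> 'g \<times> 'v" where "T_hat w = (T (snd w), 0)"

lemma T_rules: "T (v + w) = T v + T w" "T 0 = 0" "T (sv c v) = sg c (T v)" "T (- v) = - T v"
  "T (\<Sum>i\<in>A. f i) = (\<Sum>i\<in>A. T (f i))"
  using T unfolding linear_iff_module_hom
  by (simp_all add: module_hom.add module_hom.zero module_hom.scale module_hom.neg module_hom.sum)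

lemma T_sgm: "T (sgm d v) = sgm d (T v)"
  by (simp add: sgm_def T_rules)

lemma T_hat_rules: "T_hat (v + w) = T_hat v + T_hat w" "T_hat (sw c v) = sw c (T_hat v)" "T_hat (T_hat v) = 0" "T_hat 0 = 0"
  "T_hat (v - w) = T_hat v - T_hat w"
  using T_rules(1)[of "snd v" "- snd w"]
  by (simp_all add: T_hat_def T_rules sw_eq zero_prod_def)

lemma T_hat_sum: "T_hat (\<Sum>i\<in>A. f i) = (\<Sum>i\<in>A. T_hat (f i))"
  by (induction A rule: infinite_finite_induct) (simp_all add: T_hat_rules)

lemma tau_grading: "tau \<in> grading 0"
proof -
  have "Vector_Spaces.linear sv sg (\<lambda>y. 0)"
    by (simp add: VG.linear_iff)
  then have "tau \<in> cochains n sv sg 0"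
    using T by (auto simp: cochains_def blocks_def linear_map_cochain_def)
  then show ?thesis by (simp add: cochain_grading_def)
qed

lemma lift_tau: "lift_cochain tau [] = T_hat" "contr X (lift_cochain tau) = 0"
  by (simp_all add: lift_cochain_def linear_map_cochain_def T_hat_def fun_eq_iff contr_def zero_prod_def)

text \<open>The \<open>k\<close>-th elementary symmetric function of the operators
  \<open>D\<^sub>i\<close>, applied to the semidirect bracket. As these commute and square to 0, it
  is the divided power of their sum: the \<open>k\<close>-th power divided by
  \<open>k!\<close>.\<close>

definition subset_sum :: "nat \<Rightarrow> ('g \<times> 'v) list \<Rightarrow> 'g \<times> 'v"
  where "subset_sum k ws = (\<Sum>S\<in>{S. S \<subseteq> {..<n} \<and> card S = k}. semibracket (apply_on T S ws))"

text \<open>The divided power of exponent \<open>k - 1\<close>, which accompanies the single factor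
  \<open>L\<close> in the expansion; for \<open>k = 0\<close> there is no such term.\<close>

definition subset_sum' :: "nat \<Rightarrow> ('g \<times> 'v) list \<Rightarrow> 'g \<times> 'v"
  where "subset_sum' k ws = (case k of 0 \<Rightarrow> 0 | Suc k \<Rightarrow> subset_sum k ws)"

lemma subset_sum'_Suc: "subset_sum' (Suc k) ws = subset_sum k ws"
  by (simp add: subset_sum'_def)

text \<open>Multiplication of an elementary symmetric function by the sum of all
  \<open>D\<^sub>i\<close>: a repeated index gives 0, and every set of size \<open>Suc k\<close> is
  reached from \<open>Suc k\<close> smaller sets.\<close>

lemma subset_sum_step:
  assumes ws: "length ws = n"
  shows "(\<Sum>i<n. subset_sum k (ws[i := T_hat (ws ! i)])) = sw (of_nat (Suc k)) (subset_sum (Suc k) ws)"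
proof -
  let ?P = "{S. S \<subseteq> {..<n} \<and> card S = k}"
  have fin: "finite ?P"
    by (rule finite_subset[of _ "Pow {..<n}"]) auto
  have "subset_sum k (ws[i := T_hat (ws ! i)])
      = (\<Sum>S\<in>{S. S \<subseteq> {..<n} \<and> card S = k \<and> i \<notin> S}. semibracket (apply_on T (insert i S) ws))" if i: "i < n" for i
  proof -
    \<comment> \<open>\<open>T_hat\<close> leaves \<open>V\<close>-component 0 in slot
      \<open>i\<close>, so a second application of \<open>T\<close> there produces a zero
      argument.\<close>
    have "semibracket (apply_on T S (ws[i := T_hat (ws ! i)])) = 0" if "i \<in> S" for S
      by (rule semibracket_zero_slot[of _ i])
        (use that i ws in \<open>simp_all add: nth_apply_on T_hat_def T_rules zero_prod_def\<close>)
    then have "subset_sum k (ws[i := T_hat (ws ! i)])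
        = (\<Sum>S\<in>{S. S \<subseteq> {..<n} \<and> card S = k \<and> i \<notin> S}. semibracket (apply_on T S (ws[i := T_hat (ws ! i)])))"
      unfolding subset_sum_def using fin by (intro sum.mono_neutral_right) auto
    also have "\<dots> = (\<Sum>S\<in>{S. S \<subseteq> {..<n} \<and> card S = k \<and> i \<notin> S}. semibracket (apply_on T (insert i S) ws))"
      using i ws by (intro sum.cong refl) (simp add: T_hat_def apply_on_insert)
    finally show ?thesis .
  qed
  then have "(\<Sum>i<n. subset_sum k (ws[i := T_hat (ws ! i)]))
      = (\<Sum>i<n. \<Sum>S\<in>{S. S \<subseteq> {..<n} \<and> card S = k \<and> i \<notin> S}. semibracket (apply_on T (insert i S) ws))"
    by (intro sum.cong) auto
  also have "\<dots> = (\<Sum>S\<in>{S. S \<subseteq> {..<n} \<and> card S = Suc k}. \<Sum>i\<in>S. semibracket (apply_on T S ws))"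
    by (rule sum_insert_subsets) simp
  also have "\<dots> = (\<Sum>S\<in>{S. S \<subseteq> {..<n} \<and> card S = Suc k}. sw (of_nat (Suc k)) (semibracket (apply_on T S ws)))"
    by (intro sum.cong refl) (auto simp only: W.sum_const_scale mem_Collect_eq)
  finally show ?thesis
    by (simp only: subset_sum_def W.scale_sum_right)
qed

lemma subset_sum'_step:
  assumes "length ws = n"
  shows "(\<Sum>i<n. subset_sum' k (ws[i := T_hat (ws ! i)])) = sw (of_nat k) (subset_sum k ws)"
  by (cases k) (simp_all add: subset_sum'_def subset_sum_step[OF assms] del: of_nat_Suc)

text \<open>Since \<open>tau\<close> has degree 0, no signs occur: the bracket with it inserts
  \<open>T_hat\<close> into each of the \<open>n\<close> arguments in turn and subtracts
  \<open>T_hat\<close> of the value.\<close>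

lemma iterated_replicate_Suc:
  assumes "length X = n - 1"
  shows "iterated (replicate (Suc k) tau) [X] x
    = (\<Sum>i<n - 1. iterated (replicate k tau) [X[i := T_hat (X ! i)]] x)
      + iterated (replicate k tau) [X] (T_hat x) - T_hat (iterated (replicate k tau) [X] x)"
proof -
  let ?b = "iterated (replicate k tau)" and ?t = "lift_cochain tau"
  have all2: "list_all2 (\<lambda>P d. P \<in> grading d) (replicate m tau) (replicate m 0)" for m
    using tau_grading by (simp add: list_all2_conv_all_nth)
  have b: "?b \<in> CW" "homog 1 ?b"
    using iterated_closed[OF grading_CV[OF all2[of k]]] iterated_homog[OF all2[of k]] by (simp_all add: sum_list_replicate)
  have t: "?t \<in> CW" "homog 0 ?t"
    using tau_grading by (auto simp: VG.cochain_grading_eq lift_closed lift_homog)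
  have "iterated (replicate (Suc k) tau) = W.bracket ?b ?t"
    by (simp add: iterated_eq replicate_append_same[symmetric] del: replicate_append_same)
  also have "\<dots> = star n ?b ?t - star n ?t ?b"
    by (simp add: W.bracket_homog_eq[OF b t])
  finally have "iterated (replicate (Suc k) tau) [X] x = star n ?b ?t [X] x - star n ?t ?b [X] x"
    by simp
  also have "star n ?b ?t [X] x = ?b [X] (T_hat x) + (\<Sum>i<n - 1. ?b [X[i := T_hat (X ! i)]] x)"
    by (simp add: star.simps(2) lift_tau altsign_Nil W.star_zero_right[OF b(1)] contr_apply)
  also have "star n ?t ?b [X] x = T_hat (?b [X] x)"
  proof -
    have "?t [X[i := ?b [] (X ! i)]] x = 0" for i
      using lift_tau(2)[of "X[i := ?b [] (X ! i)]", THEN fun_cong, of "[]", THEN fun_cong, of x] by (simp add: contr_apply)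
    then show ?thesis
      by (simp add: star.simps(2) lift_tau contr_apply)
  qed
  finally show ?thesis by (simp add: algebra_simps)
qed

lemma iterated_replicate:
  assumes "length X = n - 1"
  shows "iterated (replicate k tau) [X] x
    = sw (fact k) (subset_sum k (X @ [x]) - T_hat (subset_sum' k (X @ [x])))"
  using assms
proof (induction k arbitrary: X x)
  case 0
  have "{S. S \<subseteq> {..<n} \<and> card S = 0} = {{}}"
    using finite_subset[of _ "{..<n}"] by auto
  then show ?case
    using 0 by (simp add: iterated_eq semidirect_single subset_sum_def subset_sum'_def T_hat_rules)
next
  case (Suc k)
  let ?ws = "X @ [x]"
  let ?f = "\<lambda>ws. subset_sum k ws - T_hat (subset_sum' k ws)"
  have ws: "length ?ws = n" using Suc.prems n2 by simp
  have upd: "X[i := T_hat (X ! i)] @ [x] = ?ws[i := T_hat (?ws ! i)]" if "i < n - 1" for i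
    using \<open>i < n - 1\<close> Suc.prems by (simp add: list_update_append nth_append)
  have upd_last: "X @ [T_hat x] = ?ws[n - 1 := T_hat (?ws ! (n - 1))]"
    using Suc.prems by (simp add: list_update_append nth_append)
  have "(\<Sum>i<n - 1. iterated (replicate k tau) [X[i := T_hat (X ! i)]] x) + iterated (replicate k tau) [X] (T_hat x)
      = (\<Sum>i<n - 1. sw (fact k) (?f (?ws[i := T_hat (?ws ! i)]))) + sw (fact k) (?f (?ws[n - 1 := T_hat (?ws ! (n - 1))]))"
  proof (intro arg_cong2[where f = "(+)"] sum.cong refl)
    fix i assume "i \<in> {..<n - 1}"
    then show "iterated (replicate k tau) [X[i := T_hat (X ! i)]] x = sw (fact k) (?f (?ws[i := T_hat (?ws ! i)]))"
      using Suc.IH[of "X[i := T_hat (X ! i)]" x] Suc.prems by (simp only: upd lessThan_iff length_list_update)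
  next
    show "iterated (replicate k tau) [X] (T_hat x) = sw (fact k) (?f (?ws[n - 1 := T_hat (?ws ! (n - 1))]))"
      using Suc.IH[OF Suc.prems, of "T_hat x"] by (simp only: upd_last)
  qed
  also have "\<dots> = (\<Sum>i<Suc (n - 1). sw (fact k) (?f (?ws[i := T_hat (?ws ! i)])))"
    by simp
  also have "Suc (n - 1) = n" using n2 by simp
  also have "(\<Sum>i<n. sw (fact k) (?f (?ws[i := T_hat (?ws ! i)])))
      = sw (fact k) ((\<Sum>i<n. subset_sum k (?ws[i := T_hat (?ws ! i)]))
        - T_hat (\<Sum>i<n. subset_sum' k (?ws[i := T_hat (?ws ! i)])))"
    by (simp only: W.scale_sum_right[symmetric] sum_subtractf T_hat_sum)
  also have "\<dots> = sw (fact k) (sw (of_nat (Suc k)) (subset_sum (Suc k) ?ws) - sw (of_nat k) (T_hat (subset_sum k ?ws)))"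
    by (simp only: subset_sum_step[OF ws] subset_sum'_step[OF ws] T_hat_rules)
  finally have "iterated (replicate (Suc k) tau) [X] x
      = sw (fact k) (sw (of_nat (Suc k)) (subset_sum (Suc k) ?ws) - sw (of_nat k) (T_hat (subset_sum k ?ws)))
        - T_hat (sw (fact k) (?f ?ws))"
    using iterated_replicate_Suc[OF Suc.prems, of k x] Suc.IH[OF Suc.prems, of x] by (simp only:)
  \<comment> \<open>\<open>T_hat\<close> squares to 0, so no term with two factors \<open>L\<close>
    arises.\<close>
  also have "T_hat (sw (fact k) (?f ?ws)) = sw (fact k) (T_hat (subset_sum k ?ws))"
    by (simp only: T_hat_rules diff_zero)
  also have "sw (fact k) (sw (of_nat (Suc k)) (subset_sum (Suc k) ?ws) - sw (of_nat k) (T_hat (subset_sum k ?ws)))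
        - sw (fact k) (T_hat (subset_sum k ?ws))
      = sw (fact (Suc k)) (subset_sum (Suc k) ?ws - T_hat (subset_sum k ?ws))"
  proof -
    \<comment> \<open>Both terms acquire the factor \<open>k + 1\<close>; in the second,
      \<open>k\<close> of it comes from the sum of the \<open>D\<^sub>i\<close> and 1 from the new
      factor \<open>L\<close>.\<close>
    have "sw c (sw (b + 1) A - sw b B) - sw c B = sw ((b + 1) * c) (A - B)" for b c A B
      by (simp add: W.scale_right_diff_distrib W.scale_left_distrib W.scale_right_distrib distrib_left distrib_right mult.commute)
    from this[of "fact k" "of_nat k" "subset_sum (Suc k) ?ws" "T_hat (subset_sum k ?ws)"]
    show ?thesis by (simp only: fact_Suc of_nat_Suc add.commute[of 1])
  qed
  finally show "iterated (replicate (Suc k) tau) [X] x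
      = sw (fact (Suc k)) (subset_sum (Suc k) ?ws - T_hat (subset_sum' (Suc k) ?ws))"
    by (simp add: subset_sum'_def)
qed

text \<open>The case \<open>k = n\<close> with arguments in \<open>V\<close>: the only subset of
  size \<open>n\<close> gives the bracket of the images, and a subset of size \<open>n - 1\<close>
  leaves one argument in \<open>V\<close>, on which the images of the others act through
  \<rho>.\<close>

lemma derived_replicate:
  fixes X :: "'v list" and x :: 'v
  assumes "length X = n - 1"
  defines "vs \<equiv> X @ [x]"
  shows "derived (replicate n tau) [X] x
    = sg (fact n) (br (map T vs) - (\<Sum>i<n. sg ((- 1) ^ (n - 1 - i)) (T (\<rho> (map T (omit i vs)) (vs ! i)))))"
proof -
  let ?ws = "map (Pair 0) vs :: ('g \<times> 'v) list"
  have len: "length vs = n" using assms n2 by simp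
  have all: "apply_on T {..<n} ?ws = map (\<lambda>v. (T v, 0)) vs"
    by (rule nth_equalityI) (simp_all add: nth_apply_on len)
  have "{S. S \<subseteq> {..<n} \<and> card S = n} = {{..<n}}"
  proof (intro equalityI subsetI)
    fix S assume "S \<in> {S. S \<subseteq> {..<n} \<and> card S = n}"
    then have "S = {..<n}" by (intro card_subset_eq) simp_all
    then show "S \<in> {{..<n}}" by simp
  qed simp
  then have 1: "subset_sum n ?ws = (br (map T vs), 0)"
    by (simp add: subset_sum_def all semibracket_def action_def rho_zero len o_def)
  \<comment> \<open>The first component stays unevaluated, since \<open>T_hat\<close> reads only the
    second.\<close>
  have omit1: "semibracket (apply_on T ({..<n} - {i}) ?ws)
      = (br ((map T vs)[i := 0]), sgm (int (n - 1 - i)) (\<rho> (map T (omit i vs)) (vs ! i)))" if i: "i < n" for i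
  proof -
    let ?us = "apply_on T ({..<n} - {i}) ?ws"
    have fst: "map fst ?us = (map T vs)[i := 0]"
      by (rule nth_equalityI) (use len in \<open>auto simp: nth_apply_on nth_list_update\<close>)
    have snd: "snd (?us ! k) = (if k = i then vs ! i else 0)" if "k < n" for k
      using that len by (simp add: nth_apply_on)
    have "action ?us = (\<Sum>k<n. if k = i then sgm (int (n - 1 - i)) (\<rho> (omit i (map T vs)) (vs ! i)) else 0)"
      unfolding action_def
    proof (intro sum.cong refl)
      fix k assume "k \<in> {..<n}"
      then show "sgm (int (n - 1 - k)) (\<rho> (omit k (map fst ?us)) (snd (?us ! k)))
          = (if k = i then sgm (int (n - 1 - i)) (\<rho> (omit i (map T vs)) (vs ! i)) else 0)"
        by (simp add: fst snd omit_update_same rho_zero len)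
    qed
    then show ?thesis
      using i by (simp add: semibracket_def fst map_omit)
  qed
  have img: "{S. S \<subseteq> {..<n} \<and> card S = n - 1} = (\<lambda>i. {..<n} - {i}) ` {..<n}"
  proof (intro set_eqI iffI)
    fix S assume S: "S \<in> {S. S \<subseteq> {..<n} \<and> card S = n - 1}"
    then have "card ({..<n} - S) = 1"
      using n2 by (simp add: card_Diff_subset finite_subset[of S "{..<n}"])
    then obtain i where i: "{..<n} - S = {i}"
      by (rule card_1_singletonE)
    have "S \<subseteq> {..<n}" using S by blast
    then have "i \<in> {..<n}" "S = {..<n} - {i}"
      using i by blast+
    then show "S \<in> (\<lambda>i. {..<n} - {i}) ` {..<n}" by blast
  qed auto
  have inj: "inj_on (\<lambda>i. {..<n} - {i}) {..<n}"
    by (rule inj_onI) auto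
  have "subset_sum' n ?ws = subset_sum (n - 1) ?ws"
    using subset_sum'_Suc[of "n - 1"] n2 by simp
  also have "\<dots> = (\<Sum>i<n. semibracket (apply_on T ({..<n} - {i}) ?ws))"
    unfolding subset_sum_def img by (simp add: sum.reindex[OF inj])
  also have "\<dots> = (\<Sum>i<n. (br ((map T vs)[i := 0]), sgm (int (n - 1 - i)) (\<rho> (map T (omit i vs)) (vs ! i))))"
    by (intro sum.cong) (auto simp: omit1)
  finally have "T_hat (subset_sum' n ?ws) = (\<Sum>i<n. (T (sgm (int (n - 1 - i)) (\<rho> (map T (omit i vs)) (vs ! i))), 0))"
    by (simp only: T_hat_sum) (simp only: T_hat_def snd_conv)
  then have 2: "fst (T_hat (subset_sum' n ?ws)) = (\<Sum>i<n. sg ((- 1) ^ (n - 1 - i)) (T (\<rho> (map T (omit i vs)) (vs ! i))))"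
    by (simp only: fst_sum fst_conv T_sgm G.scale_minus_one_power)
  have "derived (replicate n tau) [X] x = fst (iterated (replicate n tau) [map (Pair 0) X] (0, x))"
    by (simp add: derived_eq restrict_cochain_def)
  also have "\<dots> = fst (sw (fact n) (subset_sum n ?ws - T_hat (subset_sum' n ?ws)))"
    using iterated_replicate[of "map (Pair 0) X" n "(0, x)"] assms by simp
  finally show ?thesis
    by (simp add: sw_eq 1 2)
qed

text \<open>The derived bracket has degree 1, so it is determined by its values on a single block,
  and \<open>fact n\<close> is nonzero in characteristic 0.\<close>

lemma derived_replicate_eq_0_iff: "derived (replicate n tau) = 0 \<longleftrightarrow> relative_rota_baxter n sg br sv \<rho> T"
proof -
  have all2: "list_all2 (\<lambda>P d. P \<in> grading d) (replicate n tau) (replicate n 0)"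
    using tau_grading by (simp add: list_all2_conv_all_nth)
  have gr: "derived (replicate n tau) \<in> CV" "homog 1 (derived (replicate n tau))"
    using derived_grading[OF all2] by (simp_all add: VG.cochain_grading_eq sum_list_replicate)
  define e where "e vs = br (map T vs) - (\<Sum>i<n. sg ((- 1) ^ (n - 1 - i)) (T (\<rho> (map T (omit i vs)) (vs ! i))))" for vs
  have val: "derived (replicate n tau) [X] x = sg (fact n) (e (X @ [x]))" if "length X = n - 1" for X x
    unfolding e_def by (rule derived_replicate[OF that])
  have "derived (replicate n tau) = 0 \<longleftrightarrow> (\<forall>vs. length vs = n \<longrightarrow> e vs = 0)"
  proof
    assume zero: "derived (replicate n tau) = 0"
    show "\<forall>vs. length vs = n \<longrightarrow> e vs = 0"
    proof (intro allI impI)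
      fix vs :: "'v list" assume len: "length vs = n"
      then have "vs \<noteq> []"
        using n2 by auto
      then have "sg (fact n) (e vs) = 0"
        using val[of "butlast vs" "last vs"] len by (simp add: zero)
      then show "e vs = 0"
        by simp
    qed
  next
    assume e: "\<forall>vs. length vs = n \<longrightarrow> e vs = 0"
    show "derived (replicate n tau) = 0"
    proof (intro ext)
      fix Xs x
      show "derived (replicate n tau) Xs x = 0 Xs x"
      proof (cases "\<exists>X. Xs = [X] \<and> length X = n - 1")
        case True
        then show ?thesis using val e n2 by auto
      next
        case False
        have "derived (replicate n tau) Xs = 0"
        proof (cases "length Xs = 1")
          case True
          then show ?thesis
            using False VG.all_cochains_outside[OF gr(1), of Xs] by (auto simp: length_Suc_conv)
        next
          case False
          then show ?thesis using gr(2) by (simp add: homog_def)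
        qed
        then show ?thesis by simp
      qed
    qed
  qed
  also have "\<dots> \<longleftrightarrow> relative_rota_baxter n sg br sv \<rho> T"
    using T by (simp add: relative_rota_baxter_def e_def)
  finally show ?thesis .
qed

end

theorem maurer_cartan_iff:
  "{\<alpha>. maurer_cartan n (scale_cochain sg) grading derived \<alpha>}
    = linear_map_cochain ` {T. relative_rota_baxter n sg br sv \<rho> T}"
proof -
  have mc: "maurer_cartan n (scale_cochain sg) grading derived \<alpha>
      \<longleftrightarrow> \<alpha> \<in> grading 0 \<and> derived (replicate n \<alpha>) = 0" for \<alpha>
    by (auto simp: maurer_cartan_def scale_cochain_def fun_eq_iff)
  \<comment> \<open>A cochain of degree 0 is supported on the empty list of blocks, where it is a
    linear map from \<open>V\<close> to \<gg>.\<close>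
  have rep: "\<alpha> = linear_map_cochain (\<alpha> [])" "Vector_Spaces.linear sv sg (\<alpha> [])" if "\<alpha> \<in> grading 0" for \<alpha>
    using that VG.all_cochains_linear by (auto simp: VG.cochain_grading_eq homog_def linear_map_cochain_def fun_eq_iff)
  show ?thesis
  proof (intro set_eqI iffI)
    fix \<alpha> assume "\<alpha> \<in> {\<alpha>. maurer_cartan n (scale_cochain sg) grading derived \<alpha>}"
    then have \<alpha>: "\<alpha> \<in> grading 0" "derived (replicate n \<alpha>) = 0"
      by (simp_all add: mc)
    have "relative_rota_baxter n sg br sv \<rho> (\<alpha> [])"
      using derived_replicate_eq_0_iff[OF rep(2)[OF \<alpha>(1)]] \<alpha>(2) rep(1)[OF \<alpha>(1)] by simp
    then show "\<alpha> \<in> linear_map_cochain ` {T. relative_rota_baxter n sg br sv \<rho> T}"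
      using rep(1)[OF \<alpha>(1)] by blast
  next
    fix \<alpha> assume "\<alpha> \<in> linear_map_cochain ` {T. relative_rota_baxter n sg br sv \<rho> T}"
    then obtain T where T: "\<alpha> = linear_map_cochain T" "relative_rota_baxter n sg br sv \<rho> T"
      by blast
    then have "Vector_Spaces.linear sv sg T"
      by (simp add: relative_rota_baxter_def)
    then show "\<alpha> \<in> {\<alpha>. maurer_cartan n (scale_cochain sg) grading derived \<alpha>}"
      using T derived_replicate_eq_0_iff tau_grading by (simp add: mc)
  qed
qed

end

theorem theorem3p10:
  fixes n :: nat
    and sg :: "'k::{alg_closed_field, field_char_0} \<Rightarrow> 'g::ab_group_add \<Rightarrow> 'g" and Bg :: "'g set"
    and sv :: "'k \<Rightarrow> 'v::ab_group_add \<Rightarrow> 'v" and Bv :: "'v set"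
    and br :: "'g list \<Rightarrow> 'g" and \<rho> :: "'g list \<Rightarrow> 'v \<Rightarrow> 'v"
  assumes "n \<ge> 2"
    and "finite_dimensional_vector_space sg Bg"
    and "finite_dimensional_vector_space sv Bv"
    and "n_lie_rep_pair n sg br sv \<rho>"
  shows "(\<forall>Ps ms. length Ps = n \<and> list_all2 (\<lambda>P m. P \<in> cochains n sv sg m) Ps ms \<longrightarrow>
           iterated_bracket n sg br sv \<rho> Ps = lift_cochain (derived_bracket n sg br sv \<rho> Ps) \<and>
           derived_bracket n sg br sv \<rho> Ps \<in> cochains n sv sg (sum_list ms + 1))
       \<and> lie_n_algebra n (scale_cochain sg) (cochain_grading n sv sg) (derived_bracket n sg br sv \<rho>)
       \<and> {\<alpha>. maurer_cartan n (scale_cochain sg) (cochain_grading n sv sg)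
                (derived_bracket n sg br sv \<rho>) \<alpha>}
         = linear_map_cochain ` {T. relative_rota_baxter n sg br sv \<rho> T}"
proof -
  interpret G: finite_dimensional_vector_space sg Bg by fact
  interpret V: finite_dimensional_vector_space sv Bv by fact
  interpret nlie_rep_char_0 sg sv n br \<rho>
    by unfold_locales (fact assms)+
  have "iterated Ps = lift_cochain (derived Ps) \<and> derived Ps \<in> cochains n sv sg (sum_list ms + 1)"
    if Ps: "length Ps = n" "list_all2 (\<lambda>P m. P \<in> cochains n sv sg m) Ps ms" for Ps ms
  proof -
    \<comment> \<open>Degrees are natural numbers in \<open>cochains\<close> but integers in the
      grading, so \<open>ms\<close> is converted first.\<close>
    have gr: "list_all2 (\<lambda>P d. P \<in> grading d) Ps (map int ms)"
      using Ps(2) by (simp add: list_all2_conv_all_nth cochain_grading_def)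
    have sum: "sum_list (map int ms) + 1 = int (sum_list ms + 1)"
      by (induction ms) auto
    show ?thesis
      using iterated_lift[OF grading_CV[OF gr] Ps(1)] derived_grading[OF gr]
      unfolding sum cochain_grading_def nat_int by simp
  qed
  then show ?thesis
    using lie_n_algebra_derived maurer_cartan_iff by blast
qed

end
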